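(* Let $\delta, K_1, K_2, C_0, C_1$ be admissible parameters. Then the class $\mathcal{A}^\delta_{K_1,K_2,C_0,C_1}$ has the extension property for partial automorphisms (EPPA).
   Context: A $\delta$-valued metric space $(V,d)$ (a metric space with distances in $\{0,\dots,\delta\}$) is identified with the relational structure $(V,R^1,\dots,R^\delta)$, $(x,y)\in R^i$ iff $d(x,y)=i$. Parameters $\delta,K_1,K_2,C_0,C_1$ are positive integers; acceptable if $3\le\delta<\infty$, $1\le K_1\le K_2\le\delta$, $2\delta+2\le C_0,C_1\le 3\delta+2$, $C_0$ even, $C_1$ odd. Let $C=\min(C_0,C_1)$, $C'=\max(C_0,C_1)$. Admissible: acceptable and either (II) $C\le 2\delta+K_1$, $C=2K_1+2K_2+1$, $K_1+K_2\ge\delta$, $K_1+2K_2\le 2\delta-1$, and either (IIA) $C'=C+1$ or (IIB) $C'>C+1$, $K_1=K_2$, $3K_2=2\delta-1$; or (III) $C\ge 2\delta+K_1+1$, $K_1+2K_2\ge 2\delta-1$, $3K_2\ge 2\delta$, if $K_1+2K_2=2\delta-1$ then $C\ge 2\delta+K_1+2$, and if $C'>C+1$ then $C\ge 2\delta+K_2$. $\mathcal{A}^\delta_{K_1,K_2,C_0,C_1}$ is the class of finite $\delta$-valued metric spaces such that for every three distinct points with perimeter $p$ and smallest distance $m$: if $p$ is odd then $2K_1<p$, $p<2K_2+2m$, $p<C_1$; if $p$ is even then $p<C_0$. A class $\mathcal{C}$ of finite structures has EPPA if for every $\mathbf{A}\in\mathcal{C}$ there are $\mathbf{B}\in\mathcal{C}$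 and an embedding $\alpha:\mathbf{A}\to\mathbf{B}$ such that for every partial automorphism $f$ of $\mathbf{A}$ (an isomorphism between substructures of $\mathbf{A}$) there is an automorphism $g$ of $\mathbf{B}$ with $\alpha\circ f\subseteq g\circ\alpha$. *)

theory Defs
  imports "HOL-Analysis.Abstract_Metric_Spaces" "HOL-Library.Infinite_Typeclass"
begin

text \<open>
  Structures with binary relations indexed by \<open>'i\<close>. A structure over a smaller language is
  represented by leaving the relations of the unused indices empty; this does not affect
  substructures, embeddings or isomorphisms.
\<close>

record ('i, 'v) rel_structure =
  verts :: "'v set"
  rels :: "'i \<Rightarrow> 'v rel"

definition induced :: "('i, 'v) rel_structure \<Rightarrow> 'v set \<Rightarrow> ('i, 'v) rel_structure" where
  "induced A D = \<lparr>verts = D, rels = (\<lambda>i. rels A i \<inter> D \<times> D)\<rparr>"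

text \<open>Maps between structures are total functions, of which only the values on the vertex set of
  the source are relevant.\<close>

definition embedding ::
  "('i, 'v) rel_structure \<Rightarrow> ('i, 'w) rel_structure \<Rightarrow> ('v \<Rightarrow> 'w) \<Rightarrow> bool" where
  "embedding A B h \<longleftrightarrow>
     h ` verts A \<subseteq> verts B \<and> inj_on h (verts A) \<and>
     (\<forall>i. \<forall>x\<in>verts A. \<forall>y\<in>verts A. (x, y) \<in> rels A i \<longleftrightarrow> (h x, h y) \<in> rels B i)"

definition isomorphism ::
  "('i, 'v) rel_structure \<Rightarrow> ('i, 'w) rel_structure \<Rightarrow> ('v \<Rightarrow> 'w) \<Rightarrow> bool" where
  "isomorphism A B h \<longleftrightarrow> embedding A B h \<and> h ` verts A = verts B"

definition automorphism :: "('i, 'v) rel_structure \<Rightarrow> ('v \<Rightarrow> 'v) \<Rightarrow> bool" where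
  "automorphism A g \<longleftrightarrow> isomorphism A A g"

definition partial_automorphism ::
  "('i, 'v) rel_structure \<Rightarrow> 'v set \<Rightarrow> ('v \<Rightarrow> 'v) \<Rightarrow> bool" where
  "partial_automorphism A D f \<longleftrightarrow>
     (\<exists>E. D \<subseteq> verts A \<and> E \<subseteq> verts A \<and> isomorphism (induced A D) (induced A E) f)"

text \<open>
  A class of finite structures is given by its members with vertices in a type \<open>'v\<close>; if \<open>'v\<close> is
  infinite, every finite structure has an isomorphic copy there.
\<close>

definition has_EPPA :: "('i, 'v) rel_structure set \<Rightarrow> bool" where
  "has_EPPA \<C> \<longleftrightarrow>
     (\<forall>A\<in>\<C>. \<exists>B\<in>\<C>. \<exists>\<alpha>. embedding A B \<alpha> \<and>
        (\<forall>D f. partial_automorphism A D f \<longrightarrow>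
           (\<exists>g. automorphism B g \<and> (\<forall>x\<in>D. \<alpha> (f x) = g (\<alpha> x)))))"

text \<open>The locale \<^locale>\<open>Metric_space\<close> also asks for symmetry of \<open>d\<close> outside \<open>V\<close>; this is no
  restriction on the structure below, which depends only on \<open>d\<close> on \<open>V\<close>.\<close>

definition valued_metric_space :: "nat \<Rightarrow> 'v set \<Rightarrow> ('v \<Rightarrow> 'v \<Rightarrow> nat) \<Rightarrow> bool" where
  "valued_metric_space \<delta> V d \<longleftrightarrow>
     Metric_space V (\<lambda>x y. real (d x y)) \<and> (\<forall>x\<in>V. \<forall>y\<in>V. d x y \<le> \<delta>)"

definition metric_structure ::
  "nat \<Rightarrow> 'v set \<Rightarrow> ('v \<Rightarrow> 'v \<Rightarrow> nat) \<Rightarrow> (nat, 'v) rel_structure" where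
  "metric_structure \<delta> V d =
     \<lparr>verts = V,
      rels = (\<lambda>i. if i \<in> {1..\<delta>} then {(x, y) \<in> V \<times> V. d x y = i} else {})\<rparr>"

definition acceptable :: "nat \<Rightarrow> nat \<Rightarrow> nat \<Rightarrow> nat \<Rightarrow> nat \<Rightarrow> bool" where
  "acceptable \<delta> K\<^sub>1 K\<^sub>2 C\<^sub>0 C\<^sub>1 \<longleftrightarrow>
     3 \<le> \<delta> \<and> 1 \<le> K\<^sub>1 \<and> K\<^sub>1 \<le> K\<^sub>2 \<and> K\<^sub>2 \<le> \<delta> \<and>
     2 * \<delta> + 2 \<le> C\<^sub>0 \<and> C\<^sub>0 \<le> 3 * \<delta> + 2 \<and>
     2 * \<delta> + 2 \<le> C\<^sub>1 \<and> C\<^sub>1 \<le> 3 * \<delta> + 2 \<and>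
     even C\<^sub>0 \<and> odd C\<^sub>1"

text \<open>In the next two definitions \<open>C\<close> and \<open>C'\<close> stand for the minimum and the maximum of
  \<open>C\<^sub>0\<close> and \<open>C\<^sub>1\<close>.\<close>

definition case_II :: "nat \<Rightarrow> nat \<Rightarrow> nat \<Rightarrow> nat \<Rightarrow> nat \<Rightarrow> bool" where
  "case_II \<delta> K\<^sub>1 K\<^sub>2 C C' \<longleftrightarrow>
     C \<le> 2 * \<delta> + K\<^sub>1 \<and> C = 2 * K\<^sub>1 + 2 * K\<^sub>2 + 1 \<and>
     K\<^sub>1 + K\<^sub>2 \<ge> \<delta> \<and> K\<^sub>1 + 2 * K\<^sub>2 \<le> 2 * \<delta> - 1 \<and>
     (C' = C + 1 \<or>
      C' > C + 1 \<and> K\<^sub>1 = K\<^sub>2 \<and> 3 * K\<^sub>2 = 2 * \<delta> - 1)"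

definition case_III :: "nat \<Rightarrow> nat \<Rightarrow> nat \<Rightarrow> nat \<Rightarrow> nat \<Rightarrow> bool" where
  "case_III \<delta> K\<^sub>1 K\<^sub>2 C C' \<longleftrightarrow>
     C \<ge> 2 * \<delta> + K\<^sub>1 + 1 \<and>
     K\<^sub>1 + 2 * K\<^sub>2 \<ge> 2 * \<delta> - 1 \<and> 3 * K\<^sub>2 \<ge> 2 * \<delta> \<and>
     (K\<^sub>1 + 2 * K\<^sub>2 = 2 * \<delta> - 1 \<longrightarrow> C \<ge> 2 * \<delta> + K\<^sub>1 + 2) \<and>
     (C' > C + 1 \<longrightarrow> C \<ge> 2 * \<delta> + K\<^sub>2)"

definition admissible :: "nat \<Rightarrow> nat \<Rightarrow> nat \<Rightarrow> nat \<Rightarrow> nat \<Rightarrow> bool" where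
  "admissible \<delta> K\<^sub>1 K\<^sub>2 C\<^sub>0 C\<^sub>1 \<longleftrightarrow>
     acceptable \<delta> K\<^sub>1 K\<^sub>2 C\<^sub>0 C\<^sub>1 \<and>
     (case_II \<delta> K\<^sub>1 K\<^sub>2 (min C\<^sub>0 C\<^sub>1) (max C\<^sub>0 C\<^sub>1) \<or>
      case_III \<delta> K\<^sub>1 K\<^sub>2 (min C\<^sub>0 C\<^sub>1) (max C\<^sub>0 C\<^sub>1))"

definition triangle_ok :: "nat \<Rightarrow> nat \<Rightarrow> nat \<Rightarrow> nat \<Rightarrow> nat \<Rightarrow> nat \<Rightarrow> nat \<Rightarrow> bool" where
  "triangle_ok K\<^sub>1 K\<^sub>2 C\<^sub>0 C\<^sub>1 a b c \<longleftrightarrow>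
     (let p = a + b + c; m = Min {a, b, c} in
        (odd p \<longrightarrow> 2 * K\<^sub>1 < p \<and> p < 2 * K\<^sub>2 + 2 * m \<and> p < C\<^sub>1) \<and>
        (even p \<longrightarrow> p < C\<^sub>0))"

definition metric_class ::
  "nat \<Rightarrow> nat \<Rightarrow> nat \<Rightarrow> nat \<Rightarrow> nat \<Rightarrow> (nat, 'v) rel_structure set" where
  "metric_class \<delta> K\<^sub>1 K\<^sub>2 C\<^sub>0 C\<^sub>1 =
     {metric_structure \<delta> V d | V d.
        finite V \<and> valued_metric_space \<delta> V d \<and>
        (\<forall>x\<in>V. \<forall>y\<in>V. \<forall>z\<in>V. x \<noteq> y \<and> y \<noteq> z \<and> x \<noteq> z \<longrightarrow>
           triangle_ok K\<^sub>1 K\<^sub>2 C\<^sub>0 C\<^sub>1 (d x y) (d y z) (d x z))}"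

end

theory Submission
  imports Defs "HOL-Library.Multiset" "HOL-Library.FuncSet" "HOL-Combinatorics.Permutations"
begin

text \<open>
  Every triangle inequality defining the class follows a pattern \<open>\<Phi> k c r\<close>, where the labels of the
  triangle are split into \<open>k\<close> chosen ones with sum \<open>c\<close> and the others with sum \<open>r\<close>. Imposing the pattern
  on all splittings of the labels of all closed walks gives conditions that are preserved when two
  closed walks are glued along an edge. Hence the shortest bad closed walks of a labelled graph
  are induced cycles, and they can be destroyed, keeping EPPA for the given complete graph, by passing to
  a lift in which each vertex carries one bit for every bad cycle through it. After finitely many steps
  starting from a finite complete multipartite EPPA-witness, all closed walks of length at most \<open>20 * \<delta>\<close> are good.
  Such a graph has a canonical completion: each non-edge receives the admissible distance closest
  to a magic distance \<open>M\<close>. A forbidden triangle of the completion would unfold to a short bad closed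
  walk. Being canonical, the completion keeps all automorphisms.
\<close>

section \<open>Conditions on closed walks\<close>

text \<open>A lift can only destroy closed walks without chords, so a bad closed walk with a chord
  must always have a bad part. Linear inequalities imposed on all splittings have this property: the
  label of the chord is chosen in one part and unchosen in the other, hence cancels. The bounds by
  \<open>K\<^sub>1\<close>, \<open>K\<^sub>2\<close>, \<open>C\<^sub>0\<close>,
  \<open>C\<^sub>1\<close> depend on the parity of the perimeter. They survive because an odd closed
  walk falls into one odd and one even part: the odd part supplies the parity bound, the even part
  only a metric bound. In extremal cases this is one unit short, and parity or the exceptional
  clauses of admissibility must save it. Four versions of \<open>\<Phi>\<close> are needed. If the
  bounds \<open>C\<^sub>0\<close> and \<open>C\<^sub>1\<close> are consecutive, one number
  \<open>Q\<close>, the smaller bound minus 1, controls all perimeters; otherwise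
  \<open>Q = 3 * \<delta>\<close> and the perimeter bounds become separate inequalities. The
  constant \<open>20 * \<delta>\<close> is generous: lengths in a double cover bound the number of
  edges, and the violations met below unfold to closed walks of at most \<open>10 * \<delta>\<close>
  edges.\<close>

lemma split_add_mset_iff:
  "(\<forall>ch oth. add_mset x ls = ch + oth \<longrightarrow> P ch oth) \<longleftrightarrow>
   (\<forall>ch oth. ls = ch + oth \<longrightarrow> P (add_mset x ch) oth \<and> P ch (add_mset x oth))"
proof safe
  fix ch oth
  assume P: "\<forall>ch' oth'. ls = ch' + oth' \<longrightarrow> P (add_mset x ch') oth' \<and> P ch' (add_mset x oth')"
    and eq: "add_mset x ls = ch + oth"
  have "x \<in># ch + oth" by (simp flip: eq)
  then consider "x \<in># ch" | "x \<in># oth" by auto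
  then show "P ch oth"
  proof cases
    case 1
    then have "ls = (ch - {#x#}) + oth"
      using eq by (metis add_mset_remove_trivial diff_union_single_conv union_commute)
    with P have "P (add_mset x (ch - {#x#})) oth" by blast
    with 1 show ?thesis by simp
  next
    case 2
    then have "ls = ch + (oth - {#x#})"
      using eq by (metis add_mset_remove_trivial diff_union_single_conv)
    with P have "P ch (add_mset x (oth - {#x#}))" by blast
    with 2 show ?thesis by simp
  qed
qed auto

text \<open>The Riesz refinement property for multisets, with as many elements of \<open>ch\<close>
  as possible taken from \<open>u\<close>. It restricts a splitting of a glued walk to its two
  parts.\<close>

lemma mset_refinement:
  fixes u v ch oth :: "'a multiset"
  assumes "u + v = ch + oth"
  obtains ch1 oth1 ch2 oth2 where "u = ch1 + oth1" "v = ch2 + oth2" "ch = ch1 + ch2" "oth = oth1 + oth2"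
proof
  let ?c = "u \<inter># ch"
  have "count u x + count v x = count ch x + count oth x" for x
    using assms by (metis count_union)
  note * = this
  show "u = ?c + (u - ?c)" by (auto simp: multiset_eq_iff min_def)
  show "v = (ch - ?c) + (oth - (u - ?c))"
  proof (rule multiset_eqI)
    fix x show "count v x = count ((ch - ?c) + (oth - (u - ?c))) x" using *[of x] by (auto simp: min_def)
  qed
  show "ch = ?c + (ch - ?c)" by (auto simp: multiset_eq_iff min_def)
  show "oth = (u - ?c) + (oth - (u - ?c))"
  proof (rule multiset_eqI)
    fix x show "count oth x = count ((u - ?c) + (oth - (u - ?c))) x" using *[of x] by (auto simp: min_def)
  qed
qed

lemma sum_mset_le_bound:
  fixes ls :: "nat multiset"
  assumes "set_mset ls \<subseteq> {..\<delta>}"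
  shows "sum_mset ls \<le> size ls * \<delta>"
  using assms by (induction ls) auto

definition good :: "(nat \<Rightarrow> nat \<Rightarrow> nat \<Rightarrow> bool) \<Rightarrow> nat multiset \<Rightarrow> bool" where
  "good \<Phi> ls \<longleftrightarrow> (\<forall>ch oth. ls = ch + oth \<longrightarrow> \<Phi> (size ch) (sum_mset ch) (sum_mset oth))"

text \<open>Unfolding this down to \<open>good_empty\<close> turns goodness of an explicit multiset
  into the finite list of its splittings.\<close>

lemma good_add_mset:
  "good \<Phi> (add_mset x ls) \<longleftrightarrow>
   good (\<lambda>k c r. \<Phi> (Suc k) (x + c) r \<and> \<Phi> k c (x + r)) ls"
  unfolding good_def split_add_mset_iff by simp

lemma good_empty: "good \<Phi> {#} \<longleftrightarrow> \<Phi> 0 0 0"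
  by (simp add: good_def)

text \<open>In \<open>\<Phi>_glue\<close> the common edge has label \<open>e\<close>; the premises
  are the two closed walks with \<open>e\<close> once unchosen and once chosen.
  \<open>\<Phi>_zero\<close> allows a repeated vertex to be treated as a chord of label 0. The
  bounds \<open>c \<le> k * \<delta>\<close> hold because \<open>c\<close> is a sum of
  \<open>k\<close> labels.\<close>

locale cycle_condition =
  fixes \<delta> :: nat and \<Phi> :: "nat \<Rightarrow> nat \<Rightarrow> nat \<Rightarrow> bool"
  assumes \<Phi>_empty: "\<Phi> 0 0 0"
    and \<Phi>_edge: "\<And>a. 1 \<le> a \<Longrightarrow> a \<le> \<delta> \<Longrightarrow> good \<Phi> {#a, a#}"
    and \<Phi>_zero: "\<And>k c r. c \<le> k * \<delta> \<Longrightarrow> \<Phi> k c r \<Longrightarrow> \<Phi> (Suc k) c r"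
    and \<Phi>_glue: "\<And>e k1 c1 r1 k2 c2 r2. e \<le> \<delta> \<Longrightarrow> c1 \<le> k1 * \<delta> \<Longrightarrow> c2 \<le> k2 * \<delta> \<Longrightarrow>
      \<Phi> k1 c1 (e + r1) \<Longrightarrow> \<Phi> (Suc k1) (e + c1) r1 \<Longrightarrow>
      \<Phi> k2 c2 (e + r2) \<Longrightarrow> \<Phi> (Suc k2) (e + c2) r2 \<Longrightarrow> \<Phi> (k1 + k2) (c1 + c2) (r1 + r2)"
begin

lemma good_zero:
  assumes "set_mset u \<subseteq> {..\<delta>}" "good \<Phi> u"
  shows "good \<Phi> (add_mset 0 u)"
  unfolding good_add_mset
proof (unfold good_def, intro allI impI)
  fix ch oth assume eq: "u = ch + oth"
  have "sum_mset ch \<le> size ch * \<delta>" using assms(1) eq by (intro sum_mset_le_bound) auto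
  with assms(2) eq show "\<Phi> (Suc (size ch)) (0 + sum_mset ch) (sum_mset oth) \<and> \<Phi> (size ch) (sum_mset ch) (0 + sum_mset oth)"
    by (auto simp: good_def intro: \<Phi>_zero)
qed

lemma good_glue:
  assumes "set_mset u \<subseteq> {..\<delta>}" "set_mset v \<subseteq> {..\<delta>}" "e \<le> \<delta>"
    and "good \<Phi> (add_mset e u)" "good \<Phi> (add_mset e v)"
  shows "good \<Phi> (u + v)"
proof (unfold good_def, intro allI impI)
  fix ch oth assume "u + v = ch + oth"
  then obtain ch1 oth1 ch2 oth2 where
    eq: "u = ch1 + oth1" "v = ch2 + oth2" "ch = ch1 + ch2" "oth = oth1 + oth2"
    by (rule mset_refinement)
  have "sum_mset ch1 \<le> size ch1 * \<delta>" "sum_mset ch2 \<le> size ch2 * \<delta>"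
    using assms(1,2) eq by (auto intro!: sum_mset_le_bound)
  with assms(3-5) eq show "\<Phi> (size ch) (sum_mset ch) (sum_mset oth)"
    unfolding good_add_mset by (auto simp: good_def intro!: \<Phi>_glue[of e])
qed

end

section \<open>Labelled graphs and walks\<close>

text \<open>The label \<open>0\<close> marks non-edges.\<close>

definition lgraph :: "nat \<Rightarrow> 'b set \<Rightarrow> ('b \<Rightarrow> 'b \<Rightarrow> nat) \<Rightarrow> bool" where
  "lgraph \<delta> V d \<longleftrightarrow> finite V \<and> (\<forall>x y. d x y = d y x) \<and> (\<forall>x. d x x = 0) \<and> (\<forall>x y. d x y \<le> \<delta>) \<and>
     (\<forall>x y. d x y \<noteq> 0 \<longrightarrow> x \<in> V \<and> y \<in> V)"

definition lgraph_auto :: "'b set \<Rightarrow> ('b \<Rightarrow> 'b \<Rightarrow> nat) \<Rightarrow> ('b \<Rightarrow> 'b) \<Rightarrow> bool" where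
  "lgraph_auto V d g \<longleftrightarrow> g permutes V \<and> (\<forall>x y. d (g x) (g y) = d x y)"

definition partial_isometry :: "'a set \<Rightarrow> ('a \<Rightarrow> 'a \<Rightarrow> nat) \<Rightarrow> 'a set \<Rightarrow> ('a \<Rightarrow> 'a) \<Rightarrow> bool" where
  "partial_isometry X \<rho> D f \<longleftrightarrow> D \<subseteq> X \<and> f ` D \<subseteq> X \<and> inj_on f D \<and> (\<forall>x\<in>D. \<forall>y\<in>D. \<rho> (f x) (f y) = \<rho> x y)"

text \<open>Injectivity of \<open>\<alpha>\<close> on \<open>X\<close> is not listed: it follows
  from the labels once distinct points of \<open>X\<close> have nonzero label and \<open>d\<close>
  vanishes on the diagonal.\<close>

definition EPPA_witness ::
  "'a set \<Rightarrow> ('a \<Rightarrow> 'a \<Rightarrow> nat) \<Rightarrow> 'b set \<Rightarrow> ('b \<Rightarrow> 'b \<Rightarrow> nat) \<Rightarrow> ('a \<Rightarrow> 'b) \<Rightarrow> bool" where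
  "EPPA_witness X \<rho> V d \<alpha> \<longleftrightarrow> \<alpha> ` X \<subseteq> V \<and> (\<forall>x\<in>X. \<forall>y\<in>X. d (\<alpha> x) (\<alpha> y) = \<rho> x y) \<and>
     (\<forall>D f. partial_isometry X \<rho> D f \<longrightarrow> (\<exists>g. lgraph_auto V d g \<and> (\<forall>x\<in>D. g (\<alpha> x) = \<alpha> (f x))))"

fun labs :: "('b \<Rightarrow> 'b \<Rightarrow> nat) \<Rightarrow> 'b list \<Rightarrow> nat multiset" where
  "labs d (x # y # zs) = add_mset (d x y) (labs d (y # zs))"
| "labs d _ = {#}"

fun walk :: "('b \<Rightarrow> 'b \<Rightarrow> nat) \<Rightarrow> 'b list \<Rightarrow> bool" where
  "walk d (x # y # zs) \<longleftrightarrow> d x y \<noteq> 0 \<and> walk d (y # zs)"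
| "walk d _ \<longleftrightarrow> True"

lemma labs_split: "labs d (xs @ x # ys) = labs d (xs @ [x]) + labs d (x # ys)"
  by (induction xs rule: induct_list012) auto

lemma labs_map: "labs d (map g c) = labs (\<lambda>x y. d (g x) (g y)) c"
  by (induction c rule: induct_list012) auto

lemma labs_rev:
  assumes "\<And>x y. d x y = d y x"
  shows "labs d (rev c) = labs d c"
proof (induction c rule: induct_list012)
  case (3 x y zs)
  then show ?case using assms[of y x] by (simp add: labs_split[of d "rev zs" y "[x]"])
qed auto

lemma size_labs: "size (labs d c) = length c - 1"
  by (induction c rule: induct_list012) auto

lemma set_labs: "lgraph \<delta> V d \<Longrightarrow> set_mset (labs d c) \<subseteq> {..\<delta>}"
proof -
  assume "lgraph \<delta> V d"
  then have "d x y \<le> \<delta>" for x y by (simp add: lgraph_def)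
  then show ?thesis by (induction c rule: induct_list012) auto
qed

lemma walk_split: "walk d (xs @ x # ys) \<longleftrightarrow> walk d (xs @ [x]) \<and> walk d (x # ys)"
  by (induction xs rule: induct_list012) auto

lemma walk_map: "walk d (map g c) \<longleftrightarrow> walk (\<lambda>x y. d (g x) (g y)) c"
  by (induction c rule: induct_list012) auto

lemma walk_rev:
  assumes "\<And>x y. d x y = d y x"
  shows "walk d (rev c) \<longleftrightarrow> walk d c"
proof (induction c rule: induct_list012)
  case (3 x y zs)
  then show ?case using assms[of y x] by (auto simp: walk_split[of d "rev zs" y "[x]"])
qed auto

text \<open>\<open>n\<close> counts edges; the list of a closed walk repeats its first vertex at the
  end, whence \<open>Suc n\<close>.\<close>

definition cycles_good :: "(nat \<Rightarrow> nat \<Rightarrow> nat \<Rightarrow> bool) \<Rightarrow> ('b \<Rightarrow> 'b \<Rightarrow> nat) \<Rightarrow> nat \<Rightarrow> bool" where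
  "cycles_good \<Phi> d n \<longleftrightarrow> (\<forall>c. walk d c \<longrightarrow> c \<noteq> [] \<longrightarrow> hd c = last c \<longrightarrow> length c \<le> Suc n \<longrightarrow> good \<Phi> (labs d c))"

section \<open>Shortest bad closed walks are induced cycles\<close>

context cycle_condition
begin

text \<open>Such a walk is trivial or runs back and forth along one edge. This starts the induction
  on the length of walks.\<close>

lemma cycles_good_2:
  assumes "lgraph \<delta> V d"
  shows "cycles_good \<Phi> d 2"
  unfolding cycles_good_def
proof (intro allI impI)
  fix c assume c: "walk d c" "c \<noteq> []" "hd c = last c" "length c \<le> Suc 2"
  then consider x where "c = [x]" | x y where "c = [x, y]" | x y z where "c = [x, y, z]"
    by (auto simp: numeral_2_eq_2 le_Suc_eq length_Suc_conv)
  then show "good \<Phi> (labs d c)"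
  proof cases
    case 1 then show ?thesis by (simp add: good_empty \<Phi>_empty)
  next
    case 2 then show ?thesis using c assms by (auto simp: lgraph_def)
  next
    case (3 x y z)
    then have "z = x" using c by simp
    moreover have "d y x = d x y" "d x y \<le> \<delta>" using assms by (auto simp: lgraph_def)
    ultimately show ?thesis using 3 c \<Phi>_edge[of "d x y"] by auto
  qed
qed

text \<open>Cutting the cyclic list \<open>U\<close> at \<open>x\<close> and \<open>y\<close> leaves
  two closed walks with fewer edges, both good by \<open>cg\<close>, which \<open>good_glue\<close>
  puts together. If \<open>x = y\<close>, the chord has label 0 and \<open>good_zero\<close> adds
  it. The conditions on \<open>as\<close>, \<open>bs\<close>, \<open>cs\<close> say that
  \<open>x\<close> and \<open>y\<close> are not neighbours on the cycle.\<close>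

lemma good_of_chord:
  assumes G: "lgraph \<delta> V d" and cg: "cycles_good \<Phi> d (k - 1)"
    and U: "U = as @ x # bs @ y # cs" "length U = k" "walk d (U @ [hd U])"
    and bs: "bs \<noteq> []" and ac: "as \<noteq> [] \<or> cs \<noteq> []" and xy: "x = y \<or> d x y \<noteq> 0"
  shows "good \<Phi> (labs d (U @ [hd U]))"
proof -
  define h where "h = hd U"
  define u where "u = labs d (x # bs @ [y])"
  define v where "v = labs d (as @ [x]) + labs d (y # cs @ [h])"
  have w: "walk d (as @ [x])" "walk d (x # bs @ [y])" "walk d (y # cs @ [h])"
    using U(3) unfolding h_def[symmetric] unfolding U(1)
    using walk_split[of d as x "bs @ y # cs @ [h]"] walk_split[of d "x # bs" y "cs @ [h]"] by auto
  have lab: "labs d (U @ [hd U]) = u + v"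
    unfolding h_def[symmetric] unfolding U(1) u_def v_def
    using labs_split[of d as x "bs @ y # cs @ [h]"] labs_split[of d "x # bs" y "cs @ [h]"] by simp
  have sym: "d y x = d x y" and bnd: "d x y \<le> \<delta>" using G by (auto simp: lgraph_def)
  have k: "k = length as + length bs + length cs + 2" using U by simp
  have lens: "length as + length cs \<ge> 1" "length bs \<ge> 1"
    using bs ac by (simp_all add: Suc_le_eq)
  have "set_mset u \<subseteq> {..\<delta>}" "set_mset v \<subseteq> {..\<delta>}" using set_labs[OF G] by (auto simp: u_def v_def)
  note sets = this
  have goods: "good \<Phi> (add_mset (d x y) u) \<and> good \<Phi> (add_mset (d x y) v)"
  proof (cases "x = y")
    case True
    have d0: "d x y = 0" using True G by (auto simp: lgraph_def)
    have "good \<Phi> (labs d (x # bs @ [y]))"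
      using cg[unfolded cycles_good_def, rule_format, of "x # bs @ [y]"] w(2) True k lens by auto
    moreover have "good \<Phi> (labs d (as @ x # cs @ [h]))"
      using cg[unfolded cycles_good_def, rule_format, of "as @ x # cs @ [h]"] w True k lens
        walk_split[of d as x "cs @ [h]"] U(1) by (auto simp: h_def hd_append)
    moreover have "labs d (as @ x # cs @ [h]) = v"
      using True labs_split[of d as x "cs @ [h]"] by (simp add: v_def)
    ultimately show ?thesis using good_zero sets d0 by (auto simp: u_def)
  next
    case False
    then have e: "d x y \<noteq> 0" using xy by auto
    have "walk d (x # bs @ y # [x])" using w(2) e sym walk_split[of d "x # bs" y "[x]"] by auto
    then have "good \<Phi> (labs d (x # bs @ y # [x]))"
      using cg[unfolded cycles_good_def, rule_format, of "x # bs @ y # [x]"] k lens by auto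
    moreover have "labs d (x # bs @ y # [x]) = add_mset (d x y) u"
      using labs_split[of d "x # bs" y "[x]"] sym by (simp add: u_def)
    moreover have "walk d (as @ x # y # cs @ [h])" using w e walk_split[of d as x "y # cs @ [h]"] by auto
    then have "good \<Phi> (labs d (as @ x # y # cs @ [h]))"
      using cg[unfolded cycles_good_def, rule_format, of "as @ x # y # cs @ [h]"] k lens U(1)
      by (auto simp: h_def hd_append)
    moreover have "labs d (as @ x # y # cs @ [h]) = add_mset (d x y) v"
      using labs_split[of d as x "y # cs @ [h]"] by (simp add: v_def)
    ultimately show ?thesis by simp
  qed
  show ?thesis unfolding lab using good_glue[OF sets bnd] goods by blast
qed

lemma bad_cycle_distinct:
  assumes G: "lgraph \<delta> V d" and cg: "cycles_good \<Phi> d (k - 1)"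
    and U: "length U = k" "walk d (U @ [hd U])" and bad: "\<not> good \<Phi> (labs d (U @ [hd U]))"
  shows "distinct U"
proof (rule ccontr)
  assume "\<not> distinct U"
  then obtain as bs cs y where dec: "U = as @ [y] @ bs @ [y] @ cs" using not_distinct_decomp by blast
  have irr: "d z z = 0" for z using G by (simp add: lgraph_def)
  have "bs \<noteq> []"
  proof
    assume "bs = []"
    with dec U(2) have "walk d (as @ y # (y # (cs @ [hd U])))" by simp
    then show False using irr walk_split[of d as y "y # (cs @ [hd U])"] by simp
  qed
  moreover have "as \<noteq> [] \<or> cs \<noteq> []"
  proof (rule ccontr)
    assume "\<not> ?thesis"
    then have "walk d ((y # bs) @ y # [y])" using dec U(2) by simp
    then show False using irr walk_split[of d "y # bs" y "[y]"] by simp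
  qed
  ultimately show False using good_of_chord[OF G cg _ U, of as y bs y cs] dec bad by auto
qed

text \<open>Both edges at \<open>z\<close> would be chords unless they are edges of the cycle, so
  \<open>z\<close> is next to both ends. In the lift this confines a bad cycle whose closing edge
  lies in the copy of \<open>X\<close>: a third point of \<open>X\<close> on it would make it a
  triangle of \<open>X\<close>.\<close>

lemma bad_cycle_three:
  assumes G: "lgraph \<delta> V d" and cg: "cycles_good \<Phi> d (k - 1)"
    and U: "length U = k" "walk d (U @ [hd U])" and bad: "\<not> good \<Phi> (labs d (U @ [hd U]))"
    and z: "z \<in> set U" "z \<noteq> hd U" "z \<noteq> last U" and adj: "d (hd U) z \<noteq> 0" "d z (last U) \<noteq> 0"
  shows "U = [hd U, z, last U]"
proof -
  obtain h U1 where U1: "U = h # U1" using z by (cases U) auto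
  then have "z \<in> set U1" using z by auto
  then obtain bs W where W: "U1 = bs @ z # W" using split_list by metis
  have "W \<noteq> []" using z(3) U1 W by auto
  then obtain cs l where cs: "W = cs @ [l]" by (metis rev_exhaust)
  have dec: "U = h # bs @ z # cs @ [l]" and hl: "hd U = h" "last U = l" using U1 W cs by auto
  have "bs = []"
    using good_of_chord[OF G cg _ U, of "[]" h bs z "cs @ [l]"] dec hl adj bad by auto
  moreover have "cs = []"
    using good_of_chord[OF G cg _ U, of "h # bs" z cs l "[]"] dec hl adj bad by auto
  ultimately show ?thesis using dec hl by simp
qed

end

section \<open>Extending partial isometries\<close>

lemma extend_inj_to_permutation:
  assumes "finite X" "D \<subseteq> X" "f ` D \<subseteq> X" "inj_on f D"
  obtains g where "g permutes X" "\<And>x. x \<in> D \<Longrightarrow> g x = f x"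
proof -
  have "card (X - D) = card (X - f ` D)"
  proof -
    have "finite D" "finite (f ` D)" using assms(1-3) by (auto intro: finite_subset)
    then have "card (X - D) = card X - card D" "card (X - f ` D) = card X - card (f ` D)"
      using assms(2,3) card_Diff_subset by metis+
    then show ?thesis using card_image[OF assms(4)] by simp
  qed
  then obtain h where h: "bij_betw h (X - D) (X - f ` D)"
    using finite_same_card_bij[of "X - D" "X - f ` D"] assms(1) by auto
  have "bij_betw f D (f ` D)" using assms(4) by (simp add: bij_betw_def)
  then have "bij_betw (\<lambda>x. if x \<in> D then f x else h x) (D \<union> (X - D)) (f ` D \<union> (X - f ` D))"
    using h by (rule bij_betw_disjoint_Un) auto
  then have bij: "bij_betw (\<lambda>x. if x \<in> D then f x else h x) X X"
    using assms(2,3) by (simp add: Un_absorb1)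
  define g where "g x = (if x \<in> X then if x \<in> D then f x else h x else x)" for x
  have "bij_betw g X X" using bij by (subst bij_betw_cong[where g = "\<lambda>x. if x \<in> D then f x else h x"]) (auto simp: g_def)
  then have "g permutes X" by (rule bij_imp_permutes) (simp add: g_def)
  then show ?thesis by (rule that) (use assms(2) in \<open>auto simp: g_def\<close>)
qed

lemma inj_on_self_permutes:
  assumes "finite V" "inj_on g V" "g ` V \<subseteq> V" "\<And>x. x \<notin> V \<Longrightarrow> g x = x"
  shows "g permutes V"
  using assms by (intro bij_imp_permutes) (auto simp: bij_betw_def endo_inj_surj)

lemma EPPA_witness_extend:
  assumes "EPPA_witness X \<rho> V d \<alpha>" "partial_isometry X \<rho> D f"
  obtains g where "g permutes V" "\<And>x y. d (g x) (g y) = d x y" "\<And>x. x \<in> D \<Longrightarrow> g (\<alpha> x) = \<alpha> (f x)"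
proof -
  have "\<exists>g. lgraph_auto V d g \<and> (\<forall>x\<in>D. g (\<alpha> x) = \<alpha> (f x))"
    using assms by (simp add: EPPA_witness_def)
  then show thesis using that by (auto simp: lgraph_auto_def)
qed

text \<open>A vertex is a point of \<open>X\<close> with a function from \<open>X\<close> to
  residues modulo \<open>\<delta>\<close>. The label between vertices over \<open>x\<close> and
  \<open>y\<close> is read off from the sum of two residues, the value at \<open>y\<close> of the
  first function and at \<open>x\<close> of the second. Shifting these by opposite amounts changes
  no label, so any permutation of \<open>X\<close> extending \<open>f\<close> can be lifted and then
  corrected to act as prescribed on the copy of \<open>D\<close>.\<close>

lemma EPPA_witness_base:
  fixes X :: "'a set" and \<rho> :: "'a \<Rightarrow> 'a \<Rightarrow> nat"
  assumes X: "finite X" and sym: "\<And>x y. \<rho> x y = \<rho> y x" and refl: "\<And>x. \<rho> x x = 0"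
    and range: "\<And>x y. x \<in> X \<Longrightarrow> y \<in> X \<Longrightarrow> x \<noteq> y \<Longrightarrow> \<rho> x y \<in> {1..\<delta>}" and \<delta>: "\<delta> \<ge> 1"
  shows "\<exists>(V :: ('a \<times> ('a \<Rightarrow> int)) set) d \<alpha>. lgraph \<delta> V d \<and> EPPA_witness X \<rho> V d \<alpha>"
proof -
  define m where "m = int \<delta>"
  have m: "m > 0" using \<delta> by (simp add: m_def)
  define V :: "('a \<times> ('a \<Rightarrow> int)) set" where "V = X \<times> (X \<rightarrow>\<^sub>E {0..<m})"
  define d where "d p q = (if p \<in> V \<and> q \<in> V \<and> fst p \<noteq> fst q
      then nat (1 + (snd p (fst q) + snd q (fst p)) mod m) else 0)" for p q :: "'a \<times> ('a \<Rightarrow> int)"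
  have G: "lgraph \<delta> V d"
    unfolding lgraph_def
  proof (intro conjI allI impI)
    show "finite V" using X by (simp add: V_def finite_PiE)
    show "d p q = d q p" for p q by (auto simp: d_def add.commute)
    show "d p q \<le> \<delta>" for p q
      using pos_mod_bound[OF m, of "snd p (fst q) + snd q (fst p)"] pos_mod_sign[OF m, of "snd p (fst q) + snd q (fst p)"]
      by (simp add: d_def m_def nat_le_iff)
  qed (auto simp: d_def split: if_splits)
  \<comment> \<open>The numbering only decides which of the two entries of a pair carries the whole
    label, reduced by 1 to become a residue; the other entry is 0.\<close>
  obtain idx :: "'a \<Rightarrow> nat" where idx: "inj_on idx X"
    using finite_imp_inj_to_nat_seg[OF X] by blast
  define \<theta> where "\<theta> x = (\<lambda>y\<in>X. if idx x < idx y then int (\<rho> x y) - 1 else 0)" for x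
  define \<alpha> where "\<alpha> x = (x, \<theta> x)" for x
  have \<theta>_range: "\<theta> x \<in> X \<rightarrow>\<^sub>E {0..<m}" if "x \<in> X" for x
  proof (rule PiE_I)
    fix y assume "y \<in> X"
    then show "\<theta> x y \<in> {0..<m}" using that range[of x y] m by (cases "x = y") (auto simp: \<theta>_def m_def)
  qed (auto simp: \<theta>_def)
  have \<theta>_sum: "\<theta> x y + \<theta> y x = int (\<rho> x y) - 1" if "x \<in> X" "y \<in> X" "x \<noteq> y" for x y
  proof -
    have "idx x \<noteq> idx y" using idx that by (auto simp: inj_on_def)
    then show ?thesis using that sym[of x y] by (auto simp: \<theta>_def)
  qed
  have \<alpha>V: "\<alpha> x \<in> V" if "x \<in> X" for x using that \<theta>_range by (simp add: \<alpha>_def V_def)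
  have \<alpha>d: "d (\<alpha> x) (\<alpha> y) = \<rho> x y" if "x \<in> X" "y \<in> X" for x y
  proof (cases "x = y")
    case True then show ?thesis by (simp add: d_def refl)
  next
    case False
    have "(int (\<rho> x y) - 1) mod m = int (\<rho> x y) - 1"
      using range[OF that False] by (intro mod_pos_pos_trivial) (auto simp: m_def)
    then show ?thesis using False that \<alpha>V[of x] \<alpha>V[of y] \<theta>_sum[OF that False]
      by (simp add: d_def) (simp add: \<alpha>_def)
  qed
  have "\<exists>g. lgraph_auto V d g \<and> (\<forall>x\<in>D. g (\<alpha> x) = \<alpha> (f x))" if f: "partial_isometry X \<rho> D f" for D f
  proof -
    have D: "D \<subseteq> X" "f ` D \<subseteq> X" "inj_on f D" and iso: "\<And>x y. x \<in> D \<Longrightarrow> y \<in> D \<Longrightarrow> \<rho> (f x) (f y) = \<rho> x y"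
      using f by (auto simp: partial_isometry_def)
    obtain g where g: "g permutes X" "\<And>x. x \<in> D \<Longrightarrow> g x = f x"
      using extend_inj_to_permutation[OF X D] by blast
    have gX: "g x \<in> X \<longleftrightarrow> x \<in> X" for x using g(1) by (rule permutes_in_image)
    have ginj: "g x = g y \<longleftrightarrow> x = y" for x y using permutes_inj[OF g(1)] by (auto dest: injD)
    have inv: "inv g (g x) = x" "g (inv g x) = x" for x using permutes_inverses[OF g(1)] by auto
    have invX: "inv g x \<in> X \<longleftrightarrow> x \<in> X" for x using permutes_in_image[OF permutes_inv[OF g(1)]] by auto
    \<comment> \<open>The first branch is forced by sending \<open>\<alpha> x\<close> to
      \<open>\<alpha> (g x)\<close>, the second is the opposite shift for the partner. When both
      points lie in \<open>D\<close> the two demands agree because \<open>f\<close> preserves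
      \<open>\<rho>\<close>.\<close>
    define t where "t x y = (if x \<in> D then \<theta> (g x) (g y) - \<theta> x y
        else if y \<in> D then \<theta> y x - \<theta> (g y) (g x) else 0)" for x y
    have t: "t x y + t y x = 0" if "x \<in> X" "y \<in> X" "x \<noteq> y" for x y
    proof (cases "x \<in> D \<and> y \<in> D")
      case True
      then have "\<rho> (g x) (g y) = \<rho> x y" using g(2) iso by auto
      moreover have "\<theta> (g x) (g y) + \<theta> (g y) (g x) = int (\<rho> (g x) (g y)) - 1"
        using \<theta>_sum[of "g x" "g y"] that gX ginj by simp
      ultimately show ?thesis using True \<theta>_sum[OF that] by (simp add: t_def)
    next
      case False
      then show ?thesis by (cases "x \<in> D"; cases "y \<in> D") (simp_all add: t_def)
    qed
    define g0 where "g0 p = (if p \<in> V then (g (fst p), \<lambda>z\<in>X. (snd p (inv g z) + t (fst p) (inv g z)) mod m) else p)" for p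
    have g0V: "g0 p \<in> V" if "p \<in> V" for p
    proof -
      have "(\<lambda>z\<in>X. (snd p (inv g z) + t (fst p) (inv g z)) mod m) \<in> X \<rightarrow>\<^sub>E {0..<m}"
        using m by (intro restrict_PiE_iff[THEN iffD2]) auto
      then show ?thesis using that gX by (simp add: g0_def V_def mem_Times_iff)
    qed
    have fst0: "fst (g0 p) = g (fst p)" if "p \<in> V" for p using that by (simp add: g0_def)
    have snd0: "snd (g0 p) (g y) = (snd p y + t (fst p) y) mod m" if "p \<in> V" "y \<in> X" for p y
      using that gX inv by (simp add: g0_def)
    have "inj_on g0 V"
    proof (rule inj_onI)
      fix p q assume pq: "p \<in> V" "q \<in> V" "g0 p = g0 q"
      then have 1: "fst p = fst q" using fst0 ginj by metis
      have "snd p y = snd q y" for y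
      proof (cases "y \<in> X")
        case True
        then have "(snd p y + t (fst p) y) mod m = (snd q y + t (fst p) y) mod m"
          using snd0[of p y] snd0[of q y] pq 1 by simp
        then have "snd p y mod m = snd q y mod m" by (simp add: mod_eq_dvd_iff)
        moreover have "snd p y \<in> {0..<m}" "snd q y \<in> {0..<m}" using pq True by (auto simp: V_def)
        ultimately show ?thesis by simp
      next
        case False
        then show ?thesis using pq by (auto simp: V_def PiE_def extensional_def)
      qed
      with 1 show "p = q" by (simp add: prod_eq_iff fun_eq_iff)
    qed
    then have perm: "g0 permutes V"
      using G g0V by (intro inj_on_self_permutes) (auto simp: lgraph_def g0_def)
    have pres: "d (g0 p) (g0 q) = d p q" for p q
    proof (cases "p \<in> V \<and> q \<in> V \<and> fst p \<noteq> fst q")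
      case True
      then have X': "fst p \<in> X" "fst q \<in> X" by (auto simp: V_def)
      have "(snd (g0 p) (g (fst q)) + snd (g0 q) (g (fst p))) mod m
          = (snd p (fst q) + t (fst p) (fst q) + (snd q (fst p) + t (fst q) (fst p))) mod m"
        using True X' by (simp add: snd0 mod_simps)
      also have "\<dots> = (snd p (fst q) + snd q (fst p)) mod m"
        using t[OF X'] True by (simp add: algebra_simps eq_neg_iff_add_eq_0[symmetric])
      finally show ?thesis using True g0V ginj by (simp add: d_def fst0)
    next
      case False
      then have "\<not> (g0 p \<in> V \<and> g0 q \<in> V \<and> fst (g0 p) \<noteq> fst (g0 q))"
        using permutes_in_image[OF perm] fst0 ginj by auto
      with False show ?thesis by (auto simp: d_def)
    qed
    have "g0 (\<alpha> x) = \<alpha> (f x)" if "x \<in> D" for x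
    proof -
      have xX: "x \<in> X" "g x \<in> X" using that D gX by auto
      have "(\<lambda>z\<in>X. (\<theta> x (inv g z) + t x (inv g z)) mod m) = \<theta> (g x)"
      proof
        fix z
        show "(\<lambda>z\<in>X. (\<theta> x (inv g z) + t x (inv g z)) mod m) z = \<theta> (g x) z"
        proof (cases "z \<in> X")
          case True
          then have "\<theta> (g x) z \<in> {0..<m}" using \<theta>_range[OF xX(2)] by auto
          with True that show ?thesis by (simp add: t_def inv)
        qed (simp add: \<theta>_def)
      qed
      with \<alpha>V[OF xX(1)] g(2)[OF that] show ?thesis by (simp add: g0_def \<alpha>_def)
    qed
    with perm pres show ?thesis by (auto simp: lgraph_auto_def)
  qed
  then have "EPPA_witness X \<rho> V d \<alpha>"
    using \<alpha>V \<alpha>d by (simp add: EPPA_witness_def image_subset_iff)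
  with G show ?thesis by blast
qed

text \<open>Every lift enlarges the type of vertices. Copying the finite result into a fixed
  infinite type makes the construction iterable and ends in the type of the given class.\<close>

lemma EPPA_witness_transport:
  fixes V :: "'b set" and d :: "'b \<Rightarrow> 'b \<Rightarrow> nat"
  assumes G: "lgraph \<delta> V d" and W: "EPPA_witness X \<rho> V d \<alpha>" and cg: "cycles_good \<Phi> d n" and \<Phi>: "\<Phi> 0 0 0"
  shows "\<exists>(V' :: 'c::infinite set) d' \<alpha>'. lgraph \<delta> V' d' \<and> EPPA_witness X \<rho> V' d' \<alpha>' \<and> cycles_good \<Phi> d' n"
proof -
  have "finite V" using G by (simp add: lgraph_def)
  then obtain h :: "'b \<Rightarrow> 'c" where h: "inj_on h V" using arb_inj_on_finite_infinite by blast
  define k where "k = inv_into V h"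
  have kh: "k (h x) = x" if "x \<in> V" for x using h that by (simp add: k_def)
  define V' where "V' = h ` V"
  have kV: "k p \<in> V" and hk: "h (k p) = p" if "p \<in> V'" for p using that kh by (auto simp: V'_def)
  define d' where "d' p q = (if p \<in> V' \<and> q \<in> V' then d (k p) (k q) else 0)" for p q
  have G': "lgraph \<delta> V' d'"
    using G unfolding lgraph_def d'_def V'_def by auto
  have cg': "cycles_good \<Phi> d' n"
    unfolding cycles_good_def
  proof (intro allI impI)
    fix c assume c: "walk d' c" "c \<noteq> []" "hd c = last c" "length c \<le> Suc n"
    have *: "walk d (map k c) \<and> labs d (map k c) = labs d' c" if "walk d' c" for c
      using that by (induction c rule: induct_list012) (auto simp: d'_def split: if_splits)
    have "hd (map k c) = last (map k c)" using c by (simp add: hd_map last_map)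
    then show "good \<Phi> (labs d' c)"
      using cg[unfolded cycles_good_def, rule_format, of "map k c"] *[OF c(1)] c by simp
  qed
  have W': "EPPA_witness X \<rho> V' d' (h \<circ> \<alpha>)"
    unfolding EPPA_witness_def
  proof (intro conjI allI impI ballI)
    show "(h \<circ> \<alpha>) ` X \<subseteq> V'" using W by (auto simp: EPPA_witness_def V'_def)
    fix x y assume xy: "x \<in> X" "y \<in> X"
    then have "\<alpha> x \<in> V" "\<alpha> y \<in> V" "d (\<alpha> x) (\<alpha> y) = \<rho> x y" using W by (auto simp: EPPA_witness_def)
    then show "d' ((h \<circ> \<alpha>) x) ((h \<circ> \<alpha>) y) = \<rho> x y"
      by (simp add: V'_def d'_def kh)
  next
    fix D f assume f: "partial_isometry X \<rho> D f"
    obtain g where g: "g permutes V" "\<And>x y. d (g x) (g y) = d x y" "\<And>x. x \<in> D \<Longrightarrow> g (\<alpha> x) = \<alpha> (f x)"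
      using EPPA_witness_extend[OF W f] by metis
    define g' where "g' p = (if p \<in> V' then h (g (k p)) else p)" for p
    have gV: "g x \<in> V \<longleftrightarrow> x \<in> V" for x using permutes_in_image[OF g(1)] .
    have g'V: "g' p \<in> V'" if "p \<in> V'" for p using that kV gV by (auto simp: g'_def V'_def)
    have kg: "k (g' p) = g (k p)" if "p \<in> V'" for p using that kV gV kh by (simp add: g'_def)
    have "inj_on g' V'"
      by (rule inj_onI) (metis kg hk permutes_inj[OF g(1)] injD)
    then have perm: "g' permutes V'"
      using G' g'V by (intro inj_on_self_permutes) (auto simp: lgraph_def g'_def)
    have "d' (g' p) (g' q) = d' p q" for p q
      using permutes_in_image[OF perm] by (simp add: d'_def kg g(2))
    moreover have "g' ((h \<circ> \<alpha>) x) = (h \<circ> \<alpha>) (f x)" if "x \<in> D" for x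
    proof -
      have "\<alpha> x \<in> V" using f that W by (auto simp: partial_isometry_def EPPA_witness_def)
      then show ?thesis using g(3)[OF that] kh by (simp add: g'_def V'_def)
    qed
    ultimately show "\<exists>g. lgraph_auto V' d' g \<and> (\<forall>x\<in>D. g ((h \<circ> \<alpha>) x) = (h \<circ> \<alpha>) (f x))"
      using perm by (auto simp: lgraph_auto_def)
  qed
  from G' W' cg' show ?thesis by blast
qed

context cycle_condition
begin

text \<open>The bad closed walks of the minimal length \<open>k\<close> are induced cycles. A vertex of the lift
  carries one bit for each of these cycles through it; the bit changes exactly along the closing edge
  of the cycle, hence the cycle cannot close up in the lift.\<close>

lemma EPPA_witness_step:
  fixes V :: "'b set" and d :: "'b \<Rightarrow> 'b \<Rightarrow> nat"
  assumes G: "lgraph \<delta> V d" and W: "EPPA_witness X \<rho> V d \<alpha>" and cg: "cycles_good \<Phi> d (k - 1)" and k: "3 \<le> k"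
    and pos: "\<And>x y. x \<in> X \<Longrightarrow> y \<in> X \<Longrightarrow> x \<noteq> y \<Longrightarrow> \<rho> x y \<noteq> 0" and refl: "\<And>x. \<rho> x x = 0"
    and tri: "\<And>x y z. x \<in> X \<Longrightarrow> y \<in> X \<Longrightarrow> z \<in> X \<Longrightarrow> x \<noteq> y \<Longrightarrow> y \<noteq> z \<Longrightarrow> x \<noteq> z \<Longrightarrow>
      good \<Phi> {#\<rho> x y, \<rho> y z, \<rho> z x#}"
  shows "\<exists>(V' :: ('b \<times> 'b list set) set) d' \<alpha>'.
    lgraph \<delta> V' d' \<and> EPPA_witness X \<rho> V' d' \<alpha>' \<and> cycles_good \<Phi> d' k"
proof -
  have finV: "finite V" and dsym: "\<And>x y. d x y = d y x" and irr: "\<And>x. d x x = 0" and dle: "\<And>x y. d x y \<le> \<delta>"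
    and dV: "\<And>x y. d x y \<noteq> 0 \<Longrightarrow> x \<in> V \<and> y \<in> V" using G by (auto simp: lgraph_def)
  \<comment> \<open>Cycles are lists with a marked beginning, and each rotation or reversal is a
    separate member with its own closing edge. No choice is made, so automorphisms permute
    \<open>\<U>\<close>.\<close>
  define \<U> where "\<U> = {U. set U \<subseteq> V \<and> length U = k \<and> walk d (U @ [hd U]) \<and> \<not> good \<Phi> (labs d (U @ [hd U]))}"
  have fin\<U>: "finite \<U>" unfolding \<U>_def by (rule finite_subset[OF _ finite_lists_length_eq[OF finV, of k]]) auto
  have Ud: "distinct U" "U \<noteq> []" "length U = k" if "U \<in> \<U>" for U
    using that k bad_cycle_distinct[OF G cg, of U] by (auto simp: \<U>_def)
  define V' where "V' = (SIGMA x:V. Pow {U \<in> \<U>. x \<in> set U})"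
  define S where "S p q \<longleftrightarrow> (\<forall>U\<in>\<U>. fst p \<in> set U \<and> fst q \<in> set U \<longrightarrow>
      ((U \<in> snd p) \<noteq> (U \<in> snd q)) = ({fst p, fst q} = {hd U, last U}))" for p q :: "'b \<times> 'b list set"
  define d' where "d' p q = (if p \<in> V' \<and> q \<in> V' \<and> S p q then d (fst p) (fst q) else 0)" for p q
  have d'D: "d' p q = d (fst p) (fst q)" "p \<in> V'" "q \<in> V'"
     "\<And>U. U \<in> \<U> \<Longrightarrow> fst p \<in> set U \<Longrightarrow> fst q \<in> set U \<Longrightarrow> ((U \<in> snd p) \<noteq> (U \<in> snd q)) = ({fst p, fst q} = {hd U, last U})"
    if "d' p q \<noteq> 0" for p q
    using that by (auto simp: d'_def S_def split: if_splits)
  have G': "lgraph \<delta> V' d'"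
    unfolding lgraph_def
  proof (intro conjI allI impI)
    show "finite V'" using finV fin\<U> by (simp add: V'_def)
    show "d' p q = d' q p" for p q
    proof -
      have "((U \<in> snd p) \<noteq> (U \<in> snd q)) = ({fst p, fst q} = {hd U, last U}) \<longleftrightarrow>
        ((U \<in> snd q) \<noteq> (U \<in> snd p)) = ({fst q, fst p} = {hd U, last U})" for U
        by (subst insert_commute) blast
      then have "S p q \<longleftrightarrow> S q p" unfolding S_def by (simp only:) blast
      then show ?thesis using dsym[of "fst p" "fst q"] by (auto simp: d'_def)
    qed
  qed (auto simp: d'_def irr dle split: if_splits)
  have cg': "cycles_good \<Phi> d' k"
    unfolding cycles_good_def
  proof (intro allI impI)
    fix c assume c: "walk d' c" "c \<noteq> []" "hd c = last c" "length c \<le> Suc k"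
    define c0 where "c0 = map fst c"
    have *: "walk d (map fst c) \<and> labs d (map fst c) = labs d' c" if "walk d' c" for c
      using that
    proof (induction c rule: induct_list012)
      case (3 p q zs)
      then show ?case using d'D(1)[of p q] by simp
    qed simp_all
    have c0: "walk d c0" "labs d c0 = labs d' c" "hd c0 = last c0" "c0 \<noteq> []" "length c0 = length c"
      using *[OF c(1)] c by (auto simp: c0_def hd_map last_map)
    show "good \<Phi> (labs d' c)"
    proof (rule ccontr)
      assume bad: "\<not> good \<Phi> (labs d' c)"
      have len: "length c = Suc k"
      proof (rule ccontr)
        assume "length c \<noteq> Suc k"
        then have "length c0 \<le> Suc (k - 1)" using c(4) c0(5) k by simp
        then show False using cg[unfolded cycles_good_def, rule_format, of c0] c0 bad by simp
      qed
      define U where "U = butlast c0"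
      have lenU: "length U = k" using len c0 by (simp add: U_def)
      have "hd U = hd c0" using lenU k by (cases c0) (auto simp: U_def split: if_splits)
      then have c0U: "c0 = U @ [hd U]" using c0 by (metis U_def append_butlast_last_id)
      have walkV: "set w \<subseteq> V" if "walk d w" "length w \<ge> 2" for w
      proof -
        have "set w \<subseteq> V" if "walk d w" "w \<noteq> [] \<Longrightarrow> hd w \<in> V" for w
          using that
        proof (induction w rule: induct_list012)
          case (3 x y zs)
          then show ?case using dV[of x y] by simp
        qed simp_all
        moreover obtain x y zs where "w = x # y # zs" using \<open>length w \<ge> 2\<close> by (auto simp: numeral_2_eq_2 Suc_le_length_iff)
        then have "hd w \<in> V" using \<open>walk d w\<close> dV[of x y] by simp
        ultimately show ?thesis using that by blast
      qed
      have "set c0 \<subseteq> V"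
        using walkV[OF c0(1)] c0(5) len k by simp
      moreover have "set U \<subseteq> set c0" using c0U by (metis set_append sup_ge1)
      ultimately have "set U \<subseteq> V" by blast
      moreover have "walk d (U @ [hd U])" "\<not> good \<Phi> (labs d (U @ [hd U]))"
        using c0(1,2) bad unfolding c0U[symmetric] by simp_all
      ultimately have U: "U \<in> \<U>" using lenU by (simp add: \<U>_def)
      note Ud = Ud[OF U]
      have nth: "fst (c ! i) = U ! i" if "i < k" for i
        using that len lenU by (metis c0U c0_def nth_append nth_map less_SucI)
      have step: "d' (c ! i) (c ! Suc i) \<noteq> 0" if "Suc i < length c" for i
        using c(1) that by (induction c arbitrary: i rule: induct_list012) (auto simp: nth_Cons split: nat.splits)
      have hdU: "hd U = U ! 0" and lastU: "last U = U ! (k - 1)" using Ud by (auto simp: hd_conv_nth last_conv_nth)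
      have same: "(U \<in> snd (c ! i)) = (U \<in> snd (c ! 0))" if "i < k" for i
        using that
      proof (induction i)
        case (Suc i)
        have "{U ! i, U ! Suc i} \<noteq> {hd U, last U}"
          unfolding hdU lastU using Suc.prems k Ud by (auto simp: doubleton_eq_iff nth_eq_iff_index_eq)
        then show ?case
          using d'D(4)[OF step[of i] U] Suc nth[of i] nth[of "Suc i"] len Ud by auto
      qed simp
      \<comment> \<open>The walk closes in the lift, not only in its projection. Its bit at
        \<open>U\<close> is constant up to position \<open>k - 1\<close>, so the last step cannot
        change it, although it runs along the closing edge.\<close>
      have "c ! k = c ! 0" using c len by (metis hd_conv_nth last_conv_nth diff_Suc_1)
      moreover have "(U \<in> snd (c ! (k - 1))) \<noteq> (U \<in> snd (c ! k))"
        using d'D(4)[OF step[of "k - 1"] U] nth[of "k - 1"] nth[of 0] \<open>c ! k = c ! 0\<close> len k Ud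
        by (simp add: hdU lastU insert_commute)
      ultimately show False using same[of "k - 1"] k by simp
    qed
  qed
  have \<alpha>V: "\<And>x. x \<in> X \<Longrightarrow> \<alpha> x \<in> V" and \<alpha>d: "\<And>x y. x \<in> X \<Longrightarrow> y \<in> X \<Longrightarrow> d (\<alpha> x) (\<alpha> y) = \<rho> x y"
    using W by (auto simp: EPPA_witness_def)
  have \<alpha>inj: "\<alpha> x = \<alpha> y \<longleftrightarrow> x = y" if "x \<in> X" "y \<in> X" for x y
    using \<alpha>d[OF that] pos[OF that] irr by (cases "x = y") auto
  \<comment> \<open>On the copy of \<open>X\<close> only the head of \<open>U\<close> gets the bit,
    and only if the closing edge lies in that copy; otherwise no two points of \<open>X\<close> span
    the closing edge and all bits must agree.\<close>
  define \<theta> where "\<theta> x = {U \<in> \<U>. \<alpha> x = hd U \<and> last U \<in> \<alpha> ` X}" for x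
  define \<alpha>' where "\<alpha>' x = (\<alpha> x, \<theta> x)" for x
  have \<theta>: "((U \<in> \<theta> x) \<noteq> (U \<in> \<theta> y)) = ({\<alpha> x, \<alpha> y} = {hd U, last U})"
    if xy: "x \<in> X" "y \<in> X" "x \<noteq> y" and U: "U \<in> \<U>" "\<alpha> x \<in> set U" "\<alpha> y \<in> set U" for x y U
  proof -
    have hl: "hd U \<noteq> last U" using Ud[OF U(1)] k by (cases U) auto
    \<comment> \<open>The labels on \<open>X\<close> are nonzero, so a further point of
      \<open>X\<close> on \<open>U\<close> is adjacent to both ends. Then \<open>U\<close> is a
      triangle of \<open>X\<close>, and these are good.\<close>
    have three: False if z: "z \<in> X" "\<alpha> z \<in> set U" and h: "h \<in> X" "hd U = \<alpha> h" and l: "l \<in> X" "last U = \<alpha> l"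
      and ne: "z \<noteq> h" "z \<noteq> l" for z h l
    proof -
      have "h \<noteq> l" using hl h l by auto
      have "U = [\<alpha> h, \<alpha> z, \<alpha> l]"
        using bad_cycle_three[OF G cg, of U "\<alpha> z"] U(1) z h l ne \<alpha>inj \<alpha>d pos
        by (auto simp: \<U>_def)
      then have "labs d (U @ [hd U]) = {#\<rho> h z, \<rho> z l, \<rho> l h#}" using \<alpha>d z h l by simp
      then show False using U(1) tri[of h z l] z h l ne \<open>h \<noteq> l\<close> by (auto simp: \<U>_def)
    qed
    show ?thesis
    proof (cases "hd U \<in> \<alpha> ` X \<and> last U \<in> \<alpha> ` X")
      case True
      then obtain h l where hl': "h \<in> X" "hd U = \<alpha> h" "l \<in> X" "last U = \<alpha> l" by auto
      have "x = h \<or> x = l" "y = h \<or> y = l" using three[of _ h l] xy U hl' by metis+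
      then show ?thesis using xy hl hl' U(1) \<alpha>inj by (auto simp: \<theta>_def doubleton_eq_iff)
    next
      case False
      then have "U \<notin> \<theta> x" "U \<notin> \<theta> y" using xy by (auto simp: \<theta>_def intro: rev_image_eqI)
      moreover have "{\<alpha> x, \<alpha> y} \<noteq> {hd U, last U}" using False xy by (metis doubleton_eq_iff imageI)
      ultimately show ?thesis by simp
    qed
  qed
  have \<alpha>'V: "\<alpha>' x \<in> V'" if "x \<in> X" for x
    using that \<alpha>V Ud by (auto simp: \<alpha>'_def V'_def \<theta>_def)
  have \<alpha>'d: "d' (\<alpha>' x) (\<alpha>' y) = \<rho> x y" if "x \<in> X" "y \<in> X" for x y
  proof (cases "x = y")
    case True then show ?thesis using irr by (simp add: d'_def refl)
  next
    case False
    have "\<alpha>' x \<in> V'" "\<alpha>' y \<in> V'" using \<alpha>'V that by auto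
    moreover have "S (\<alpha>' x) (\<alpha>' y)"
      using \<theta>[OF that False] by (simp add: S_def \<alpha>'_def)
    ultimately show ?thesis using \<alpha>d[OF that] by (simp add: d'_def) (simp add: \<alpha>'_def)
  qed
  have ext: "\<exists>g. lgraph_auto V' d' g \<and> (\<forall>x\<in>D. g (\<alpha>' x) = \<alpha>' (f x))" if f: "partial_isometry X \<rho> D f" for D f
  proof -
    obtain g where g: "g permutes V" "\<And>x y. d (g x) (g y) = d x y" "\<And>x. x \<in> D \<Longrightarrow> g (\<alpha> x) = \<alpha> (f x)"
      using EPPA_witness_extend[OF W f] by metis
    have D: "D \<subseteq> X" "\<And>x. x \<in> D \<Longrightarrow> f x \<in> X" "inj_on f D" using f by (auto simp: partial_isometry_def)
    have gV: "g x \<in> V \<longleftrightarrow> x \<in> V" for x using permutes_in_image[OF g(1)] .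
    have ginj: "g x = g y \<longleftrightarrow> x = y" for x y using permutes_inj[OF g(1)] by (auto dest: injD)
    have inv: "g (inv g x) = x" for x using permutes_inverses[OF g(1)] by auto
    have gsub: "set (map g U) \<subseteq> V \<longleftrightarrow> set U \<subseteq> V" for U using gV by auto
    have g\<U>: "map g U \<in> \<U> \<longleftrightarrow> U \<in> \<U>" for U
    proof (cases "U = []")
      case False
      then have "map g U @ [hd (map g U)] = map g (U @ [hd U])" by (simp add: hd_map)
      then have "walk d (map g U @ [hd (map g U)]) = walk d (U @ [hd U])"
        "labs d (map g U @ [hd (map g U)]) = labs d (U @ [hd U])"
        by (simp_all only: walk_map labs_map g(2))
      then show ?thesis unfolding \<U>_def using gsub[of U] by simp
    qed (use k in \<open>simp add: \<U>_def\<close>)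
    have mapinj: "map g U = map g U' \<longleftrightarrow> U = U'" for U U'
      using permutes_inj[OF g(1)] by (simp add: inj_map_eq_map)
    have mapsurj: "\<exists>U. U' = map g U" for U'
      by (rule exI[of _ "map (inv g) U'"]) (simp add: inv o_def)
    have gset: "g x \<in> set (map g U) \<longleftrightarrow> x \<in> set U" for x U using ginj by auto
    \<comment> \<open>Whether the bit of \<open>U\<close> is flipped on passing to
      \<open>map g U\<close>. Every \<open>x\<close> in \<open>D\<close> on \<open>U\<close> gives
      the same answer: bits of two such points differ exactly on the closing edge, and
      \<open>g\<close> carries closing edges to closing edges.\<close>
    define t where "t U \<longleftrightarrow> (\<exists>x\<in>D. \<alpha> x \<in> set U \<and> (U \<in> \<theta> x) \<noteq> (map g U \<in> \<theta> (f x)))" for U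
    have t: "t U \<longleftrightarrow> (U \<in> \<theta> x) \<noteq> (map g U \<in> \<theta> (f x))" if "x \<in> D" "\<alpha> x \<in> set U" "U \<in> \<U>" for x U
    proof -
      have "((U \<in> \<theta> x) \<noteq> (map g U \<in> \<theta> (f x))) \<longleftrightarrow> ((U \<in> \<theta> y) \<noteq> (map g U \<in> \<theta> (f y)))"
        if y: "y \<in> D" "\<alpha> y \<in> set U" for y
      proof (cases "x = y")
        case False
        have "((U \<in> \<theta> x) \<noteq> (U \<in> \<theta> y)) = ({\<alpha> x, \<alpha> y} = {hd U, last U})"
          using \<theta>[of x y U] D that \<open>x \<in> D\<close> \<open>\<alpha> x \<in> set U\<close> \<open>U \<in> \<U>\<close> False by auto
        also have "\<dots> = ({\<alpha> (f x), \<alpha> (f y)} = {hd (map g U), last (map g U)})"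
          using Ud[OF \<open>U \<in> \<U>\<close>] \<open>x \<in> D\<close> y by (simp add: hd_map last_map ginj doubleton_eq_iff flip: g(3))
        also have "\<dots> = ((map g U \<in> \<theta> (f x)) \<noteq> (map g U \<in> \<theta> (f y)))"
        proof (rule \<theta>[symmetric])
          show "f x \<noteq> f y" using False D(3) \<open>x \<in> D\<close> y by (auto simp: inj_on_def)
          show "\<alpha> (f x) \<in> set (map g U)" "\<alpha> (f y) \<in> set (map g U)"
            using gset[of "\<alpha> x" U] gset[of "\<alpha> y" U] g(3) that \<open>x \<in> D\<close> \<open>\<alpha> x \<in> set U\<close> by auto
        qed (use D \<open>x \<in> D\<close> y \<open>U \<in> \<U>\<close> g\<U> in auto)
        finally show ?thesis by blast
      qed simp
      with that show ?thesis unfolding t_def by blast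
    qed
    define g' where "g' p = (if p \<in> V' then (g (fst p), map g ` {U \<in> \<U>. fst p \<in> set U \<and> (U \<in> snd p) \<noteq> t U}) else p)" for p
    have fst': "fst (g' p) = g (fst p)" if "p \<in> V'" for p using that by (simp add: g'_def)
    have snd': "map g U \<in> snd (g' p) \<longleftrightarrow> U \<in> \<U> \<and> fst p \<in> set U \<and> (U \<in> snd p) \<noteq> t U" if "p \<in> V'" for p U
      using that by (auto simp: g'_def mapinj)
    have g'V: "g' p \<in> V'" if "p \<in> V'" for p
      using that gV g\<U> by (auto simp: g'_def V'_def)
    have "inj_on g' V'"
    proof (rule inj_onI)
      fix p q assume pq: "p \<in> V'" "q \<in> V'" "g' p = g' q"
      then have 1: "fst p = fst q" using fst' ginj by metis
      have "U \<in> snd p \<longleftrightarrow> U \<in> snd q" for U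
      proof (cases "U \<in> \<U> \<and> fst p \<in> set U")
        case True
        then show ?thesis using snd'[OF pq(1), of U] snd'[OF pq(2), of U] pq(3) 1 by auto
      next
        case False
        then show ?thesis using pq 1 by (auto simp: V'_def)
      qed
      with 1 show "p = q" by (simp add: prod_eq_iff set_eq_iff)
    qed
    then have perm: "g' permutes V'"
      using G' g'V by (intro inj_on_self_permutes) (auto simp: lgraph_def g'_def)
    have "d' (g' p) (g' q) = d' p q" for p q
    proof (cases "p \<in> V' \<and> q \<in> V'")
      case True
      have "S (g' p) (g' q) \<longleftrightarrow> S p q"
      proof -
        let ?P = "\<lambda>U'. fst (g' p) \<in> set U' \<and> fst (g' q) \<in> set U' \<longrightarrow>
          ((U' \<in> snd (g' p)) \<noteq> (U' \<in> snd (g' q))) = ({fst (g' p), fst (g' q)} = {hd U', last U'})"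
        let ?Q = "\<lambda>U. fst p \<in> set U \<and> fst q \<in> set U \<longrightarrow>
          ((U \<in> snd p) \<noteq> (U \<in> snd q)) = ({fst p, fst q} = {hd U, last U})"
        have "?P (map g U) \<longleftrightarrow> ?Q U" if "U \<in> \<U>" for U
        proof -
          have "({g (fst p), g (fst q)} = {hd (map g U), last (map g U)}) = ({fst p, fst q} = {hd U, last U})"
            using Ud[OF that] by (simp add: hd_map last_map ginj doubleton_eq_iff)
          moreover have "p \<in> V'" "q \<in> V'" using True by auto
          ultimately show ?thesis using that by (simp only: fst' snd' gset) blast
        qed
        then have PQ: "?P (map g U) = ?Q U" if "U \<in> \<U>" for U using that by blast
        have "(\<forall>U'\<in>\<U>. ?P U') \<longleftrightarrow> (\<forall>U\<in>\<U>. ?Q U)"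
        proof (intro iffI ballI)
          fix U assume all: "\<forall>U'\<in>\<U>. ?P U'" and U: "U \<in> \<U>"
          have "?P (map g U)" using bspec[OF all, of "map g U"] U g\<U> by blast
          then show "?Q U" unfolding PQ[OF U] .
        next
          fix U' assume all: "\<forall>U\<in>\<U>. ?Q U" and U': "U' \<in> \<U>"
          obtain U where U: "U' = map g U" using mapsurj by blast
          then have "U \<in> \<U>" using U' g\<U> by simp
          with all have "?Q U" by (rule bspec)
          then have "?P (map g U)" unfolding PQ[OF \<open>U \<in> \<U>\<close>] .
          then show "?P U'" unfolding U .
        qed
        then show ?thesis unfolding S_def .
      qed
      then show ?thesis using True g'V by (simp add: d'_def fst' g(2))
    next
      case False
      then have "\<not> (g' p \<in> V' \<and> g' q \<in> V')" using permutes_in_image[OF perm] by auto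
      with False show ?thesis by (auto simp: d'_def)
    qed
    moreover have "g' (\<alpha>' x) = \<alpha>' (f x)" if x: "x \<in> D" for x
    proof -
      have fx: "f x \<in> X" "x \<in> X" using x D by auto
      have "map g U \<in> snd (g' (\<alpha>' x)) \<longleftrightarrow> map g U \<in> \<theta> (f x)" for U
      proof (cases "U \<in> \<U> \<and> \<alpha> x \<in> set U")
        case True
        then show ?thesis using snd'[OF \<alpha>'V[OF fx(2)]] t[OF x, of U] by (auto simp: \<alpha>'_def)
      next
        case False
        have "map g U \<notin> \<theta> (f x)"
        proof
          assume *: "map g U \<in> \<theta> (f x)"
          then have U: "U \<in> \<U>" using g\<U> by (simp add: \<theta>_def)
          have "g (\<alpha> x) = hd (map g U)" using * g(3)[OF x] by (simp add: \<theta>_def)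
          then have "\<alpha> x = hd U" using Ud[OF U] ginj by (simp add: hd_map)
          then show False using False U Ud[OF U] by simp
        qed
        then show ?thesis using snd'[OF \<alpha>'V[OF fx(2)]] False by (auto simp: \<alpha>'_def)
      qed
      then have "snd (g' (\<alpha>' x)) = \<theta> (f x)" using mapsurj by (metis set_eq_iff)
      moreover have "fst (g' (\<alpha>' x)) = \<alpha> (f x)" using fst'[OF \<alpha>'V[OF fx(2)]] g(3)[OF x] by (simp add: \<alpha>'_def)
      ultimately show ?thesis by (simp add: prod_eq_iff \<alpha>'_def)
    qed
    ultimately show ?thesis using perm by (auto simp: lgraph_auto_def)
  qed
  have "EPPA_witness X \<rho> V' d' \<alpha>'"
    using \<alpha>'V \<alpha>'d ext by (simp add: EPPA_witness_def image_subset_iff)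
  with G' cg' show ?thesis by blast
qed

text \<open>The copy of \<open>X\<close> is present in every lift, so its own triangles can never be
  destroyed and have to be good from the start.\<close>

theorem EPPA_witness_cycles_good:
  fixes X :: "'v::infinite set" and \<rho> :: "'v \<Rightarrow> 'v \<Rightarrow> nat"
  assumes X: "finite X" and sym: "\<And>x y. \<rho> x y = \<rho> y x" and refl: "\<And>x. \<rho> x x = 0"
    and range: "\<And>x y. x \<in> X \<Longrightarrow> y \<in> X \<Longrightarrow> x \<noteq> y \<Longrightarrow> \<rho> x y \<in> {1..\<delta>}" and \<delta>: "\<delta> \<ge> 1"
    and tri: "\<And>x y z. x \<in> X \<Longrightarrow> y \<in> X \<Longrightarrow> z \<in> X \<Longrightarrow> x \<noteq> y \<Longrightarrow> y \<noteq> z \<Longrightarrow> x \<noteq> z \<Longrightarrow>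
      good \<Phi> {#\<rho> x y, \<rho> y z, \<rho> z x#}"
  shows "\<exists>(V :: 'v set) d \<alpha>. lgraph \<delta> V d \<and> EPPA_witness X \<rho> V d \<alpha> \<and> cycles_good \<Phi> d (n + 2)"
proof (induction n)
  case 0
  obtain V :: "('v \<times> ('v \<Rightarrow> int)) set" and d \<alpha> where G: "lgraph \<delta> V d" and W: "EPPA_witness X \<rho> V d \<alpha>"
    using EPPA_witness_base[where \<rho> = \<rho>, OF X sym refl range \<delta>] by blast
  show ?case using EPPA_witness_transport[OF G W cycles_good_2[OF G] \<Phi>_empty] by (simp add: numeral_2_eq_2)
next
  case (Suc n)
  then obtain V :: "'v set" and d \<alpha> where G: "lgraph \<delta> V d" and W: "EPPA_witness X \<rho> V d \<alpha>"
    and cg: "cycles_good \<Phi> d (n + 2)" by blast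
  have pos: "\<rho> x y \<noteq> 0" if "x \<in> X" "y \<in> X" "x \<noteq> y" for x y using range[OF that] by auto
  obtain V' :: "('v \<times> 'v list set) set" and d' \<alpha>' where
    "lgraph \<delta> V' d'" "EPPA_witness X \<rho> V' d' \<alpha>'" "cycles_good \<Phi> d' (n + 3)"
    using EPPA_witness_step[OF G W, of "n + 3"] cg pos refl tri by (auto simp: eval_nat_numeral)
  from EPPA_witness_transport[OF this \<Phi>_empty] show ?case by (simp add: eval_nat_numeral)
qed

end

section \<open>Completing labelled graphs\<close>

definition lpath :: "('b \<Rightarrow> 'b \<Rightarrow> nat) \<Rightarrow> 'b \<Rightarrow> 'b \<Rightarrow> nat multiset \<Rightarrow> bool" where
  "lpath d x y ls \<longleftrightarrow> (\<exists>c. walk d c \<and> c \<noteq> [] \<and> hd c = x \<and> last c = y \<and> labs d c = ls)"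

lemma lpath_trans:
  assumes "lpath d x y l1" "lpath d y z l2"
  shows "lpath d x z (l1 + l2)"
proof -
  obtain c1 c2 where c: "walk d c1" "c1 \<noteq> []" "hd c1 = x" "last c1 = y" "labs d c1 = l1"
    "walk d c2" "c2 \<noteq> []" "hd c2 = y" "last c2 = z" "labs d c2 = l2"
    using assms unfolding lpath_def by metis
  define b1 where "b1 = butlast c1"
  define t2 where "t2 = tl c2"
  have c1: "c1 = b1 @ [y]"
    using c(2,4) by (auto simp: b1_def)
  have c2: "c2 = y # t2"
    using c(7,8) by (cases c2) (auto simp: t2_def)
  have "walk d (b1 @ y # t2)" "labs d (b1 @ y # t2) = l1 + l2"
    using walk_split[of d b1 y t2] labs_split[of d b1 y t2] c(1,5,6,10) unfolding c1 c2 by simp_all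
  moreover have "hd (b1 @ y # t2) = x" using c(3) unfolding c1 by (cases b1) auto
  moreover have "last (b1 @ y # t2) = z" using c(9) unfolding c2 by (cases t2) auto
  ultimately show ?thesis unfolding lpath_def by blast
qed

lemma lpath_sym:
  assumes "\<And>x y. d x y = d y x" "lpath d x y ls"
  shows "lpath d y x ls"
proof -
  obtain c where "walk d c" "c \<noteq> []" "hd c = x" "last c = y" "labs d c = ls"
    using assms(2) unfolding lpath_def by metis
  then have "walk d (rev c)" "rev c \<noteq> []" "hd (rev c) = y" "last (rev c) = x" "labs d (rev c) = ls"
    using walk_rev[of d c] labs_rev[of d c] assms(1) by (auto simp: hd_rev last_rev)
  then show ?thesis unfolding lpath_def by blast
qed

lemma lpath_edge: "d x y \<noteq> 0 \<Longrightarrow> lpath d x y {#d x y#}"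
  unfolding lpath_def by (rule exI[of _ "[x, y]"]) simp

lemma lpath_empty: "lpath d x y {#} \<longleftrightarrow> x = y"
proof
  assume "lpath d x y {#}"
  then obtain c where c: "c \<noteq> []" "hd c = x" "last c = y" "labs d c = {#}"
    unfolding lpath_def by metis
  have "length c - 1 = 0" using size_labs[of d c] c(4) by simp
  then show "x = y" using c by (cases c) auto
next
  assume "x = y"
  then show "lpath d x y {#}" unfolding lpath_def by (intro exI[of _ "[x]"]) simp
qed

lemma lpath_labels_pos:
  assumes "lpath d x y ls" "l \<in># ls" shows "l \<noteq> 0"
proof -
  have "walk d c \<Longrightarrow> l \<in># labs d c \<Longrightarrow> l \<noteq> 0" for c
    by (induction c rule: induct_list012) auto
  with assms show ?thesis unfolding lpath_def by metis
qed

lemma lpath_map: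
  assumes "\<And>x y. d (g x) (g y) = d x y" "lpath d x y ls"
  shows "lpath d (g x) (g y) ls"
proof -
  obtain c where c: "walk d c" "c \<noteq> []" "hd c = x" "last c = y" "labs d c = ls"
    using assms(2) unfolding lpath_def by metis
  have "walk d (map g c)" "labs d (map g c) = ls" unfolding walk_map labs_map assms(1) by (fact c)+
  moreover have "hd (map g c) = g x" "last (map g c) = g y" using c by (auto simp: hd_map last_map)
  ultimately show ?thesis unfolding lpath_def using c(2) by (metis map_is_Nil_conv)
qed

lemma size_le_sum_mset:
  fixes A :: "nat multiset"
  assumes "\<And>l. l \<in># A \<Longrightarrow> l \<noteq> 0"
  shows "size A \<le> sum_mset A"
  using assms
proof (induction A)
  case (add x A)
  then show ?case by (cases x) fastforce+
qed simp

text \<open>Think of two copies of the graph: an edge with label \<open>l\<close> has length \<open>2 * l\<close> within each copy and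
  length \<open>Q - 2 * l\<close> between the copies. The goodness of closed walks says that the two copies of a
  vertex have distance at least \<open>Q\<close>. The label of a non-edge is then chosen as
  close to \<open>M\<close> as the distances between the copies allow.\<close>

locale completion =
  fixes \<delta> Q M :: nat and \<Phi> :: "nat \<Rightarrow> nat \<Rightarrow> nat \<Rightarrow> bool" and V :: "'b set" and d :: "'b \<Rightarrow> 'b \<Rightarrow> nat"
  assumes G: "lgraph \<delta> V d" and cg: "cycles_good \<Phi> d (20 * \<delta>)"
    and \<Phi>_odd: "\<And>k c r. \<Phi> k c r \<Longrightarrow> odd k \<Longrightarrow> 2 * c + Q \<le> k * Q + 2 * r"
    and M: "1 \<le> M" "M \<le> \<delta>" "\<delta> \<le> 2 * M" "2 * M + \<delta> \<le> Q"
    and Q: "2 * \<delta> + 1 \<le> Q" "Q \<le> 3 * \<delta> + 1"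
begin

section \<open>Distances in the double cover\<close>

lemma dsym: "d x y = d y x" and irr: "d x x = 0" and dle: "d x y \<le> \<delta>"
  using G by (auto simp: lgraph_def)

lemma path_le: "lpath d x y ls \<Longrightarrow> set_mset ls \<subseteq> {..\<delta>}"
  unfolding lpath_def using set_labs[OF G] by blast

lemma closed_path_good:
  assumes "lpath d x x ls" "size ls \<le> 20 * \<delta>"
  shows "good \<Phi> ls"
proof -
  obtain c where c: "walk d c" "c \<noteq> []" "hd c = x" "last c = x" "labs d c = ls"
    using assms(1) unfolding lpath_def by metis
  then have "length c \<le> Suc (20 * \<delta>)" using assms(2) size_labs[of d c] by simp
  with c cg[unfolded cycles_good_def, rule_format, of c] show ?thesis by simp
qed

text \<open>A walk of length \<open>c\<close> in the double cover between copies of \<open>x\<close>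
  and \<open>y\<close>; \<open>s\<close> tells whether the copies differ. The equation defining
  \<open>c\<close> is written with sums only, since natural subtraction truncates.\<close>

definition R :: "'b \<Rightarrow> 'b \<Rightarrow> bool \<Rightarrow> nat \<Rightarrow> bool" where
  "R x y s c \<longleftrightarrow> (\<exists>ch oth. lpath d x y (ch + oth) \<and> odd (size ch) = s \<and>
     c + 2 * sum_mset ch = size ch * Q + 2 * sum_mset oth)"

lemma R_trans:
  assumes "R x y s c" "R y z t c'"
  shows "R x z (s \<noteq> t) (c + c')"
proof -
  obtain ch1 oth1 ch2 oth2 where *: "lpath d x y (ch1 + oth1)" "odd (size ch1) = s"
     "c + 2 * sum_mset ch1 = size ch1 * Q + 2 * sum_mset oth1"
     "lpath d y z (ch2 + oth2)" "odd (size ch2) = t"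
     "c' + 2 * sum_mset ch2 = size ch2 * Q + 2 * sum_mset oth2"
    using assms unfolding R_def by blast
  have "lpath d x z ((ch1 + ch2) + (oth1 + oth2))"
    using lpath_trans[OF *(1,4)] by (simp add: ac_simps)
  moreover have "odd (size (ch1 + ch2)) = (s \<noteq> t)" using *(2,5) by auto
  moreover have "(c + c') + 2 * sum_mset (ch1 + ch2) = size (ch1 + ch2) * Q + 2 * sum_mset (oth1 + oth2)"
    using *(3,6) by (simp add: algebra_simps)
  ultimately show ?thesis unfolding R_def by blast
qed

lemma R_sym: "R x y s c \<Longrightarrow> R y x s c"
  unfolding R_def using lpath_sym[of d, OF dsym] by blast

lemma R_map:
  assumes "\<And>x y. d (g x) (g y) = d x y" "R x y s c" shows "R (g x) (g y) s c"
  using assms(2) lpath_map[of d g, OF assms(1)] unfolding R_def by blast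

lemma R_edge:
  assumes "d x y \<noteq> 0"
  shows "R x y False (2 * d x y)" "R x y True (Q - 2 * d x y)"
proof -
  show "R x y False (2 * d x y)"
    unfolding R_def using lpath_edge[of d x y, OF assms] by (intro exI[of _ "{#}"] exI[of _ "{#d x y#}"]) simp
  show "R x y True (Q - 2 * d x y)"
    unfolding R_def using lpath_edge[of d x y, OF assms] dle[of x y] Q
    by (intro exI[of _ "{#d x y#}"] exI[of _ "{#}"]) simp
qed

text \<open>Because of this parity, lengths have the form \<open>2 * b\<close> within a copy and,
  below \<open>Q\<close>, the form \<open>Q - 2 * b\<close> between the copies.\<close>

lemma R_parity: "R x y s c \<Longrightarrow> even c = (s \<longrightarrow> even Q)"
proof -
  assume "R x y s c"
  then obtain ch oth where *: "odd (size ch) = s"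
     "c + 2 * sum_mset ch = size ch * Q + 2 * sum_mset oth" unfolding R_def by blast
  have "even c = even (c + 2 * sum_mset ch)" by simp
  also have "\<dots> = even (size ch * Q)" unfolding * by simp
  finally show ?thesis using *(1) by auto
qed

text \<open>An edge between the copies has length at least \<open>Q - 2 * \<delta> \<ge> 1\<close>,
  an edge within a copy at least 2. Hence a walk of length \<open>c\<close> has at most
  \<open>c\<close> edges, and short lengths lead to walks covered by \<open>cg\<close>.\<close>

lemma size_le_cost:
  assumes "lpath d x y (ch + oth)" "c + 2 * sum_mset ch = size ch * Q + 2 * sum_mset oth"
  shows "size ch * (Q - 2 * \<delta>) + 2 * sum_mset oth \<le> c" "size (ch + oth) \<le> c"
proof -
  have ch: "sum_mset ch \<le> size ch * \<delta>" using path_le[OF assms(1)] by (intro sum_mset_le_bound) auto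
  have oth: "size oth \<le> sum_mset oth" using lpath_labels_pos[OF assms(1)] by (intro size_le_sum_mset) auto
  have eq: "size ch * Q = size ch * (Q - 2 * \<delta>) + 2 * (size ch * \<delta>)"
    using Q by (simp add: diff_mult_distrib2 algebra_simps)
  show 1: "size ch * (Q - 2 * \<delta>) + 2 * sum_mset oth \<le> c" using assms(2) ch eq by linarith
  have "size ch * 1 \<le> size ch * (Q - 2 * \<delta>)" using Q by (intro mult_le_mono2) auto
  then show "size (ch + oth) \<le> c" using 1 oth unfolding size_union by linarith
qed

lemma R_zero: "R x y s 0 \<Longrightarrow> x = y"
  unfolding R_def using size_le_cost(2)[of x y _ _ 0] by (metis le_zero_eq lpath_empty size_eq_0_iff_empty)

lemma R_odd_lower: "R x y True c \<Longrightarrow> Q \<le> c + 2 * \<delta>"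
proof -
  assume "R x y True c"
  then obtain ch oth where *: "lpath d x y (ch + oth)" "odd (size ch)"
     "c + 2 * sum_mset ch = size ch * Q + 2 * sum_mset oth" unfolding R_def by blast
  have "size ch \<ge> 1" using *(2) by (cases "size ch") auto
  then have "1 * (Q - 2 * \<delta>) \<le> size ch * (Q - 2 * \<delta>)" by (intro mult_le_mono1)
  with size_le_cost(1)[OF *(1,3)] show ?thesis by linarith
qed

text \<open>Goodness is needed only for short walks; beyond \<open>20 * \<delta>\<close> the bound
  \<open>Q \<le> 3 * \<delta> + 1\<close> suffices.\<close>

lemma R_closed_odd:
  assumes "R x x True c" shows "Q \<le> c"
proof (cases "c \<le> 20 * \<delta>")
  case True
  obtain ch oth where *: "lpath d x x (ch + oth)" "odd (size ch)"
     "c + 2 * sum_mset ch = size ch * Q + 2 * sum_mset oth" using assms unfolding R_def by blast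
  have "good \<Phi> (ch + oth)" using closed_path_good[OF *(1)] size_le_cost(2)[OF *(1,3)] True by simp
  then have "2 * sum_mset ch + Q \<le> size ch * Q + 2 * sum_mset oth"
    using \<Phi>_odd[OF _ *(2)] by (auto simp: good_def)
  with *(3) show ?thesis by linarith
next
  case False
  with M Q show ?thesis by linarith
qed

text \<open>The middle conjuncts confine \<open>a\<close> to an interval: its upper end is half the
  distance within a copy, its lower end comes from the distance between the copies. The last two say
  that \<open>a\<close> is the point of it closest to \<open>M\<close>: below \<open>M\<close> the
  upper end is attained, above \<open>M\<close> the lower end.\<close>

definition admits :: "'b \<Rightarrow> 'b \<Rightarrow> nat \<Rightarrow> bool" where
  "admits x y a \<longleftrightarrow> 1 \<le> a \<and> a \<le> \<delta> \<and> (\<forall>c. R x y False c \<longrightarrow> 2 * a \<le> c) \<and> (\<forall>c. R x y True c \<longrightarrow> Q \<le> c + 2 * a) \<and>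
     (a < M \<longrightarrow> R x y False (2 * a)) \<and> (a > M \<longrightarrow> R x y True (Q - 2 * a))"

text \<open>The interval is nonempty: a walk within a copy followed back by one between the copies
  is closed up to a change of copy, so it has length at least \<open>Q\<close>. The value is the
  upper end if this lies below \<open>M\<close>, the lower end if this lies above \<open>M\<close>,
  and \<open>M\<close> otherwise.\<close>

lemma ex_admits:
  assumes "x \<noteq> y" shows "\<exists>a. admits x y a"
proof -
  have consistent: "Q \<le> c + c'" if "R x y False c" "R x y True c'" for c c'
    using R_closed_odd[of x "c + c'"] R_trans[OF that(1) R_sym[OF that(2)]] by simp
  have even_half: "\<exists>b. c = 2 * b" if "R x y False c" for c
    using R_parity[OF that] by (auto elim: evenE)
  have odd_half: "c \<ge> Q \<or> (\<exists>b\<le>\<delta>. c = Q - 2 * b \<and> 2 * b \<le> Q)" if "R x y True c" for c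
  proof (cases "c \<ge> Q")
    case False
    have "even (Q - c)" using R_parity[OF that] False by auto
    then obtain b where b: "Q - c = 2 * b" by (rule evenE)
    then have "c = Q - 2 * b" "2 * b \<le> Q" using False by auto
    moreover have "b \<le> \<delta>" using R_odd_lower[OF that] b by linarith
    ultimately show ?thesis by blast
  qed simp
  show ?thesis
  proof (cases "\<exists>a<M. R x y False (2 * a)")
    case True
    define a where "a = (LEAST a. R x y False (2 * a))"
    have Ra: "R x y False (2 * a)" and least: "\<And>b. R x y False (2 * b) \<Longrightarrow> a \<le> b"
      unfolding a_def using True by (auto intro: LeastI Least_le)
    have aM: "a < M" using True least by force
    have "a \<ge> 1" using Ra R_zero[of x y False] assms by (cases a) auto
    moreover have "2 * a \<le> c" if "R x y False c" for c using even_half[OF that] least that by auto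
    moreover have "Q \<le> c + 2 * a" if "R x y True c" for c using consistent[OF Ra that] by simp
    ultimately have "admits x y a" using aM Ra M by (simp add: admits_def)
    then show ?thesis by blast
  next
    case noF: False
    have F: "2 * M \<le> c" if "R x y False c" for c
      using even_half[OF that] noF that by (metis mult_le_mono2 not_le_imp_less)
    show ?thesis
    proof (cases "\<exists>a. M < a \<and> a \<le> \<delta> \<and> R x y True (Q - 2 * a)")
      case True
      define A where "A = {a. M < a \<and> a \<le> \<delta> \<and> R x y True (Q - 2 * a)}"
      have A: "finite A" "A \<noteq> {}" unfolding A_def using True by auto
      define a where "a = Max A"
      have "a \<in> A" using A Max_in unfolding a_def by blast
      then have a: "M < a" "a \<le> \<delta>" and Ra: "R x y True (Q - 2 * a)" by (auto simp: A_def)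
      have "2 * a \<le> c" if "R x y False c" for c using consistent[OF that Ra] a Q by linarith
      moreover have "Q \<le> c + 2 * a" if "R x y True c" for c
        using odd_half[OF that]
      proof
        assume "\<exists>b\<le>\<delta>. c = Q - 2 * b \<and> 2 * b \<le> Q"
        then obtain b where b: "b \<le> \<delta>" "c = Q - 2 * b" "2 * b \<le> Q" by blast
        have "b \<le> a"
        proof (cases "M < b")
          case True
          then have "b \<in> A" using b that by (simp add: A_def)
          then show ?thesis unfolding a_def using A by simp
        qed (use a in simp)
        with b show ?thesis by linarith
      qed simp
      ultimately have "admits x y a" using a Ra by (simp add: admits_def)
      then show ?thesis by blast
    next
      case False
      have "Q \<le> c + 2 * M" if "R x y True c" for c
        using odd_half[OF that]
      proof
        assume "\<exists>b\<le>\<delta>. c = Q - 2 * b \<and> 2 * b \<le> Q"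
        then obtain b where b: "b \<le> \<delta>" "c = Q - 2 * b" "2 * b \<le> Q" by blast
        then have "b \<le> M" using False that not_less by blast
        with b show ?thesis by linarith
      qed simp
      then have "admits x y M" using F M by (simp add: admits_def)
      then show ?thesis by blast
    qed
  qed
qed

text \<open>The choice depends only on the predicate \<open>admits x y\<close>; whatever preserves
  \<open>R\<close> therefore preserves \<open>D\<close>.\<close>

definition D :: "'b \<Rightarrow> 'b \<Rightarrow> nat" where
  "D x y = (if x = y then 0 else SOME a. admits x y a)"

lemma admits_D: "x \<noteq> y \<Longrightarrow> admits x y (D x y)"
  unfolding D_def using ex_admits[of x y] by (auto intro: someI)

lemma D_refl: "D x x = 0"
  by (simp add: D_def)

lemma D_sym: "D x y = D y x"
proof -
  have "R x y = R y x" using R_sym by (intro ext iffI) auto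
  then have "admits x y = admits y x" by (simp add: admits_def fun_eq_iff)
  then show ?thesis by (simp add: D_def)
qed

lemma D_auto:
  assumes "lgraph_auto V d g" shows "D (g x) (g y) = D x y"
proof -
  have g: "bij g" "\<And>x y. d (g x) (g y) = d x y"
    using assms permutes_bij by (auto simp: lgraph_auto_def)
  have inv: "inv g (g x) = x" "g (inv g x) = x" for x
    using g(1) by (simp_all add: bij_is_inj bij_is_surj surj_f_inv_f)
  have g': "d (inv g x) (inv g y) = d x y" for x y using g(2)[of "inv g x" "inv g y"] inv by simp
  have "R (g x) (g y) = R x y"
  proof (intro ext iffI)
    fix s c assume "R (g x) (g y) s c"
    from R_map[of "inv g", OF g' this] show "R x y s c" by (simp add: inv)
  qed (rule R_map[OF g(2)])
  then have "admits (g x) (g y) = admits x y" by (simp add: admits_def fun_eq_iff)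
  moreover have "g x = g y \<longleftrightarrow> x = y" using g(1) by (simp add: bij_is_inj inj_eq)
  ultimately show ?thesis by (simp add: D_def)
qed

lemma D_bounds: "x \<noteq> y \<Longrightarrow> 1 \<le> D x y" "D x y \<le> \<delta>"
  using admits_D[of x y] by (cases "x = y"; simp add: admits_def D_refl)+

text \<open>An edge is a walk of length \<open>2 * d x y\<close> within a copy and
  \<open>Q - 2 * d x y\<close> between the copies, which shrinks the interval of
  \<open>admits\<close> to one point.\<close>

lemma D_edge:
  assumes "d x y \<noteq> 0" shows "D x y = d x y"
proof -
  have "x \<noteq> y" using assms irr by auto
  from admits_D[OF this] R_edge[OF assms] have "2 * D x y \<le> 2 * d x y" "Q \<le> (Q - 2 * d x y) + 2 * D x y"
    unfolding admits_def by blast+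
  moreover have "2 * d x y \<le> Q" using dle[of x y] Q by linarith
  ultimately show ?thesis by linarith
qed

text \<open>Values below \<open>M\<close> are attained by walks within a copy, values above
  \<open>M\<close> by walks between the copies. Composing two attained sides bounds the third. Where
  too few sides are attained, \<open>\<delta> \<le> 2 * M\<close> or a single side of size at least
  \<open>M\<close> is enough.\<close>

lemma D_triangle:
  assumes "x \<noteq> y" "y \<noteq> z" "x \<noteq> z"
  shows "D x z \<le> D x y + D y z"
proof -
  note A = admits_D[OF assms(1), unfolded admits_def] and B = admits_D[OF assms(2), unfolded admits_def]
    and C = admits_D[OF assms(3), unfolded admits_def]
  have Q2: "2 * D x z \<le> Q" using D_bounds(2)[of x z] Q by linarith
  show ?thesis
  proof (cases "D x z \<le> M")
    case True
    show ?thesis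
    proof (cases "D x y < M \<and> D y z < M")
      case True
      then have "R x z False (2 * D x y + 2 * D y z)" using A B R_trans[of x y False _ z False] by auto
      then show ?thesis using C by fastforce
    next
      case False
      then show ?thesis using \<open>D x z \<le> M\<close> by auto
    qed
  next
    case False
    then have RC: "R x z True (Q - 2 * D x z)" using C by auto
    consider "D x y < M" | "D y z < M" | "D x y \<ge> M" "D y z \<ge> M" by linarith
    then show ?thesis
    proof cases
      case 1
      then have "R y z True (2 * D x y + (Q - 2 * D x z))" using A R_trans[OF R_sym[of x y False "2 * D x y"] RC] by simp
      then have "Q \<le> 2 * D x y + (Q - 2 * D x z) + 2 * D y z" using B by blast
      then show ?thesis using Q2 by linarith
    next
      case 2
      then have "R x y True ((Q - 2 * D x z) + 2 * D y z)" using B R_trans[OF RC R_sym[of y z False "2 * D y z"]] by simp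
      then have "Q \<le> (Q - 2 * D x z) + 2 * D y z + 2 * D x y" using A by blast
      then show ?thesis using Q2 by linarith
    next
      case 3
      then show ?thesis using C M by linarith
    qed
  qed
qed

text \<open>Two sides above \<open>M\<close> compose to a walk within a copy that bounds the third
  side. Otherwise two sides are at most \<open>M\<close>, and
  \<open>2 * M + \<delta> \<le> Q\<close> applies.\<close>

lemma D_perimeter:
  assumes "x \<noteq> y" "y \<noteq> z" "x \<noteq> z"
  shows "D x y + D y z + D x z \<le> Q"
proof -
  have two: "D x y + D y z + D x z \<le> Q" if "D x y > M" "D y z > M" "x \<noteq> y" "y \<noteq> z" "x \<noteq> z" for x y z
  proof -
    have "R x y True (Q - 2 * D x y)" "R y z True (Q - 2 * D y z)"
      using admits_D[of x y] admits_D[of y z] that by (auto simp: admits_def)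
    then have "R x z False ((Q - 2 * D x y) + (Q - 2 * D y z))" using R_trans by fastforce
    then have "2 * D x z \<le> (Q - 2 * D x y) + (Q - 2 * D y z)"
      using admits_D[of x z] that by (auto simp: admits_def)
    moreover have "2 * D x y \<le> Q" "2 * D y z \<le> Q" using D_bounds(2)[of x y] D_bounds(2)[of y z] Q by linarith+
    ultimately show ?thesis by linarith
  qed
  consider "D x y > M" "D y z > M" | "D x z > M" "D y z > M" | "D x y > M" "D x z > M"
    | "D x y \<le> M" "D y z \<le> M" | "D x z \<le> M" "D y z \<le> M" | "D x y \<le> M" "D x z \<le> M"
    by linarith
  then show ?thesis
  proof cases
    case 1 then show ?thesis using two assms by blast
  next
    case 2 then show ?thesis using two[of x z y] assms D_sym[of z y] by auto
  next
    case 3 then show ?thesis using two[of y x z] assms D_sym[of y x] by auto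
  qed (use D_bounds(2)[of x y] D_bounds(2)[of y z] D_bounds(2)[of x z] M in linarith)+
qed

text \<open>A refinement of \<open>R\<close> that keeps \<open>k\<close>, \<open>c\<close>,
  \<open>r\<close> apart and bounds the number of edges, for the inequalities of
  \<open>\<Phi>\<close> that belong to particular \<open>k\<close> and are not visible in the length
  alone.\<close>

definition att :: "nat \<Rightarrow> 'b \<Rightarrow> 'b \<Rightarrow> nat \<Rightarrow> nat \<Rightarrow> nat \<Rightarrow> bool" where
  "att n x y k c r \<longleftrightarrow> (\<exists>ch oth. lpath d x y (ch + oth) \<and> size (ch + oth) \<le> n \<and> size ch = k \<and> sum_mset ch = c \<and> sum_mset oth = r)"

lemma att_trans:
  assumes "att n x y k c r" "att n' y z k' c' r'"
  shows "att (n + n') x z (k + k') (c + c') (r + r')"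
proof -
  obtain ch1 oth1 ch2 oth2 where *: "lpath d x y (ch1 + oth1)" "size (ch1 + oth1) \<le> n" "size ch1 = k" "sum_mset ch1 = c" "sum_mset oth1 = r"
     "lpath d y z (ch2 + oth2)" "size (ch2 + oth2) \<le> n'" "size ch2 = k'" "sum_mset ch2 = c'" "sum_mset oth2 = r'"
    using assms unfolding att_def by blast
  have "lpath d x z ((ch1 + ch2) + (oth1 + oth2))"
    using lpath_trans[OF *(1,6)] by (simp add: ac_simps)
  then show ?thesis unfolding att_def by (intro exI[of _ "ch1 + ch2"] exI[of _ "oth1 + oth2"]) (use * in auto)
qed

lemma att_sym: "att n x y k c r \<Longrightarrow> att n y x k c r"
  unfolding att_def using lpath_sym[of d, OF dsym] by blast

lemma att_closed: "att n x x k c r \<Longrightarrow> n \<le> 20 * \<delta> \<Longrightarrow> \<Phi> k c r"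
  unfolding att_def using closed_path_good by (metis good_def order_trans)

lemma att_triangle:
  assumes "att \<delta> x y k1 c1 r1" "att \<delta> y z k2 c2 r2" "att \<delta> x z k3 c3 r3"
  shows "\<Phi> (k1 + k2 + k3) (c1 + c2 + c3) (r1 + r2 + r3)"
  using att_closed[OF att_trans[OF att_trans[OF assms(1,2)] att_sym[OF assms(3)]]] by simp

lemma att_edge: "d x y \<noteq> 0 \<Longrightarrow> att 1 x y 1 (d x y) 0"
  unfolding att_def using lpath_edge[of d x y] by (intro exI[of _ "{#d x y#}"] exI[of _ "{#}"]) simp

text \<open>The walk attaining \<open>D x y\<close> has an even number of chosen edges, and two of
  them would already cost more than \<open>2 * D x y\<close>. So \<open>D x y\<close> is the label
  sum of a path with none chosen.\<close>

lemma att_small: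
  assumes "x \<noteq> y" "D x y < M" "D x y + 2 * \<delta> < Q"
  shows "att \<delta> x y 0 0 (D x y)"
proof -
  have "R x y False (2 * D x y)" using admits_D[OF assms(1)] assms(2) by (simp add: admits_def)
  then obtain ch oth where *: "lpath d x y (ch + oth)" "even (size ch)"
     "2 * D x y + 2 * sum_mset ch = size ch * Q + 2 * sum_mset oth" unfolding R_def by blast
  have "size ch = 0"
  proof (rule ccontr)
    assume "size ch \<noteq> 0"
    then have "2 * (Q - 2 * \<delta>) \<le> size ch * (Q - 2 * \<delta>)" using *(2) by (intro mult_le_mono1) presburger
    with size_le_cost(1)[OF *(1,3)] assms(3) show False by linarith
  qed
  then have "ch = {#}" by simp
  with * have oth: "lpath d x y oth" "sum_mset oth = D x y" by auto
  have "size oth \<le> sum_mset oth" using lpath_labels_pos[OF oth(1)] by (rule size_le_sum_mset)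
  then have "size oth \<le> \<delta>" using oth assms M by linarith
  then show ?thesis unfolding att_def using oth by (intro exI[of _ "{#}"] exI[of _ oth]) simp
qed

text \<open>Three chosen edges would cost more than \<open>Q - 2 * D x y\<close>, so there is just
  one. Its label exceeds \<open>D x y\<close> by the sum \<open>r\<close> of the others;
  \<open>r = 0\<close> leaves a single edge.\<close>

lemma att_large:
  assumes "x \<noteq> y" "D x y > M" "3 * \<delta> < D x y + Q"
  obtains r where "att \<delta> x y 1 (D x y + r) r" "D x y + r \<le> \<delta>" "r = 0 \<Longrightarrow> d x y = D x y"
proof -
  have "R x y True (Q - 2 * D x y)" using admits_D[OF assms(1)] assms(2) by (simp add: admits_def)
  then obtain ch oth where *: "lpath d x y (ch + oth)" "odd (size ch)"
     "(Q - 2 * D x y) + 2 * sum_mset ch = size ch * Q + 2 * sum_mset oth" unfolding R_def by blast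
  have D2: "2 * D x y \<le> Q" using D_bounds(2)[of x y] Q by linarith
  have "size ch = 1"
  proof (rule ccontr)
    assume "size ch \<noteq> 1"
    then have "3 * (Q - 2 * \<delta>) \<le> size ch * (Q - 2 * \<delta>)" using *(2) by (intro mult_le_mono1) presburger
    with size_le_cost(1)[OF *(1,3)] assms(3) D2 Q show False by linarith
  qed
  then obtain t where t: "ch = {#t#}" by (metis One_nat_def size_1_singleton_mset)
  have tD: "t = D x y + sum_mset oth" using *(3) D2 t by simp
  have "t \<le> \<delta>" using path_le[OF *(1)] t by auto
  have "size oth \<le> sum_mset oth" using lpath_labels_pos[OF *(1)] by (intro size_le_sum_mset) auto
  then have "size (ch + oth) \<le> \<delta>" using t tD \<open>t \<le> \<delta>\<close> D_bounds(1)[OF assms(1)] by simp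
  then have "att \<delta> x y 1 (D x y + sum_mset oth) (sum_mset oth)"
    unfolding att_def using * t tD by (intro exI[of _ ch] exI[of _ oth]) simp
  moreover have "d x y = D x y" if "sum_mset oth = 0"
  proof -
    have "size oth = 0" using that \<open>size oth \<le> sum_mset oth\<close> by linarith
    then have "oth = {#}" by simp
    then obtain c where c: "walk d c" "c \<noteq> []" "hd c = x" "last c = y" "labs d c = {#t#}"
      using *(1) t unfolding lpath_def by auto
    have "length c = 2" using size_labs[of d c] c by (cases c) auto
    then have "c = [x, y]" using c by (auto simp: numeral_2_eq_2 length_Suc_conv)
    then show ?thesis using c tD that by simp
  qed
  moreover have "D x y + sum_mset oth \<le> \<delta>" using \<open>t \<le> \<delta>\<close> tD by simp
  ultimately show thesis using that by metis
qed

end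

section \<open>The conditions on closed walks for admissible parameters\<close>

lemma triangle_ok_iff:
  "triangle_ok K1 K2 C0 C1 a b c \<longleftrightarrow>
    (odd (a + b + c) \<longrightarrow> 2 * K1 < a + b + c \<and> a + b < 2 * K2 + c \<and> b + c < 2 * K2 + a \<and> a + c < 2 * K2 + b \<and> a + b + c < C1) \<and>
    (even (a + b + c) \<longrightarrow> a + b + c < C0)"
proof -
  have "a + b + c < 2 * K2 + 2 * Min {a, b, c} \<longleftrightarrow> a + b < 2 * K2 + c \<and> b + c < 2 * K2 + a \<and> a + c < 2 * K2 + b"
    by (auto simp: min_def)
  then show ?thesis unfolding triangle_ok_def Let_def by blast
qed

text \<open>This is the distance condition between the two copies in the double cover used for the completion:
  \<open>k * Q + 2 * r - 2 * c\<close> is the length of a lifted walk that changes copies along the chosen edges.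
  With \<open>k = 1\<close> it is the triangle inequality, with \<open>k = 3\<close> the bound \<open>Q\<close> on perimeters; for \<open>Q = 3 * \<delta>\<close>
  the latter is void.\<close>

definition cover_ok :: "nat \<Rightarrow> nat \<Rightarrow> nat \<Rightarrow> nat \<Rightarrow> bool" where
  "cover_ok Q k c r \<longleftrightarrow> (odd k \<longrightarrow> 2 * c + Q \<le> k * Q + 2 * r)"

lemma cover_ok_zero:
  assumes "2 * \<delta> \<le> Q" "c \<le> k * \<delta>"
  shows "cover_ok Q (Suc k) c r"
proof -
  have "k * (2 * \<delta>) \<le> k * Q" using assms(1) by (rule mult_le_mono2)
  then have "2 * c \<le> k * Q" using assms(2) by linarith
  then show ?thesis by (simp add: cover_ok_def)
qed

text \<open>Only an odd \<open>k1 + k2\<close> matters; then exactly one summand is odd. Leaving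
  \<open>e\<close> unchosen in that walk and choosing it in the other makes both premises effective,
  and \<open>e\<close> cancels.\<close>

lemma cover_ok_glue:
  assumes "cover_ok Q k1 c1 (e + r1)" "cover_ok Q (Suc k1) (e + c1) r1"
    "cover_ok Q k2 c2 (e + r2)" "cover_ok Q (Suc k2) (e + c2) r2"
  shows "cover_ok Q (k1 + k2) (c1 + c2) (r1 + r2)"
  using assms unfolding cover_ok_def by (cases "even k1"; cases "even k2") (simp_all add: algebra_simps)

text \<open>For \<open>Q = 2 * K\<^sub>1 + 2 * K\<^sub>2\<close> the case \<open>k = 0\<close> of the second condition is the \<open>K\<^sub>1\<close>-bound, and the
  case \<open>k = 2\<close> the \<open>K\<^sub>2\<close>-bound.\<close>

definition \<Phi>_IIA :: "nat \<Rightarrow> nat \<Rightarrow> nat \<Rightarrow> nat \<Rightarrow> nat \<Rightarrow> bool" where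
  "\<Phi>_IIA Q K1 k c r \<longleftrightarrow> cover_ok Q k c r \<and> (even k \<and> odd (c + r) \<longrightarrow> 2 * c + 4 * K1 + 2 \<le> k * Q + 2 * r)"

text \<open>For an odd total exactly one of the glued walks is odd. It supplies the second
  inequality and the other one \<open>cover_ok\<close>, with \<open>e\<close> chosen in exactly one
  of them so that the parities of the numbers of chosen labels fit.\<close>

lemma cycle_condition_IIA:
  assumes "2 * \<delta> + 1 \<le> Q" "2 * K1 + 1 \<le> Q"
  shows "cycle_condition \<delta> (\<Phi>_IIA Q K1)"
proof
  show "\<Phi>_IIA Q K1 0 0 0" by (simp add: \<Phi>_IIA_def cover_ok_def)
  fix a assume "1 \<le> a" "a \<le> \<delta>"
  then show "good (\<Phi>_IIA Q K1) {#a, a#}" using assms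
    by (simp add: good_add_mset good_empty \<Phi>_IIA_def cover_ok_def)
next
  fix k c r assume "c \<le> k * \<delta>" "\<Phi>_IIA Q K1 k c r"
  then show "\<Phi>_IIA Q K1 (Suc k) c r" using cover_ok_zero[of \<delta> Q c k r] assms
    by (auto simp: \<Phi>_IIA_def cover_ok_def)
next
  fix e k1 c1 r1 k2 c2 r2
  assume *: "\<Phi>_IIA Q K1 k1 c1 (e + r1)" "\<Phi>_IIA Q K1 (Suc k1) (e + c1) r1"
    "\<Phi>_IIA Q K1 k2 c2 (e + r2)" "\<Phi>_IIA Q K1 (Suc k2) (e + c2) r2"
  have "2 * (c1 + c2) + 4 * K1 + 2 \<le> (k1 + k2) * Q + 2 * (r1 + r2)"
    if "even (k1 + k2)" "odd (c1 + c2 + (r1 + r2))"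
    using * that
    by (cases "even k1"; cases "even (c1 + e + r1)") (auto simp: \<Phi>_IIA_def cover_ok_def algebra_simps)
  then show "\<Phi>_IIA Q K1 (k1 + k2) (c1 + c2) (r1 + r2)"
    using cover_ok_glue[of Q k1 c1 e r1 k2 c2 r2] * by (simp add: \<Phi>_IIA_def)
qed

definition \<Phi>_K :: "nat \<Rightarrow> nat \<Rightarrow> nat \<Rightarrow> nat \<Rightarrow> nat \<Rightarrow> nat \<Rightarrow> bool" where
  "\<Phi>_K Q K1 K2 k c r \<longleftrightarrow> cover_ok Q k c r \<and>
     (odd (c + r) \<longrightarrow> (k = 0 \<longrightarrow> 2 * K1 + 1 \<le> r) \<and> (k = 2 \<longrightarrow> c + 1 \<le> 2 * K2 + r))"

text \<open>If the walk without chosen labels is odd, its bound and \<open>e \<le> r1\<close> give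
  \<open>r1 \<ge> K1 + 1\<close>, which falls short only in the extremal case
  \<open>r1 = K1 + 1\<close>, \<open>e = K1\<close>, \<open>r = 0\<close>,
  \<open>c = 2 * \<delta> = K1 + 2 * K2 + 1\<close>. There \<open>K1\<close> is odd, which
  contradicts the even sum of the other walk.\<close>

lemma \<Phi>_K_glue_aux1:
  fixes K1 K2 :: nat
  assumes "2 * \<delta> \<le> K1 + 2 * K2 + 1" "c \<le> 2 * \<delta>" "e \<le> r1"
    and "odd (e + r1) \<longrightarrow> 2 * K1 + 1 \<le> e + r1" "odd (c + (e + r)) \<longrightarrow> c + 1 \<le> 2 * K2 + (e + r)"
    and "odd (c + (r1 + r))"
  shows "c + 1 \<le> 2 * K2 + (r1 + r)"
proof (cases "odd (c + (e + r))")
  case True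
  then show ?thesis using assms by linarith
next
  case False
  then have odd1: "odd (e + r1)" using assms(6) by presburger
  then have le: "2 * K1 + 1 \<le> e + r1" using assms(4) by blast
  show ?thesis
  proof (rule ccontr)
    assume "\<not> ?thesis"
    then have neg: "2 * K2 + (r1 + r) \<le> c" by linarith
    then have "r1 \<le> K1 + 1" using assms(1,2) by linarith
    then have r1: "r1 = K1 + 1" using le assms(3) by linarith
    then have "r = 0" "c = 2 * \<delta>" "2 * \<delta> = K1 + 2 * K2 + 1" using neg assms(1,2) by linarith+
    moreover have "e = K1" using odd1 le assms(3) r1 by presburger
    ultimately show False using False odd1 r1 by presburger
  qed
qed

lemma \<Phi>_K_glue_aux2:
  assumes "e \<le> \<delta>" "c2 \<le> k2 * \<delta>" "2 * \<delta> \<le> K1 + 2 * K2 + 1" "k1 = 0" "c1 = 0" "k2 = 2"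
    "\<Phi>_K Q K1 K2 k1 c1 (e + r1)" "\<Phi>_K Q K1 K2 (Suc k1) (e + c1) r1"
    "\<Phi>_K Q K1 K2 k2 c2 (e + r2)" "odd (c1 + c2 + (r1 + r2))"
  shows "c1 + c2 + 1 \<le> 2 * K2 + (r1 + r2)"
  using \<Phi>_K_glue_aux1[of \<delta> K1 K2 c2 e r1 r2] assms by (auto simp: \<Phi>_K_def cover_ok_def)

lemma cycle_condition_K:
  assumes "2 * \<delta> + 1 \<le> Q" "2 * \<delta> \<le> K1 + 2 * K2 + 1" "1 \<le> K2"
  shows "cycle_condition \<delta> (\<Phi>_K Q K1 K2)"
proof
  show "\<Phi>_K Q K1 K2 0 0 0" by (simp add: \<Phi>_K_def cover_ok_def)
  fix a assume "1 \<le> a" "a \<le> \<delta>"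
  then show "good (\<Phi>_K Q K1 K2) {#a, a#}" using assms
    by (simp add: good_add_mset good_empty \<Phi>_K_def cover_ok_def)
next
  fix k c r assume "c \<le> k * \<delta>" "\<Phi>_K Q K1 K2 k c r"
  then show "\<Phi>_K Q K1 K2 (Suc k) c r" using cover_ok_zero[of \<delta> Q c k r] assms
    by (auto simp: \<Phi>_K_def cover_ok_def)
next
  fix e k1 c1 r1 k2 c2 r2
  assume b: "e \<le> \<delta>" "c1 \<le> k1 * \<delta>" "c2 \<le> k2 * \<delta>"
  assume *: "\<Phi>_K Q K1 K2 k1 c1 (e + r1)" "\<Phi>_K Q K1 K2 (Suc k1) (e + c1) r1"
    "\<Phi>_K Q K1 K2 k2 c2 (e + r2)" "\<Phi>_K Q K1 K2 (Suc k2) (e + c2) r2"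
  have "2 * K1 + 1 \<le> r1 + r2" if "k1 + k2 = 0" "odd (c1 + c2 + (r1 + r2))"
    using * b that by (cases "even (e + r1)") (auto simp: \<Phi>_K_def cover_ok_def)
  moreover have "c1 + c2 + 1 \<le> 2 * K2 + (r1 + r2)" if k: "k1 + k2 = 2" and odd: "odd (c1 + c2 + (r1 + r2))"
  proof -
    consider "k1 = 0" "k2 = 2" | "k1 = 1" "k2 = 1" | "k1 = 2" "k2 = 0" using k by linarith
    then show ?thesis
    proof cases
      case 1
      then show ?thesis using \<Phi>_K_glue_aux2[of e \<delta> c2 k2 K1 K2 k1 c1 Q r1 r2] * b assms odd by simp
    next
      case 2
      then show ?thesis using * odd by (cases "even (c1 + e + r1)") (auto simp: \<Phi>_K_def cover_ok_def)
    next
      case 3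
      then show ?thesis using \<Phi>_K_glue_aux2[of e \<delta> c1 k1 K1 K2 k2 c2 Q r2 r1] * b assms odd by (simp add: ac_simps)
    qed
  qed
  ultimately show "\<Phi>_K Q K1 K2 (k1 + k2) (c1 + c2) (r1 + r2)"
    using cover_ok_glue[of Q k1 c1 e r1 k2 c2 r2] * by (simp add: \<Phi>_K_def)
qed

text \<open>When \<open>C0\<close> and \<open>C1\<close> are not consecutive, no single
  \<open>Q\<close> expresses both perimeter bounds; they are imposed on three chosen labels
  according to parity.\<close>

definition \<Phi>_KC :: "nat \<Rightarrow> nat \<Rightarrow> nat \<Rightarrow> nat \<Rightarrow> nat \<Rightarrow> nat \<Rightarrow> nat \<Rightarrow> nat \<Rightarrow> bool" where
  "\<Phi>_KC Q K1 K2 C0 C1 k c r \<longleftrightarrow> \<Phi>_K Q K1 K2 k c r \<and>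
     (k = 3 \<longrightarrow> c < (if even (c + r) then C0 else C1) + r)"

lemma \<Phi>_KC_glue_aux1:
  assumes "3 * \<delta> \<le> C0 + K1" "3 * \<delta> \<le> C1 + K1" "c2 \<le> k2 * \<delta>" "k1 = 0" "c1 = 0" "k2 = 3"
    "\<Phi>_KC Q K1 K2 C0 C1 k1 c1 (e + r1)" "\<Phi>_KC Q K1 K2 C0 C1 (Suc k1) (e + c1) r1"
    "\<Phi>_KC Q K1 K2 C0 C1 k2 c2 (e + r2)"
  shows "c1 + c2 < (if even (c1 + c2 + (r1 + r2)) then C0 else C1) + (r1 + r2)"
proof -
  have e: "e \<le> r1" and k: "odd (e + r1) \<longrightarrow> 2 * K1 + 1 \<le> e + r1"
    and c: "c2 < (if even (c2 + (e + r2)) then C0 else C1) + (e + r2)" and c2: "c2 \<le> 3 * \<delta>"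
    using assms(3-) by (auto simp: \<Phi>_KC_def \<Phi>_K_def cover_ok_def)
  show ?thesis
  proof (cases "odd (e + r1)")
    case True
    then have "K1 + 1 \<le> r1" using k e by linarith
    then show ?thesis using assms(1,2,5) c2 by auto
  next
    case False
    then have "even (c1 + c2 + (r1 + r2)) = even (c2 + (e + r2))" using assms(5) by presburger
    then show ?thesis using c e assms(5) by auto
  qed
qed

text \<open>For an odd first walk, adding \<open>c1 \<le> e + r1\<close> and
  \<open>e + c1 + 1 \<le> 2 * K2 + r1\<close> eliminates \<open>e\<close> and leaves
  \<open>c1 + 1 \<le> K2 + r1\<close>. This is where the bounds \<open>2 * \<delta> + K2\<close> on
  \<open>C0\<close> and \<open>C1\<close> enter.\<close>

lemma \<Phi>_KC_glue_aux2:
  assumes "2 * \<delta> + K2 \<le> C0" "2 * \<delta> + K2 \<le> C1" "c2 \<le> k2 * \<delta>" "k1 = 1" "k2 = 2"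
    "\<Phi>_KC Q K1 K2 C0 C1 k1 c1 (e + r1)" "\<Phi>_KC Q K1 K2 C0 C1 (Suc k1) (e + c1) r1"
    "\<Phi>_KC Q K1 K2 C0 C1 (Suc k2) (e + c2) r2"
  shows "c1 + c2 < (if even (c1 + c2 + (r1 + r2)) then C0 else C1) + (r1 + r2)"
proof -
  have e: "c1 \<le> e + r1" and k: "odd (e + c1 + r1) \<longrightarrow> e + c1 + 1 \<le> 2 * K2 + r1"
    and c: "e + c2 < (if even (e + c2 + r2) then C0 else C1) + r2" and c2: "c2 \<le> 2 * \<delta>"
    using assms(3-) by (auto simp: \<Phi>_KC_def \<Phi>_K_def cover_ok_def numeral_2_eq_2 numeral_3_eq_3)
  show ?thesis
  proof (cases "odd (e + c1 + r1)")
    case True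
    then have "c1 + 1 \<le> K2 + r1" using k e by linarith
    then show ?thesis using assms(1,2) c2 by auto
  next
    case False
    then have "even (c1 + c2 + (r1 + r2)) = even (e + c2 + r2)" by presburger
    then show ?thesis using c e by auto
  qed
qed

lemma cycle_condition_KC:
  assumes "2 * \<delta> + 1 \<le> Q" "2 * \<delta> \<le> K1 + 2 * K2 + 1" "1 \<le> K2" "\<delta> \<le> K1 + K2"
    and C: "2 * \<delta> + K2 \<le> C0" "2 * \<delta> + K2 \<le> C1"
  shows "cycle_condition \<delta> (\<Phi>_KC Q K1 K2 C0 C1)"
proof -
  interpret K: cycle_condition \<delta> "\<Phi>_K Q K1 K2" using assms(1-3) by (rule cycle_condition_K)
  show ?thesis
  proof
    show "\<Phi>_KC Q K1 K2 C0 C1 0 0 0" by (simp add: \<Phi>_KC_def K.\<Phi>_empty)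
    fix a assume "1 \<le> a" "a \<le> \<delta>"
    then show "good (\<Phi>_KC Q K1 K2 C0 C1) {#a, a#}" using K.\<Phi>_edge[of a]
      by (simp add: good_add_mset good_empty \<Phi>_KC_def)
  next
    fix k c r assume "c \<le> k * \<delta>" "\<Phi>_KC Q K1 K2 C0 C1 k c r"
    then show "\<Phi>_KC Q K1 K2 C0 C1 (Suc k) c r" using K.\<Phi>_zero[of c k r] C assms(3)
      by (auto simp: \<Phi>_KC_def)
  next
    fix e k1 c1 r1 k2 c2 r2
    assume b: "e \<le> \<delta>" "c1 \<le> k1 * \<delta>" "c2 \<le> k2 * \<delta>"
    assume *: "\<Phi>_KC Q K1 K2 C0 C1 k1 c1 (e + r1)" "\<Phi>_KC Q K1 K2 C0 C1 (Suc k1) (e + c1) r1"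
      "\<Phi>_KC Q K1 K2 C0 C1 k2 c2 (e + r2)" "\<Phi>_KC Q K1 K2 C0 C1 (Suc k2) (e + c2) r2"
    have C': "3 * \<delta> \<le> C0 + K1" "3 * \<delta> \<le> C1 + K1" using assms by linarith+
    have "c1 + c2 < (if even (c1 + c2 + (r1 + r2)) then C0 else C1) + (r1 + r2)" if k: "k1 + k2 = 3"
    proof -
      consider "k1 = 0" "k2 = 3" | "k1 = 1" "k2 = 2" | "k1 = 2" "k2 = 1" | "k1 = 3" "k2 = 0" using k by linarith
      then show ?thesis
      proof cases
        case 1
        then show ?thesis using \<Phi>_KC_glue_aux1[OF C', of c2 k2 k1 c1 Q K2 e r1 r2] * b by simp
      next
        case 2
        then show ?thesis using \<Phi>_KC_glue_aux2[OF C, of c2 k2 k1 Q K1 c1 e r1 r2] * b by simp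
      next
        case 3
        then show ?thesis using \<Phi>_KC_glue_aux2[OF C, of c1 k1 k2 Q K1 c2 e r2 r1] * b by (simp add: ac_simps)
      next
        case 4
        then show ?thesis using \<Phi>_KC_glue_aux1[OF C', of c1 k1 k2 c2 Q K2 e r2 r1] * b by (simp add: ac_simps)
      qed
    qed
    then show "\<Phi>_KC Q K1 K2 C0 C1 (k1 + k2) (c1 + c2) (r1 + r2)"
      using K.\<Phi>_glue[OF b] * by (simp add: \<Phi>_KC_def)
  qed
qed

text \<open>With \<open>K1 = K2 = K\<close> and \<open>C1 = 4 * K + 1\<close> the four bounds on odd
  triangles are the cases \<open>k = 0, 1, 2, 3\<close> of one inequality. It is imposed for all
  \<open>k\<close>, because some sides of the completion unfold to two chosen edges and
  \<open>k\<close> then exceeds 3.\<close>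

definition \<Phi>_IIB :: "nat \<Rightarrow> nat \<Rightarrow> nat \<Rightarrow> nat \<Rightarrow> nat \<Rightarrow> nat \<Rightarrow> bool" where
  "\<Phi>_IIB Q K C0 k c r \<longleftrightarrow> cover_ok Q k c r \<and> (odd (c + r) \<longrightarrow> 2 * K + 1 + c \<le> k * (2 * K) + r) \<and>
     (even (c + r) \<and> k = 3 \<longrightarrow> c < C0 + r)"

text \<open>An odd walk through the edge \<open>e\<close>, used with \<open>e\<close> unchosen and
  with \<open>e\<close> chosen, misses its bound without \<open>e\<close> by at most
  \<open>min e (2 * K - e)\<close>; the even walk has to make up for this. For \<open>k2 = 2\<close>
  the only failure would be \<open>e = K\<close>, \<open>c2 = 2 * \<delta>\<close>,
  \<open>r2 = 0\<close>, which has odd sum. For \<open>k2 \<ge> 3\<close> the estimate rests on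
  \<open>3 * \<delta> + K \<le> 6 * K\<close>, which uses \<open>K \<ge> 3\<close>.\<close>

lemma \<Phi>_IIB_glue_aux0:
  assumes K: "3 * K + 1 = 2 * \<delta>" "odd K" "3 \<le> K" and c2: "c2 \<le> k2 * \<delta>" and e: "e \<le> \<delta>"
    and v: "\<Phi>_IIB Q K C0 k2 c2 (e + r2)" "\<Phi>_IIB Q K C0 (Suc k2) (e + c2) r2" "even (c2 + (e + r2))"
  shows "min e (2 * K - e) + c2 \<le> k2 * (2 * K) + r2"
proof -
  consider "k2 = 0" | "k2 = 1" | "k2 = 2" | "3 \<le> k2" by linarith
  then show ?thesis
  proof cases
    case 1
    then have "e \<le> r2" "c2 = 0" using v c2 by (auto simp: \<Phi>_IIB_def cover_ok_def)
    then show ?thesis by simp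
  next
    case 2
    then have "c2 \<le> e + r2" using v by (auto simp: \<Phi>_IIB_def cover_ok_def)
    then show ?thesis using 2 e K by (cases "e \<le> K") (auto simp: min_def)
  next
    case 3
    have "c2 \<le> 2 * \<delta>" using c2 3 by simp
    show ?thesis
    proof (rule ccontr)
      assume "\<not> ?thesis"
      then have *: "4 * K + r2 < min e (2 * K - e) + c2" using 3 by simp
      have "min e (2 * K - e) \<le> K" by (cases "e \<le> K") (simp_all add: min.coboundedI1 min.coboundedI2)
      then have "min e (2 * K - e) = K" "c2 = 2 * \<delta>" "r2 = 0" using * \<open>c2 \<le> 2 * \<delta>\<close> K by linarith+
      moreover from this have "e = K" using K by (auto simp: min_def split: if_splits)
      ultimately show False using v(3) K by simp
    qed
  next
    case 4
    then obtain j where j: "k2 = j + 3" using le_Suc_ex[of 3 k2] by (auto simp: add.commute)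
    have "\<delta> \<le> 2 * K" using K by linarith
    then have "j * \<delta> \<le> j * (2 * K)" by (rule mult_le_mono2)
    moreover have "c2 \<le> 3 * \<delta> + j * \<delta>" using c2 j by (simp add: add_mult_distrib)
    ultimately have "c2 \<le> 3 * \<delta> + j * (2 * K)" by linarith
    moreover have "min e (2 * K - e) \<le> K" by (cases "e \<le> K") (simp_all add: min.coboundedI1 min.coboundedI2)
    ultimately show ?thesis using j K by (simp add: algebra_simps)
  qed
qed

lemma \<Phi>_IIB_glue_odd:
  assumes K: "3 * K + 1 = 2 * \<delta>" "odd K" "3 \<le> K" and c2: "c2 \<le> k2 * \<delta>" and e: "e \<le> \<delta>"
    and u: "\<Phi>_IIB Q K C0 k1 c1 (e + r1)" "\<Phi>_IIB Q K C0 (Suc k1) (e + c1) r1" "odd (c1 + (e + r1))"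
    and v: "\<Phi>_IIB Q K C0 k2 c2 (e + r2)" "\<Phi>_IIB Q K C0 (Suc k2) (e + c2) r2" "even (c2 + (e + r2))"
  shows "2 * K + 1 + (c1 + c2) \<le> (k1 + k2) * (2 * K) + (r1 + r2)"
proof -
  have "2 * K + 1 + c1 \<le> k1 * (2 * K) + (e + r1)" "2 * K + 1 + (e + c1) \<le> Suc k1 * (2 * K) + r1"
    using u by (auto simp: \<Phi>_IIB_def ac_simps)
  then have "2 * K + 1 + c1 \<le> k1 * (2 * K) + (min e (2 * K - e) + r1)"
    using e K by (auto simp: min_def)
  with \<Phi>_IIB_glue_aux0[OF K c2 e v] show ?thesis by (simp add: add_mult_distrib)
qed

lemma \<Phi>_IIB_glue_even3:
  assumes K: "3 * K + 1 = 2 * \<delta>" "odd K" "3 \<le> K" "4 * K + 4 \<le> C0"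
    and c2: "c2 \<le> k2 * \<delta>" and c1: "c1 \<le> k1 * \<delta>" and e: "e \<le> \<delta>"
    and u: "\<Phi>_IIB Q K C0 k1 c1 (e + r1)" "\<Phi>_IIB Q K C0 (Suc k1) (e + c1) r1"
    and v: "\<Phi>_IIB Q K C0 k2 c2 (e + r2)" "\<Phi>_IIB Q K C0 (Suc k2) (e + c2) r2"
    and ev: "even (c1 + c2 + (r1 + r2))" and k: "k1 = 0 \<and> k2 = 3 \<or> k1 = 1 \<and> k2 = 2"
  shows "c1 + c2 < C0 + (r1 + r2)"
  using k
proof
  assume k: "k1 = 0 \<and> k2 = 3"
  have c: "c1 = 0" "c2 \<le> 3 * \<delta>" "e \<le> r1" using c1 c2 k u by (auto simp: \<Phi>_IIB_def cover_ok_def)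
  show ?thesis
  proof (cases "even (e + r1)")
    case True
    then have "c2 < C0 + (e + r2)" using ev c k v by (auto simp: \<Phi>_IIB_def)
    then show ?thesis using c by linarith
  next
    case False
    then have "2 * K + 1 \<le> e + r1" using u k c by (auto simp: \<Phi>_IIB_def)
    then show ?thesis using c K by linarith
  qed
next
  assume k: "k1 = 1 \<and> k2 = 2"
  have c: "c2 \<le> 2 * \<delta>" "c1 \<le> e + r1" using c1 c2 k u by (auto simp: \<Phi>_IIB_def cover_ok_def)
  show ?thesis
  proof (cases "even (c1 + e + r1)")
    case True
    then have "even (e + c2 + r2)" using ev by presburger
    then have "e + c2 < C0 + r2" using k v by (auto simp: \<Phi>_IIB_def)
    then show ?thesis using c by linarith
  next
    case False
    then have "2 * K + 1 + (e + c1) \<le> 4 * K + r1" using u k by (auto simp: \<Phi>_IIB_def ac_simps)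
    then show ?thesis using c K by linarith
  qed
qed

lemma cycle_condition_IIB:
  assumes K: "3 * K + 1 = 2 * \<delta>" "odd K" "3 \<le> K" "4 * K + 4 \<le> C0" and Q: "2 * \<delta> + 1 \<le> Q"
  shows "cycle_condition \<delta> (\<Phi>_IIB Q K C0)"
proof
  show "\<Phi>_IIB Q K C0 0 0 0" by (simp add: \<Phi>_IIB_def cover_ok_def)
  fix a assume "1 \<le> a" "a \<le> \<delta>"
  then show "good (\<Phi>_IIB Q K C0) {#a, a#}" using assms
    by (simp add: good_add_mset good_empty \<Phi>_IIB_def cover_ok_def)
next
  fix k c r assume "c \<le> k * \<delta>" "\<Phi>_IIB Q K C0 k c r"
  then show "\<Phi>_IIB Q K C0 (Suc k) c r" using cover_ok_zero[of \<delta> Q c k r] assms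
    by (auto simp: \<Phi>_IIB_def)
next
  fix e k1 c1 r1 k2 c2 r2
  assume b: "e \<le> \<delta>" "c1 \<le> k1 * \<delta>" "c2 \<le> k2 * \<delta>"
  assume *: "\<Phi>_IIB Q K C0 k1 c1 (e + r1)" "\<Phi>_IIB Q K C0 (Suc k1) (e + c1) r1"
    "\<Phi>_IIB Q K C0 k2 c2 (e + r2)" "\<Phi>_IIB Q K C0 (Suc k2) (e + c2) r2"
  have "2 * K + 1 + (c1 + c2) \<le> (k1 + k2) * (2 * K) + (r1 + r2)" if odd: "odd (c1 + c2 + (r1 + r2))"
  proof (cases "odd (c1 + (e + r1))")
    case True
    then have "even (c2 + (e + r2))" using odd by presburger
    then show ?thesis using \<Phi>_IIB_glue_odd[OF K(1-3) b(3,1) *(1,2) True *(3,4)] by blast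
  next
    case False
    then have "odd (c2 + (e + r2))" "even (c1 + (e + r1))" using odd by presburger+
    then show ?thesis using \<Phi>_IIB_glue_odd[OF K(1-3) b(2,1) *(3,4) _ *(1,2)] by (simp add: ac_simps)
  qed
  moreover have "c1 + c2 < C0 + (r1 + r2)" if ev: "even (c1 + c2 + (r1 + r2))" and k: "k1 + k2 = 3"
  proof -
    have ev': "even (c2 + c1 + (r2 + r1))" using ev by (simp add: ac_simps)
    consider "k1 = 0 \<and> k2 = 3 \<or> k1 = 1 \<and> k2 = 2" | "k2 = 0 \<and> k1 = 3 \<or> k2 = 1 \<and> k1 = 2" using k by linarith
    then show ?thesis
    proof cases
      case 1
      then show ?thesis using \<Phi>_IIB_glue_even3[OF K b(3,2,1) * ev] by blast
    next
      case 2
      then show ?thesis using \<Phi>_IIB_glue_even3[OF K b(2,3,1) *(3,4,1,2) ev'] by (simp add: ac_simps)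
    qed
  qed
  ultimately show "\<Phi>_IIB Q K C0 (k1 + k2) (c1 + c2) (r1 + r2)"
    using cover_ok_glue[of Q k1 c1 e r1 k2 c2 r2] * by (simp add: \<Phi>_IIB_def)
qed

text \<open>Splittings with \<open>k = 0, 1, 2, 3\<close> chosen sides give the
  \<open>K1\<close>-bound, the triangle inequality, the \<open>K2\<close>-bound and the perimeter
  bound. In the last claim the inequality is sharper by 1 for odd perimeters, where parity makes the
  metric bounds strict.\<close>

lemma good_triangle:
  assumes "a \<le> \<delta>" "b \<le> \<delta>" "c \<le> \<delta>" "a \<le> b + c" "b \<le> a + c" "c \<le> a + b" "triangle_ok K1 K2 C0 C1 a b c"
  shows "a + b + c \<le> Q \<Longrightarrow> Q = 2 * K1 + 2 * K2 \<Longrightarrow> good (\<Phi>_IIA Q K1) {#a, b, c#}"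
    and "a + b + c \<le> Q \<Longrightarrow> good (\<Phi>_K Q K1 K2) {#a, b, c#}"
    and "a + b + c \<le> Q \<Longrightarrow> good (\<Phi>_KC Q K1 K2 C0 C1) {#a, b, c#}"
    and "a + b + c \<le> Q \<Longrightarrow> K1 = K2 \<Longrightarrow> C1 \<le> 4 * K2 + 1 \<Longrightarrow> good (\<Phi>_IIB Q K2 C0) {#a, b, c#}"
  subgoal
    using assms unfolding triangle_ok_iff good_add_mset good_empty \<Phi>_IIA_def cover_ok_def
    by (cases "odd (a + b + c)") (simp_all add: ac_simps, linarith?)
  subgoal
    using assms unfolding triangle_ok_iff good_add_mset good_empty \<Phi>_K_def cover_ok_def
    by (cases "odd (a + b + c)") (simp_all add: ac_simps, linarith?)
  subgoal
    using assms unfolding triangle_ok_iff good_add_mset good_empty \<Phi>_K_def \<Phi>_KC_def cover_ok_def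
    by (cases "odd (a + b + c)") (simp_all add: ac_simps, linarith?)
  subgoal premises prems
  proof (cases "odd (a + b + c)")
    case True
    then have "a \<noteq> b + c" "b \<noteq> a + c" "c \<noteq> a + b" "a + b + c \<noteq> 4 * K2" by presburger+
    then show ?thesis using True assms prems
      unfolding triangle_ok_iff good_add_mset good_empty \<Phi>_IIB_def cover_ok_def
      by (simp add: ac_simps)
  next
    case False
    then show ?thesis using assms prems
      unfolding triangle_ok_iff good_add_mset good_empty \<Phi>_IIB_def cover_ok_def
      by (simp add: ac_simps)
  qed
  done

section \<open>The completion lies in the class\<close>

lemma odd_less: "odd p \<Longrightarrow> \<not> 2 * k < p \<Longrightarrow> p < 2 * k" for p k :: nat
  by presburger

lemma odd_ge: "odd (a + b + c) \<Longrightarrow> \<not> a + b < 2 * k + c \<Longrightarrow> 2 * k + c + 1 \<le> a + b" for a b c k :: nat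
  by presburger

lemma double_diff:
  "2 * a \<le> q \<Longrightarrow> 2 * b \<le> q \<Longrightarrow> q - 2 * a + (q - 2 * b) + 2 * c = 2 * (q - (a + b) + c)" for a b c q :: nat
  by presburger

context completion
begin

lemma att_mono: "att n x y k c r \<Longrightarrow> n \<le> n' \<Longrightarrow> att n' x y k c r"
proof -
  assume "att n x y k c r" "n \<le> n'"
  then obtain ch oth where "lpath d x y (ch + oth)" "size (ch + oth) \<le> n'" "size ch = k" "sum_mset ch = c" "sum_mset oth = r"
    unfolding att_def by (metis le_trans)
  then show ?thesis unfolding att_def by blast
qed

lemma R_closed_even:
  assumes "R x x False c" "c \<le> 20 * \<delta>"
  obtains k s r where "even k" "c + 2 * s = k * Q + 2 * r" "\<Phi> k s r"
proof -
  obtain ch oth where *: "lpath d x x (ch + oth)" "even (size ch)"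
     "c + 2 * sum_mset ch = size ch * Q + 2 * sum_mset oth" using assms(1) unfolding R_def by blast
  have "good \<Phi> (ch + oth)" using closed_path_good[OF *(1)] size_le_cost(2)[OF *(1,3)] assms(2) by linarith
  then have "\<Phi> (size ch) (sum_mset ch) (sum_mset oth)" by (auto simp: good_def)
  then show thesis using that *(2,3) by blast
qed

lemma D_less: "x \<noteq> y \<Longrightarrow> D x y < M \<Longrightarrow> R x y False (2 * D x y)"
  and D_greater: "x \<noteq> y \<Longrightarrow> M < D x y \<Longrightarrow> R x y True (Q - 2 * D x y)"
  using admits_D[of x y] by (auto simp: admits_def)

lemma D_metric:
  assumes "x \<noteq> y" "y \<noteq> z" "x \<noteq> z"
  shows "D x z \<le> D x y + D y z" "D x y \<le> D x z + D y z" "D y z \<le> D x y + D x z"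
  using D_triangle[of x y z] D_triangle[of x z y] D_triangle[of y x z] assms
  by (simp_all add: D_sym[of z y] D_sym[of y x])

end

text \<open>One position of the short side suffices, as \<open>x\<close>, \<open>y\<close>,
  \<open>z\<close> may be permuted; \<open>triangle_okI\<close> recovers the other two.\<close>

definition odd_triangles_ok :: "nat \<Rightarrow> nat \<Rightarrow> ('b \<Rightarrow> 'b \<Rightarrow> nat) \<Rightarrow> bool" where
  "odd_triangles_ok K1 K2 D \<longleftrightarrow> (\<forall>x y z. x \<noteq> y \<and> y \<noteq> z \<and> x \<noteq> z \<and> odd (D x y + D y z + D x z) \<longrightarrow>
     2 * K1 < D x y + D y z + D x z \<and> D x y + D y z < 2 * K2 + D x z)"

lemma triangle_okI:
  assumes sym: "\<And>x y. D x y = D y x" and K: "odd_triangles_ok K1 K2 D"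
    and C: "odd (D x y + D y z + D x z) \<Longrightarrow> D x y + D y z + D x z < C1"
      "even (D x y + D y z + D x z) \<Longrightarrow> D x y + D y z + D x z < C0"
    and xyz: "x \<noteq> y" "y \<noteq> z" "x \<noteq> z"
  shows "triangle_ok K1 K2 C0 C1 (D x y) (D y z) (D x z)"
proof -
  have K': "2 * K1 < D u v + D v w + D u w \<and> D u v + D v w < 2 * K2 + D u w"
    if "u \<noteq> v" "v \<noteq> w" "u \<noteq> w" "odd (D u v + D v w + D u w)" for u v w
    using K[unfolded odd_triangles_ok_def, rule_format, of u v w] that by simp
  have 1: "odd (D x y + D y z + D x z) \<longrightarrow> 2 * K1 < D x y + D y z + D x z \<and> D x y + D y z < 2 * K2 + D x z"
    and 2: "odd (D y z + D z x + D y x) \<longrightarrow> D y z + D z x < 2 * K2 + D y x"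
    and 3: "odd (D y x + D x z + D y z) \<longrightarrow> D y x + D x z < 2 * K2 + D y z"
    using K'[of x y z] K'[of y z x] K'[of y x z] xyz by simp_all
  have t2: "odd (D x y + D y z + D x z) \<longrightarrow> D y z + D x z < 2 * K2 + D x y"
    using 2 sym[of z x] sym[of y x] by (simp add: ac_simps)
  have t3: "odd (D x y + D y z + D x z) \<longrightarrow> D x y + D x z < 2 * K2 + D y z"
    using 3 sym[of y x] by (simp add: ac_simps)
  show ?thesis using 1 t2 t3 C unfolding triangle_ok_iff by blast
qed

text \<open>The conditions range over the whole type, which avoids membership premises; points
  outside \<open>V\<close> are isolated in the labelled graph. The restriction to \<open>V\<close>
  comes with \<open>metric_structure\<close>.\<close>

definition completes ::
  "nat \<Rightarrow> nat \<Rightarrow> nat \<Rightarrow> nat \<Rightarrow> nat \<Rightarrow> 'b set \<Rightarrow> ('b \<Rightarrow> 'b \<Rightarrow> nat) \<Rightarrow> ('b \<Rightarrow> 'b \<Rightarrow> nat) \<Rightarrow> bool" where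
  "completes \<delta> K1 K2 C0 C1 V d D \<longleftrightarrow>
     (\<forall>x y. D x y = D y x) \<and> (\<forall>x. D x x = 0) \<and> (\<forall>x y. x \<noteq> y \<longrightarrow> 1 \<le> D x y) \<and> (\<forall>x y. D x y \<le> \<delta>) \<and>
     (\<forall>x y. d x y \<noteq> 0 \<longrightarrow> D x y = d x y) \<and>
     (\<forall>g. lgraph_auto V d g \<longrightarrow> (\<forall>x y. D (g x) (g y) = D x y)) \<and>
     (\<forall>x y z. x \<noteq> y \<and> y \<noteq> z \<and> x \<noteq> z \<longrightarrow> D x z \<le> D x y + D y z \<and> triangle_ok K1 K2 C0 C1 (D x y) (D y z) (D x z))"

lemma (in completion) completesI:
  assumes "odd_triangles_ok K1 K2 D"
    and "\<And>x y z. x \<noteq> y \<Longrightarrow> y \<noteq> z \<Longrightarrow> x \<noteq> z \<Longrightarrow> odd (D x y + D y z + D x z) \<Longrightarrow> D x y + D y z + D x z < C1"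
    and "\<And>x y z. x \<noteq> y \<Longrightarrow> y \<noteq> z \<Longrightarrow> x \<noteq> z \<Longrightarrow> even (D x y + D y z + D x z) \<Longrightarrow> D x y + D y z + D x z < C0"
  shows "completes \<delta> K1 K2 C0 C1 V d D"
  unfolding completes_def
proof (intro conjI allI impI)
  fix x y :: 'b show "D x y = D y x" by (rule D_sym)
next
  fix x y z :: 'b assume xyz: "x \<noteq> y \<and> y \<noteq> z \<and> x \<noteq> z"
  show "triangle_ok K1 K2 C0 C1 (D x y) (D y z) (D x z)"
    using triangle_okI[of D, OF D_sym assms(1)] assms(2,3) xyz by blast
qed (use D_refl D_bounds D_edge D_auto D_triangle in auto)

text \<open>A violation of the \<open>K1\<close>-bound has all sides below \<open>M\<close>, one of
  the \<open>K2\<close>-bound two sides above and one below. In both cases the attaining walks close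
  up within a copy, with odd half-length at least \<open>2 * K1 + 1\<close>;
  \<open>Q = 2 * K1 + 2 * K2\<close> turns this into the \<open>K2\<close>-bound in the second
  case.\<close>

lemma completes_IIA:
  assumes G: "lgraph \<delta> V d" and cg: "cycles_good (\<Phi>_IIA Q K1) d (20 * \<delta>)"
    and Qs: "Q = 2 * K1 + 2 * K2" "2 * \<delta> + 1 \<le> Q" "Q \<le> 3 * \<delta> + 1" "Q < C0" "Q < C1"
    and Ms: "1 \<le> M" "M \<le> \<delta>" "\<delta> \<le> 2 * M" "2 * M + \<delta> \<le> Q" "K1 \<le> M" "M \<le> K2"
  shows "\<exists>D. completes \<delta> K1 K2 C0 C1 V d D"
proof -
  interpret completion \<delta> Q M "\<Phi>_IIA Q K1" V d
    using assms by unfold_locales (auto simp: \<Phi>_IIA_def cover_ok_def)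
  have closed: "2 * K1 + 1 \<le> p" if "R x x False (2 * p)" "odd p" "2 * p \<le> 20 * \<delta>" for x p
  proof -
    obtain k s r where k: "even k" "2 * p + 2 * s = k * Q + 2 * r" "\<Phi>_IIA Q K1 k s r"
      using R_closed_even[OF \<open>R x x False (2 * p)\<close> \<open>2 * p \<le> 20 * \<delta>\<close>] by blast
    obtain j where j: "k = 2 * j" using k(1) by (rule evenE)
    \<comment> \<open>\<open>Q\<close> is even, so the half-length \<open>p\<close> has the parity
      of the label sum \<open>s + r\<close>, to which \<open>\<Phi>_IIA\<close> refers.\<close>
    have "p + s = j * Q + r" using k(2) j by simp
    then have "even (p + s) = even (j * Q + r)" by simp
    moreover have "even Q" using Qs(1) by simp
    ultimately have "odd (s + r)" using \<open>odd p\<close> by auto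
    then have "2 * s + 4 * K1 + 2 \<le> k * Q + 2 * r" using k(1,3) by (simp add: \<Phi>_IIA_def)
    with k(2) show ?thesis by linarith
  qed
  have K1: "2 * K1 < D x y + D y z + D x z"
    if "x \<noteq> y" "y \<noteq> z" "x \<noteq> z" "odd (D x y + D y z + D x z)" for x y z
  proof (rule ccontr)
    assume neg: "\<not> ?thesis"
    then have "D x y + D y z + D x z < 2 * K1" by (rule odd_less[OF that(4)])
    then have "D x y < M" "D y z < M" "D x z < M" using D_metric[OF that(1-3)] Ms by linarith+
    then have "R x y False (2 * D x y)" "R y z False (2 * D y z)" "R z x False (2 * D x z)"
      using D_less[of x y] D_less[of y z] R_sym[OF D_less[of x z]] that by auto
    from R_trans[OF R_trans[OF this(1,2)] this(3)]
    have R: "R x x False (2 * (D x y + D y z + D x z))" by (simp add: algebra_simps)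
    have "2 * (D x y + D y z + D x z) \<le> 20 * \<delta>"
      using add_mono[OF add_mono[OF D_bounds(2)[of x y] D_bounds(2)[of y z]] D_bounds(2)[of x z]] by simp
    from closed[OF R that(4) this] neg show False by linarith
  qed
  have K2: "D x y + D y z < 2 * K2 + D x z"
    if "x \<noteq> y" "y \<noteq> z" "x \<noteq> z" "odd (D x y + D y z + D x z)" for x y z
  proof (rule ccontr)
    assume neg: "\<not> ?thesis"
    have le: "D x y + D y z + D x z \<le> Q" using D_perimeter[OF that(1-3)] .
    have neg': "2 * K2 + D x z + 1 \<le> D x y + D y z" using that(4) neg by (rule odd_ge)
    have "D x y > M" "D y z > M" using neg' D_metric[OF that(1-3)] Ms by linarith+
    moreover have "D x z < M" using neg' le Qs Ms by linarith
    ultimately have "R x y True (Q - 2 * D x y)" "R y z True (Q - 2 * D y z)" "R z x False (2 * D x z)"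
      using D_greater[of x y] D_greater[of y z] R_sym[OF D_less[of x z]] that by auto
    from R_trans[OF R_trans[OF this(1,2)] this(3)]
    have R: "R x x False (Q - 2 * D x y + (Q - 2 * D y z) + 2 * D x z)" by simp
    have b: "2 * D x y \<le> Q" "2 * D y z \<le> Q" "D x z \<le> \<delta>" using D_bounds(2)[of x y] D_bounds(2)[of y z] D_bounds(2)[of x z] Qs by linarith+
    have bb: "D x y + D y z \<le> Q" using b by linarith
    have eq: "Q - 2 * D x y + (Q - 2 * D y z) + 2 * D x z = 2 * (Q - (D x y + D y z) + D x z)" using b(1,2) by (rule double_diff)
    have "odd (Q - (D x y + D y z) + D x z)" using that(4) Qs(1) bb by (auto simp: even_diff_nat)
    moreover have "Q - (D x y + D y z) + D x z \<le> 5 * \<delta>" using b(3) Qs(3) Ms(1,2) by linarith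
    then have "2 * (Q - (D x y + D y z) + D x z) \<le> 20 * \<delta>" by simp
    ultimately have "2 * K1 + 1 \<le> Q - (D x y + D y z) + D x z" by (rule closed[OF R[unfolded eq]])
    with neg Qs(1) bb show False by linarith
  qed
  have per: "D x y + D y z + D x z \<le> Q" if "x \<noteq> y" "y \<noteq> z" "x \<noteq> z" for x y z
    using D_perimeter[OF that] .
  have "completes \<delta> K1 K2 C0 C1 V d D"
  proof (rule completesI)
    show "odd_triangles_ok K1 K2 D" using K1 K2 by (simp add: odd_triangles_ok_def)
  qed (use per Qs in \<open>meson order_le_less_trans\<close>)+
  then show ?thesis by (rule exI[of _ D])
qed

locale completion_K = completion +
  fixes K1 K2
  assumes \<Phi>_K: "\<And>k c r. \<Phi> k c r \<Longrightarrow> odd (c + r) \<Longrightarrow> (k = 0 \<longrightarrow> 2 * K1 + 1 \<le> r) \<and> (k = 2 \<longrightarrow> c + 1 \<le> 2 * K2 + r)"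
    and K: "K1 \<le> M" "M \<le> K2" "2 * \<delta> \<le> 2 * K2 + M" "2 * \<delta> \<le> K1 + 2 * K2 + 1"
    and QK: "2 * \<delta> + K1 \<le> Q" "2 * \<delta> = K1 + 2 * K2 + 1 \<Longrightarrow> 2 * \<delta> + K1 + 1 \<le> Q"
begin

text \<open>In a violation of the \<open>K1\<close>-bound all sides are label sums of paths, so
  \<open>k = 0\<close>. In a violation of the \<open>K2\<close>-bound each long side contributes one
  chosen edge and the short side a path, so \<open>k = 2\<close>. The detours \<open>r1\<close>,
  \<open>r2\<close> occur among chosen and unchosen labels alike and cancel.\<close>

lemma odd_triangles_ok_D: "odd_triangles_ok K1 K2 D"
proof -
  have "2 * K1 < D x y + D y z + D x z"
    if "x \<noteq> y" "y \<noteq> z" "x \<noteq> z" "odd (D x y + D y z + D x z)" for x y z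
  proof (rule ccontr)
    assume neg: "\<not> ?thesis"
    then have "D x y + D y z + D x z < 2 * K1" by (rule odd_less[OF that(4)])
    then have "D x y < K1" "D y z < K1" "D x z < K1" using D_metric[OF that(1-3)] by linarith+
    then have "att \<delta> x y 0 0 (D x y)" "att \<delta> y z 0 0 (D y z)" "att \<delta> x z 0 0 (D x z)"
      using att_small[of x y] att_small[of y z] att_small[of x z] that K QK by auto
    from \<Phi>_K[OF att_triangle[OF this]] that(4) neg show False by simp
  qed
  moreover have "D x y + D y z < 2 * K2 + D x z"
    if "x \<noteq> y" "y \<noteq> z" "x \<noteq> z" "odd (D x y + D y z + D x z)" for x y z
  proof (rule ccontr)
    assume "\<not> ?thesis"
    with that(4) have neg: "2 * K2 + D x z + 1 \<le> D x y + D y z" by (rule odd_ge)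
    note b = D_bounds(2)[of x y] D_bounds(2)[of y z] D_bounds(2)[of x z]
    have gt: "D x y > M" "D y z > M" using neg D_metric[OF that(1-3)] K by linarith+
    note ne = that(1-3)
    have "3 * \<delta> < D x y + Q" "3 * \<delta> < D y z + Q" using neg b K QK D_bounds(1)[OF that(3)] by linarith+
    then obtain r1 r2 where "att \<delta> x y 1 (D x y + r1) r1" "att \<delta> y z 1 (D y z + r2) r2"
      using att_large[OF ne(1) gt(1)] att_large[OF ne(2) gt(2)] by metis
    moreover have "D x z < M" using neg b K by linarith
    \<comment> \<open>The violation gives
      \<open>D x z \<le> 2 * \<delta> - 2 * K2 - 1 \<le> K1\<close>. The value \<open>K1\<close> can
      occur only if \<open>2 * \<delta> = K1 + 2 * K2 + 1\<close>, and then \<open>QK(2)\<close>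
      provides the extra unit.\<close>
    have "D x z + 2 * \<delta> < Q"
    proof (cases "2 * \<delta> = K1 + 2 * K2 + 1")
      case True
      then show ?thesis using QK(2) neg b by linarith
    next
      case False
      then show ?thesis using QK(1) neg b K by linarith
    qed
    then have "att \<delta> x z 0 0 (D x z)" using att_small[OF that(3) \<open>D x z < M\<close>] by blast
    ultimately have "\<Phi> 2 (D x y + r1 + (D y z + r2)) (r1 + r2 + D x z)"
      using att_triangle[of x y 1 _ _ z 1 _ _ 0 0] by (fastforce simp: numeral_2_eq_2)
    moreover have "odd (D x y + r1 + (D y z + r2) + (r1 + r2 + D x z))" using that(4) by presburger
    ultimately show False using \<Phi>_K neg by fastforce
  qed
  ultimately show ?thesis by (simp add: odd_triangles_ok_def)
qed

end

lemma completes_IIIA: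
  assumes G: "lgraph \<delta> V d" and cg: "cycles_good (\<Phi>_K Q K1 K2) d (20 * \<delta>)"
    and Qs: "2 * \<delta> + 1 \<le> Q" "Q \<le> 3 * \<delta> + 1" "Q < C0" "Q < C1"
    and Ms: "1 \<le> M" "M \<le> \<delta>" "\<delta> \<le> 2 * M" "2 * M + \<delta> \<le> Q" "K1 \<le> M" "M \<le> K2" "2 * \<delta> \<le> 2 * K2 + M"
    and K: "2 * \<delta> \<le> K1 + 2 * K2 + 1" "2 * \<delta> + K1 \<le> Q" "2 * \<delta> = K1 + 2 * K2 + 1 \<Longrightarrow> 2 * \<delta> + K1 + 1 \<le> Q"
  shows "\<exists>D. completes \<delta> K1 K2 C0 C1 V d D"
proof -
  interpret completion_K \<delta> Q M "\<Phi>_K Q K1 K2" V d K1 K2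
    using assms by unfold_locales (auto simp: \<Phi>_K_def cover_ok_def)
  have per: "D x y + D y z + D x z \<le> Q" if "x \<noteq> y" "y \<noteq> z" "x \<noteq> z" for x y z
    using D_perimeter[OF that] .
  have "completes \<delta> K1 K2 C0 C1 V d D"
    using per Qs by (intro completesI odd_triangles_ok_D) (meson order_le_less_trans)+
  then show ?thesis by (rule exI[of _ D])
qed

text \<open>\<open>Q = 3 * \<delta>\<close> says nothing about perimeters. A triangle violating
  \<open>C0\<close> or \<open>C1\<close> has all sides above \<open>M\<close>, hence unfolds to
  three chosen edges with detours that cancel and preserve parity.\<close>

lemma completes_IIIB:
  assumes G: "lgraph \<delta> V d" and cg: "cycles_good (\<Phi>_KC (3 * \<delta>) K1 K2 C0 C1) d (20 * \<delta>)"
    and M: "1 \<le> M" "M \<le> \<delta>" "\<delta> \<le> 2 * M" "K1 \<le> M" "M \<le> K2" "2 * \<delta> \<le> 2 * K2 + M"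
    and K: "2 * \<delta> \<le> K1 + 2 * K2 + 1" "K1 \<le> \<delta>" "2 * \<delta> = K1 + 2 * K2 + 1 \<Longrightarrow> K1 + 1 \<le> \<delta>"
    and C: "M + 2 * \<delta> + 1 \<le> C0" "M + 2 * \<delta> + 1 \<le> C1"
  shows "\<exists>D. completes \<delta> K1 K2 C0 C1 V d D"
proof -
  interpret completion_K \<delta> "3 * \<delta>" M "\<Phi>_KC (3 * \<delta>) K1 K2 C0 C1" V d K1 K2
    using assms by unfold_locales (auto simp: \<Phi>_KC_def \<Phi>_K_def cover_ok_def)
  have per: "D x y + D y z + D x z < (if even (D x y + D y z + D x z) then C0 else C1)"
    if "x \<noteq> y" "y \<noteq> z" "x \<noteq> z" for x y z
  proof (rule ccontr)
    assume neg: "\<not> ?thesis"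
    then have "M + 2 * \<delta> + 1 \<le> D x y + D y z + D x z" using C by (auto split: if_splits)
    then have gt: "M < D x y" "M < D y z" "M < D x z"
      using D_bounds(2)[of x y] D_bounds(2)[of y z] D_bounds(2)[of x z] by linarith+
    have large: "\<exists>r. att \<delta> u v 1 (D u v + r) r" if "u \<noteq> v" "M < D u v" for u v
      using att_large[OF that] that by auto
    note ne = that(1-3)
    obtain r1 r2 r3 where r: "att \<delta> x y 1 (D x y + r1) r1" "att \<delta> y z 1 (D y z + r2) r2" "att \<delta> x z 1 (D x z + r3) r3"
      using large[OF ne(1) gt(1)] large[OF ne(2) gt(2)] large[OF ne(3) gt(3)] by blast
    from att_triangle[OF r]
    have "D x y + r1 + (D y z + r2) + (D x z + r3) <
      (if even (D x y + r1 + (D y z + r2) + (D x z + r3) + (r1 + r2 + r3)) then C0 else C1) + (r1 + r2 + r3)"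
      by (simp add: \<Phi>_KC_def numeral_3_eq_3)
    moreover have "even (D x y + r1 + (D y z + r2) + (D x z + r3) + (r1 + r2 + r3)) = even (D x y + D y z + D x z)"
      by presburger
    ultimately show False using neg by (simp split: if_splits)
  qed
  have "completes \<delta> K1 K2 C0 C1 V d D"
    using per by (intro completesI odd_triangles_ok_D) presburger+
  then show ?thesis by (rule exI[of _ D])
qed

text \<open>In case (IIB) the only obstacle to the label \<open>M = K\<close> on an undetermined pair is a common
  neighbour at distance \<open>\<delta>\<close> from both ends, which forces the label to be even. Such pairs get \<open>L = K - 1\<close>.\<close>

locale completion_IIB = completion \<delta> "3 * \<delta>" K "\<Phi>_IIB (3 * \<delta>) K C0" V d
  for \<delta> K C0 :: nat and V :: "'b set" and d +
  assumes K: "3 * K + 1 = 2 * \<delta>" "odd K" "3 \<le> K" and C0: "4 * K + 4 \<le> C0"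
begin

definition fork :: "'b \<Rightarrow> 'b \<Rightarrow> bool" where
  "fork x y \<longleftrightarrow> D x y = K \<and> (\<exists>z. d x z = \<delta> \<and> d z y = \<delta>)"

definition L :: nat where
  "L = K - 1"

definition D' :: "'b \<Rightarrow> 'b \<Rightarrow> nat" where
  "D' x y = (if fork x y then L else D x y)"

lemma fork_sym: "fork x y = fork y x"
proof -
  have "fork y x" if "fork x y" for x y
    using that D_sym[of x y] dsym[of x] dsym[of _ y] unfolding fork_def by auto
  then show ?thesis by blast
qed

lemma D'_sym: "D' x y = D' y x"
  unfolding D'_def using fork_sym[of x y] D_sym[of x y] by simp

lemma small: "x \<noteq> y \<Longrightarrow> D x y < K \<Longrightarrow> att \<delta> x y 0 0 (D x y)"
  using att_small[of x y] K by simp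

lemma large:
  assumes "x \<noteq> y" "K < D x y"
  shows "\<exists>r. att \<delta> x y 1 (D x y + r) r \<and> D x y + r \<le> \<delta> \<and> (r = 0 \<longrightarrow> d x y = D x y)"
proof -
  have "3 * \<delta> < D x y + 3 * \<delta>" using assms(2) by simp
  from att_large[OF assms this] show ?thesis by metis
qed

lemma fork_att: "fork x y \<Longrightarrow> att \<delta> x y 2 (2 * \<delta>) 0"
proof -
  assume "fork x y"
  then obtain z where z: "d x z = \<delta>" "d z y = \<delta>" unfolding fork_def by blast
  then have "att (1 + 1) x y (1 + 1) (d x z + d z y) (0 + 0)"
    using att_trans[OF att_edge att_edge, of x z y] K by simp
  then have "att 2 x y 2 (2 * \<delta>) 0" using z by (simp add: mult_2 numeral_2_eq_2)
  then show ?thesis by (rule att_mono) (use K in simp)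
qed

text \<open>The chosen edge realising \<open>D x y\<close> has label at most
  \<open>\<delta>\<close>, which leaves no room for a detour.\<close>

lemma large_max: "x \<noteq> y \<Longrightarrow> D x y = \<delta> \<Longrightarrow> d x y = \<delta>"
  using large[of x y] K by auto

text \<open>Let a side contribute \<open>2 * K * k + r - c\<close>: this is \<open>D x y\<close> for
  a side below \<open>K\<close>, \<open>2 * K - D x y\<close> for one above \<open>K\<close>, and
  \<open>4 * K - 2 * \<delta> = L\<close> for a fork. The contributions of an odd closed walk add up
  to at least \<open>2 * K + 1\<close>. The choice of \<open>L\<close> as replacement for
  \<open>K\<close> is thus the natural one.\<close>

lemma odd_triangle:
  assumes "att \<delta> x y k1 c1 r1" "att \<delta> y z k2 c2 r2" "att \<delta> x z k3 c3 r3"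
    and "odd (c1 + c2 + c3 + (r1 + r2 + r3))"
  shows "2 * K + 1 + (c1 + c2 + c3) \<le> (k1 + k2 + k3) * (2 * K) + (r1 + r2 + r3)"
  using att_triangle[OF assms(1-3)] assms(4) unfolding \<Phi>_IIB_def by blast

lemma even_triangle:
  assumes "att \<delta> x y 1 c1 r1" "att \<delta> y z 1 c2 r2" "att \<delta> x z 1 c3 r3"
    and "even (c1 + c2 + c3 + (r1 + r2 + r3))"
  shows "c1 + c2 + c3 < C0 + (r1 + r2 + r3)"
  using att_triangle[OF assms(1-3)] assms(4) unfolding \<Phi>_IIB_def by (simp add: numeral_3_eq_3)

lemma even_L: "even L" and L1: "L + 1 = K"
  using K by (auto simp: L_def)

lemma D'_fork: "fork x y \<Longrightarrow> D' x y = L" "fork x y \<Longrightarrow> D x y = K" "\<not> fork x y \<Longrightarrow> D' x y = D x y"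
  by (auto simp: D'_def fork_def)

lemma D'_le: "D' x y \<le> D x y"
  using L1 D'_fork[of x y] by (cases "fork x y") linarith+

lemma D'_le_\<delta>: "D' x y \<le> \<delta>"
  using D'_le D_bounds(2) by (rule order_trans)

lemma no_two_max:
  assumes "x \<noteq> y" "y \<noteq> z" "D x y = \<delta>" "D y z = \<delta>" "D x z = K"
  shows "fork x z"
  using large_max[of x y] large_max[of y z] assms unfolding fork_def by blast

section \<open>Triangles of \<open>D\<close> sorted by their forks\<close>

context
  fixes x y z :: 'b
  assumes xyz: "x \<noteq> y" "y \<noteq> z" "x \<noteq> z"
begin

lemma ne: "y \<noteq> x" "z \<noteq> y" "z \<noteq> x"
  using xyz by auto

lemmas bounds = D_bounds(1)[OF xyz(1)] D_bounds(1)[OF xyz(2)] D_bounds(1)[OF xyz(3)]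
  D_bounds(2)[of x y] D_bounds(2)[of y z] D_bounds(2)[of x z]

text \<open>Lowering \<open>K\<close> to \<open>L\<close> can only hurt if
  \<open>D x z = K + D y z\<close>. The contributions \<open>L\<close>, \<open>D y z\<close> and
  \<open>K - D y z\<close> then total \<open>2 * K - 1\<close>, too little for the odd closed walk
  they come from.\<close>

lemma metric_one_fork:
  assumes "fork x y" "\<not> fork y z" "\<not> fork x z"
  shows "D x z \<le> L + D y z"
proof (rule ccontr)
  assume neg: "\<not> ?thesis"
  then have eq: "D x z = K + D y z" using D_triangle[OF xyz] D'_fork(2)[OF assms(1)] L1 by linarith
  then have "K < D x z" "D y z < K" using bounds K by linarith+
  then obtain r where r: "att \<delta> x z 1 (D x z + r) r" using large[OF xyz(3)] by blast
  have "2 * K + 1 + (2 * \<delta> + 0 + (D x z + r)) \<le> (2 + 0 + 1) * (2 * K) + (0 + D y z + r)"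
    by (rule odd_triangle[OF fork_att[OF assms(1)] small[OF xyz(2) \<open>D y z < K\<close>] r]) (use eq K in presburger)
  with eq K show False by simp
qed

text \<open>A violation needs \<open>2 * K - 1 \<le> \<delta>\<close>, which leaves only
  \<open>K = 3\<close>, \<open>\<delta> = 5\<close>. There the contributions are 2, 2 and 1 instead
  of at least 7.\<close>

lemma metric_two_forks:
  assumes "fork x y" "fork y z" "\<not> fork x z"
  shows "D x z \<le> 2 * L"
proof (rule ccontr)
  assume "\<not> ?thesis"
  then have ge: "2 * K \<le> D x z + 1" using L1 by linarith
  then have K3: "K = 3" "\<delta> = 5" "D x z = 5" using bounds K by linarith+
  then obtain r where r: "att \<delta> x z 1 (D x z + r) r" "D x z + r \<le> \<delta>" using large[OF xyz(3)] by auto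
  have "2 * K + 1 + (2 * \<delta> + 2 * \<delta> + (D x z + r)) \<le> (2 + 2 + 1) * (2 * K) + (0 + 0 + r)"
    by (rule odd_triangle[OF fork_att[OF assms(1)] fork_att[OF assms(2)] r(1)]) (use K3 in simp)
  with K3 show False by simp
qed

lemma perimeter_no_fork:
  assumes "odd (D x y + D y z + D x z)"
  shows "2 * K < D x y + D y z + D x z"
proof (rule ccontr)
  assume neg: "\<not> ?thesis"
  then have "D x y + D y z + D x z < 2 * K" by (rule odd_less[OF assms])
  then have lt: "D x y < K" "D y z < K" "D x z < K" using D_metric[OF xyz] by linarith+
  from odd_triangle[OF small[OF xyz(1) lt(1)] small[OF xyz(2) lt(2)] small[OF xyz(3) lt(3)]] assms neg
  show False by simp
qed

text \<open>The triangle inequality for \<open>D\<close> and parity leave only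
  \<open>D y z + D x z = K\<close>, with total contribution
  \<open>L + K = 2 * K - 1\<close>.\<close>

lemma perimeter_one_fork:
  assumes "fork x y" "odd (D y z + D x z)"
  shows "K + 1 < D y z + D x z"
proof (rule ccontr)
  assume neg: "\<not> ?thesis"
  have "D x y = K" using assms(1) by (rule D'_fork)
  then have ge: "K \<le> D y z + D x z" using D_metric[OF xyz] by linarith
  have "D y z + D x z \<noteq> K + 1" using assms(2) K(2) by (metis even_plus_one_iff)
  then have eq: "D y z + D x z = K" using ge neg by linarith
  then have lt: "D y z < K" "D x z < K" using bounds by linarith+
  from odd_triangle[OF fork_att[OF assms(1)] small[OF xyz(2) lt(1)] small[OF xyz(3) lt(2)]] assms(2) eq K
  show False by simp
qed

lemma perimeter_two_forks:
  assumes "fork x y" "fork y z" "odd (D x z)"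
  shows "3 \<le> D x z"
proof (rule ccontr)
  assume neg: "\<not> ?thesis"
  then have "D x z \<noteq> 2" "D x z < 3" using assms(3) by (auto simp del: One_nat_def)
  then have eq: "D x z = 1" using bounds by linarith
  then have "D x z < K" using K by linarith
  from odd_triangle[OF fork_att[OF assms(1)] fork_att[OF assms(2)] small[OF xyz(3) this]] eq K
  show False by simp
qed

text \<open>If all sides exceed \<open>K\<close>, their contributions give the bound. Otherwise
  \<open>K + 2 * \<delta> = 4 * K + 1\<close> forces a violation to have sides \<open>K\<close>,
  \<open>\<delta>\<close>, \<open>\<delta>\<close>. Sides of length \<open>\<delta>\<close> are
  edges, so the side \<open>K\<close> is a fork.\<close>

lemma upper_no_fork:
  assumes "\<not> fork x y" "\<not> fork y z" "\<not> fork x z" "odd (D x y + D y z + D x z)"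
  shows "D x y + D y z + D x z < 4 * K + 1"
proof (cases "K < D x y \<and> K < D y z \<and> K < D x z")
  case True
  then obtain r1 r2 r3 where r: "att \<delta> x y 1 (D x y + r1) r1" "att \<delta> y z 1 (D y z + r2) r2" "att \<delta> x z 1 (D x z + r3) r3"
    using large[OF xyz(1)] large[OF xyz(2)] large[OF xyz(3)] by blast
  have "2 * K + 1 + (D x y + r1 + (D y z + r2) + (D x z + r3)) \<le> (1 + 1 + 1) * (2 * K) + (r1 + r2 + r3)"
    by (rule odd_triangle[OF r]) (use assms(4) in presburger)
  then show ?thesis by simp
next
  case False
  show ?thesis
  proof (rule ccontr)
    assume neg: "\<not> ?thesis"
    then consider "D x y = K" "D y z = \<delta>" "D x z = \<delta>" | "D y z = K" "D x y = \<delta>" "D x z = \<delta>" | "D x z = K" "D x y = \<delta>" "D y z = \<delta>"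
      using False bounds K by linarith
    then show False
    proof cases
      case 1
      then show False using no_two_max[of x z y] ne xyz assms(1) D_sym[of z y] by auto
    next
      case 2
      then show False using no_two_max[of y x z] ne xyz assms(2) D_sym[of y x] by auto
    next
      case 3
      then show False using no_two_max[of x y z] xyz assms(3) by auto
    qed
  qed
qed

lemma K2_no_fork:
  assumes "\<not> fork x z" "odd (D x y + D y z + D x z)"
  shows "D x y + D y z < 2 * K + D x z"
proof (rule ccontr)
  assume "\<not> ?thesis"
  with assms(2) have neg: "2 * K + D x z + 1 \<le> D x y + D y z" by (rule odd_ge)
  then have gt: "K < D x y" "K < D y z" using D_metric[OF xyz] by linarith+
  obtain r1 r2 where r: "att \<delta> x y 1 (D x y + r1) r1" "att \<delta> y z 1 (D y z + r2) r2"
    using large[OF xyz(1) gt(1)] large[OF xyz(2) gt(2)] by blast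
  show False
  proof (cases "D x z < K")
    case True
    have "2 * K + 1 + (D x y + r1 + (D y z + r2) + 0) \<le> (1 + 1 + 0) * (2 * K) + (r1 + r2 + D x z)"
      by (rule odd_triangle[OF r small[OF xyz(3) True]]) (use assms(2) in presburger)
    then show False using neg by simp
  next
    case False
    then have "D x z = K" "D x y = \<delta>" "D y z = \<delta>" using neg bounds K by linarith+
    then show False using no_two_max[OF xyz(1,2)] assms(1) by blast
  qed
qed

text \<open>Parity excludes \<open>3 * K - 1\<close> and \<open>2 * \<delta> = 3 * K + 1\<close>, so
  a violation has \<open>D x y + D y z = 3 * K\<close> and contributions
  \<open>K + L = 2 * K - 1\<close>.\<close>

lemma K2_fork:
  assumes "fork x z" "\<not> fork x y" "\<not> fork y z" "odd (D x y + D y z)"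
  shows "D x y + D y z < 2 * K + L"
proof (rule ccontr)
  assume "\<not> ?thesis"
  then have ge: "3 * K \<le> D x y + D y z + 1" using L1 by linarith
  have "odd (3 * K)" "even (2 * \<delta>)" using K(2) by simp_all
  then have "D x y + D y z + 1 \<noteq> 3 * K" "D x y + D y z \<noteq> 2 * \<delta>"
    using assms(4) by (metis even_plus_one_iff)+
  then have eq: "D x y + D y z = 3 * K" using ge bounds K by linarith
  then have gt: "K < D x y" "K < D y z" using bounds K by linarith+
  obtain r1 r2 where r: "att \<delta> x y 1 (D x y + r1) r1" "att \<delta> y z 1 (D y z + r2) r2"
    using large[OF xyz(1) gt(1)] large[OF xyz(2) gt(2)] by blast
  have "2 * K + 1 + (D x y + r1 + (D y z + r2) + 2 * \<delta>) \<le> (1 + 1 + 2) * (2 * K) + (r1 + r2 + 0)"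
    by (rule odd_triangle[OF r fork_att[OF assms(1)]]) (use assms(4) in presburger)
  then show False using eq K by simp
qed

lemma upper_even:
  assumes "even (D x y + D y z + D x z)"
  shows "D x y + D y z + D x z < C0"
proof (rule ccontr)
  assume neg: "\<not> ?thesis"
  then have "K < D x y" "K < D y z" "K < D x z" using bounds C0 K by linarith+
  then obtain r1 r2 r3 where r: "att \<delta> x y 1 (D x y + r1) r1" "att \<delta> y z 1 (D y z + r2) r2" "att \<delta> x z 1 (D x z + r3) r3"
    using large[OF xyz(1)] large[OF xyz(2)] large[OF xyz(3)] by blast
  have "D x y + r1 + (D y z + r2) + (D x z + r3) < C0 + (r1 + r2 + r3)"
    by (rule even_triangle[OF r]) (use assms in presburger)
  then show False using neg by linarith
qed

end

section \<open>Triangles of the corrected distance \<open>D'\<close>\<close>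

lemma D'_metric:
  assumes xyz: "x \<noteq> y" "y \<noteq> z" "x \<noteq> z"
  shows "D' x z \<le> D' x y + D' y z"
proof -
  note m = D_triangle[OF xyz]
  show ?thesis
  proof (cases "fork x z")
    case True
    then have "D x z = K" "D' x z = L" by (simp_all add: D'_fork)
    then show ?thesis using m L1 by (cases "fork x y"; cases "fork y z") (simp_all add: D'_fork)
  next
    case False
    have sym: "fork z y = fork y z" "fork y x = fork x y" "fork z x = fork x z" "D z x = D x z" "D y x = D x y"
      using fork_sym D_sym by blast+
    show ?thesis
    proof (cases "fork x y"; cases "fork y z")
      assume "fork x y" "fork y z"
      then show ?thesis using metric_two_forks[OF xyz] False by (simp add: D'_fork)
    next
      assume "fork x y" "\<not> fork y z"
      then show ?thesis using metric_one_fork[OF xyz] False by (simp add: D'_fork)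
    next
      assume "\<not> fork x y" "fork y z"
      then show ?thesis using metric_one_fork[of z y x] xyz False sym by (simp add: D'_fork add.commute)
    next
      assume "\<not> fork x y" "\<not> fork y z"
      then show ?thesis using m False by (simp add: D'_fork)
    qed
  qed
qed

lemma D'_K1:
  assumes xyz: "x \<noteq> y" "y \<noteq> z" "x \<noteq> z" and odd: "odd (D' x y + D' y z + D' x z)"
  shows "2 * K < D' x y + D' y z + D' x z"
proof -
  have one: "2 * K < L + D y z + D x z" if "x \<noteq> y" "y \<noteq> z" "x \<noteq> z" "fork x y" "odd (D y z + D x z)" for x y z
    using perimeter_one_fork[OF that(1-5)] L1 by linarith
  have two: "2 * K < L + L + D x z" if "x \<noteq> y" "y \<noteq> z" "x \<noteq> z" "fork x y" "fork y z" "odd (D x z)" for x y z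
    using perimeter_two_forks[OF that] L1 by linarith
  have sym: "fork z y = fork y z" "fork y x = fork x y" "D z x = D x z" "D y x = D x y" "D z y = D y z"
    using fork_sym D_sym by blast+
  have F1: "2 * K < L + D y z + D x z" if "fork x y" "odd (D y z + D x z)"
    using one[OF xyz that] .
  have F2: "2 * K < D x y + L + D x z" if "fork y z" "odd (D x y + D x z)"
    using one[of y z x] that xyz by (auto simp: sym)
  have F3: "2 * K < D x y + D y z + L" if "fork x z" "odd (D x y + D y z)"
    using one[of x z y] that xyz by (auto simp: sym)
  have T1: "2 * K < L + L + D x z" if "fork x y" "fork y z" "odd (D x z)"
    using two[OF xyz that] .
  have T2: "2 * K < L + D y z + L" if "fork x y" "fork x z" "odd (D y z)"
    using two[of y x z] that xyz by (auto simp: sym)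
  have T3: "2 * K < D x y + L + L" if "fork x z" "fork y z" "odd (D x y)"
    using two[of x z y] that xyz by (auto simp: sym)
  show ?thesis
    using odd perimeter_no_fork[OF xyz] F1 F2 F3 T1 T2 T3 even_L
    by (cases "fork x y"; cases "fork y z"; cases "fork x z") (simp_all add: D'_fork)
qed

lemma D'_upper_odd:
  assumes xyz: "x \<noteq> y" "y \<noteq> z" "x \<noteq> z" and odd: "odd (D' x y + D' y z + D' x z)"
  shows "D' x y + D' y z + D' x z < 4 * K + 1"
proof (cases "fork x y \<or> fork y z \<or> fork x z")
  case False
  then show ?thesis using upper_no_fork[OF xyz] odd by (simp add: D'_fork)
next
  case True
  have b: "D' x y \<le> \<delta>" "D' y z \<le> \<delta>" "D' x z \<le> \<delta>"
    by (rule D'_le_\<delta>)+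
  \<comment> \<open>\<open>2 * \<delta> + L = 4 * K\<close>: once a side is lowered, the bound holds
    without unfolding.\<close>
  have *: "a + b + L < 4 * K + 1" if "a \<le> \<delta>" "b \<le> \<delta>" for a b using that K L1 by linarith
  show ?thesis
    using True *[OF b(1,2)] *[OF b(2,3)] *[OF b(1,3)] by (auto simp: D'_fork ac_simps)
qed

lemma D'_upper_even:
  assumes xyz: "x \<noteq> y" "y \<noteq> z" "x \<noteq> z" and even: "even (D' x y + D' y z + D' x z)"
  shows "D' x y + D' y z + D' x z < C0"
proof (cases "fork x y \<or> fork y z \<or> fork x z")
  case False
  then show ?thesis using upper_even[OF xyz] even by (simp add: D'_fork)
next
  case True
  have b: "D' x y \<le> \<delta>" "D' y z \<le> \<delta>" "D' x z \<le> \<delta>"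
    by (rule D'_le_\<delta>)+
  have *: "a + b + L < C0" if "a \<le> \<delta>" "b \<le> \<delta>" for a b using that K L1 C0 by linarith
  show ?thesis
    using True *[OF b(1,2)] *[OF b(2,3)] *[OF b(1,3)] by (auto simp: D'_fork ac_simps)
qed

lemma D'_K2:
  assumes xyz: "x \<noteq> y" "y \<noteq> z" "x \<noteq> z" and odd: "odd (D' x y + D' y z + D' x z)"
  shows "D' x y + D' y z < 2 * K + D' x z"
proof -
  have sym: "D z x = D x z" "D y x = D x y" "D z y = D y z" using D_sym by blast+
  note m = D_metric[OF xyz]
  have b: "1 \<le> D x z" "D x y \<le> \<delta>" "D y z \<le> \<delta>" "\<delta> < 2 * K" using D_bounds xyz K by auto
  show ?thesis
  proof (cases "fork x y \<or> fork y z")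
    case False
    show ?thesis
    proof (cases "fork x z")
      case True
      then have "odd (D x y + D y z)" using False odd even_L by (simp add: D'_fork)
      then show ?thesis using K2_fork[OF xyz True] False True by (simp add: D'_fork)
    next
      case 2: False
      then show ?thesis using K2_no_fork[OF xyz 2] False odd by (simp add: D'_fork)
    qed
  next
    case True
    \<comment> \<open>With one fork, say at \<open>x\<close> and \<open>y\<close>, the triangle
      inequality bounds \<open>D y z\<close> by \<open>K + D x z\<close>, and
      \<open>L = K - 1\<close> makes the estimate strict.\<close>
    have "D' x y + D' y z < 2 * K + D x z" if "\<not> fork x z"
      using True m b L1 D'_fork(2)[of x y] D'_fork(2)[of y z] that
      by (cases "fork x y"; cases "fork y z") (simp_all add: D'_fork)
    moreover have "D' x y + D' y z < 2 * K + L" if "fork x z"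
      using True b L1 by (cases "fork x y"; cases "fork y z") (simp_all add: D'_fork)
    ultimately show ?thesis by (cases "fork x z") (simp_all add: D'_fork)
  qed
qed

lemma completes_D':
  assumes "4 * K + 1 \<le> C1"
  shows "completes \<delta> K K C0 C1 V d D'"
  unfolding completes_def
proof (intro conjI allI impI)
  fix x y z :: 'b assume xyz: "x \<noteq> y \<and> y \<noteq> z \<and> x \<noteq> z"
  show "triangle_ok K K C0 C1 (D' x y) (D' y z) (D' x z)"
  proof (rule triangle_okI[of D', OF D'_sym])
    show "odd_triangles_ok K K D'" using D'_K1 D'_K2 unfolding odd_triangles_ok_def by blast
    show "odd (D' x y + D' y z + D' x z) \<Longrightarrow> D' x y + D' y z + D' x z < C1"
      using D'_upper_odd[of x y z] xyz assms by auto
    show "even (D' x y + D' y z + D' x z) \<Longrightarrow> D' x y + D' y z + D' x z < C0"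
      using D'_upper_even[of x y z] xyz by auto
  qed (use xyz in auto)
  show "D' x z \<le> D' x y + D' y z" using D'_metric xyz by blast
next
  fix x y :: 'b show "D' x y = D' y x" by (rule D'_sym)
next
  fix x show "D' x x = 0" using K by (simp add: D'_def fork_def D_refl)
next
  fix x y :: 'b assume "x \<noteq> y"
  moreover have "1 \<le> L" using L1 K by linarith
  ultimately show "1 \<le> D' x y" using D_bounds(1)[of x y] by (simp add: D'_def)
next
  fix x y show "D' x y \<le> \<delta>" by (rule D'_le_\<delta>)
next
  fix x y assume e: "d x y \<noteq> 0"
  have "\<not> fork x y"
  proof
    assume f: "fork x y"
    have "x \<noteq> y" using e irr by auto
    have "D x y = K" using f by (rule D'_fork)
    then have "d x y = K" using D_edge[OF e] by simp
    then have "att 1 y x 1 K 0" using att_sym[OF att_edge[OF e]] by simp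
    \<comment> \<open>An edge of label \<open>K\<close> would close the fork to a walk with three
      chosen labels of odd sum \<open>2 * \<delta> + K = 4 * K + 1\<close>, against the bound for
      \<open>k = 3\<close>. So lowering never touches an edge.\<close>
    note att_closed[OF att_trans[OF fork_att[OF f] this]]
    moreover have "\<delta> + 1 \<le> 20 * \<delta>" using K by linarith
    ultimately have "\<Phi>_IIB (3 * \<delta>) K C0 (2 + 1) (2 * \<delta> + K) (0 + 0)" by blast
    then show False using K by (simp add: \<Phi>_IIB_def)
  qed
  then show "D' x y = d x y" using D_edge[OF e] by (simp add: D'_fork)
next
  fix g x y assume g: "lgraph_auto V d g"
  then have perm: "g permutes V" and pres: "\<And>x y. d (g x) (g y) = d x y" by (auto simp: lgraph_auto_def)
  have surj: "\<exists>w. z = g w" for z using permutes_surj[OF perm] by (metis surjD)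
  have "(\<exists>z. d (g x) z = \<delta> \<and> d z (g y) = \<delta>) \<longleftrightarrow> (\<exists>z. d x z = \<delta> \<and> d z y = \<delta>)"
    using surj pres by metis
  then show "D' (g x) (g y) = D' x y" unfolding D'_def fork_def D_auto[OF g] by simp
qed

end

lemma completes_IIB:
  assumes "lgraph \<delta> V d" "cycles_good (\<Phi>_IIB (3 * \<delta>) K C0) d (20 * \<delta>)"
    and "3 * K + 1 = 2 * \<delta>" "odd K" "3 \<le> K" "4 * K + 4 \<le> C0" "4 * K + 1 \<le> C1"
  shows "\<exists>D. completes \<delta> K K C0 C1 V d D"
proof -
  interpret completion_IIB \<delta> K C0 V d
    using assms by unfold_locales (auto simp: \<Phi>_IIB_def cover_ok_def)
  show ?thesis using completes_D'[OF assms(7)] by (rule exI[of _ D'])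
qed

section \<open>The main theorem\<close>

lemma rels_metric_structure:
  "(x, y) \<in> rels (metric_structure \<delta> V d) i \<longleftrightarrow> 1 \<le> i \<and> i \<le> \<delta> \<and> x \<in> V \<and> y \<in> V \<and> d x y = i"
  by (auto simp: metric_structure_def)

lemma verts_metric_structure: "verts (metric_structure \<delta> V d) = V"
  by (simp add: metric_structure_def)

lemma completesD:
  assumes "completes \<delta> K1 K2 C0 C1 V d D"
  shows "D x y = D y x" "D x x = 0" "x \<noteq> y \<Longrightarrow> 1 \<le> D x y" "D x y \<le> \<delta>"
    "d x y \<noteq> 0 \<Longrightarrow> D x y = d x y" "lgraph_auto V d g \<Longrightarrow> D (g x) (g y) = D x y"
    "x \<noteq> y \<Longrightarrow> y \<noteq> z \<Longrightarrow> x \<noteq> z \<Longrightarrow> D x z \<le> D x y + D y z"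
    "x \<noteq> y \<Longrightarrow> y \<noteq> z \<Longrightarrow> x \<noteq> z \<Longrightarrow> triangle_ok K1 K2 C0 C1 (D x y) (D y z) (D x z)"
proof -
  note c1 = assms[unfolded completes_def]
  note c2 = c1[THEN conjunct2]
  note c3 = c2[THEN conjunct2]
  note c4 = c3[THEN conjunct2]
  note c5 = c4[THEN conjunct2]
  note c6 = c5[THEN conjunct2]
  note c7 = c6[THEN conjunct2, rule_format, of x y z]
  show "D x y = D y x" by (rule c1[THEN conjunct1, rule_format])
  show "D x x = 0" by (rule c2[THEN conjunct1, rule_format])
  show "x \<noteq> y \<Longrightarrow> 1 \<le> D x y" by (rule c3[THEN conjunct1, rule_format])
  show "D x y \<le> \<delta>" by (rule c4[THEN conjunct1, rule_format])
  show "d x y \<noteq> 0 \<Longrightarrow> D x y = d x y" by (rule c5[THEN conjunct1, rule_format])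
  show "lgraph_auto V d g \<Longrightarrow> D (g x) (g y) = D x y" by (rule c6[THEN conjunct1, rule_format])
  show "x \<noteq> y \<Longrightarrow> y \<noteq> z \<Longrightarrow> x \<noteq> z \<Longrightarrow> D x z \<le> D x y + D y z"
    "x \<noteq> y \<Longrightarrow> y \<noteq> z \<Longrightarrow> x \<noteq> z \<Longrightarrow> triangle_ok K1 K2 C0 C1 (D x y) (D y z) (D x z)"
    using c7 by simp_all
qed

lemma completes_metric_class:
  assumes "completes \<delta> K1 K2 C0 C1 V d D" "finite V"
  shows "metric_structure \<delta> V D \<in> metric_class \<delta> K1 K2 C0 C1"
proof -
  note D = completesD[OF assms(1)]
  have tri: "D x z \<le> D x y + D y z" for x y z
    using D(7)[of x y z] D(2)[of x] D(2)[of y] by (cases "x = y"; cases "y = z"; cases "x = z") auto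
  have "Metric_space V (\<lambda>x y. real (D x y))"
  proof
    fix x y z
    show "real (D x y) = real (D y x)" using D(1)[of x y] by simp
    show "real (D x y) = 0 \<longleftrightarrow> x = y" using D(2)[of x] D(3)[of x y] by (cases "x = y") auto
    show "real (D x z) \<le> real (D x y) + real (D y z)" using tri[where x = x and y = y and z = z] by linarith
  qed simp
  then have "valued_metric_space \<delta> V D" using D(4) by (simp add: valued_metric_space_def)
  moreover have "\<forall>x\<in>V. \<forall>y\<in>V. \<forall>z\<in>V. x \<noteq> y \<and> y \<noteq> z \<and> x \<noteq> z \<longrightarrow> triangle_ok K1 K2 C0 C1 (D x y) (D y z) (D x z)"
    using D(8) by simp
  ultimately show ?thesis using assms(2) unfolding metric_class_def by blast
qed

lemma partial_isometry_of_partial_automorphism: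
  assumes "partial_automorphism (metric_structure \<delta> X \<rho>) D f"
    and range: "\<And>x y. x \<in> X \<Longrightarrow> y \<in> X \<Longrightarrow> x \<noteq> y \<Longrightarrow> \<rho> x y \<in> {1..\<delta>}" and refl: "\<And>x. \<rho> x x = 0"
  shows "partial_isometry X \<rho> D f"
proof -
  obtain E where DE: "D \<subseteq> X" "E \<subseteq> X" and iso: "isomorphism (induced (metric_structure \<delta> X \<rho>) D) (induced (metric_structure \<delta> X \<rho>) E) f"
    using assms(1) by (auto simp: partial_automorphism_def verts_metric_structure)
  have fD: "f ` D = E" "inj_on f D" and rel: "\<And>i x y. x \<in> D \<Longrightarrow> y \<in> D \<Longrightarrow>
      (x, y) \<in> rels (metric_structure \<delta> X \<rho>) i \<longleftrightarrow> (f x, f y) \<in> rels (metric_structure \<delta> X \<rho>) i"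
    using iso by (auto simp: isomorphism_def embedding_def induced_def)
  have "\<rho> (f x) (f y) = \<rho> x y" if "x \<in> D" "y \<in> D" for x y
  proof (cases "x = y")
    case False
    have "(x, y) \<in> rels (metric_structure \<delta> X \<rho>) (\<rho> x y)"
      using range[of x y] that DE False by (auto simp: rels_metric_structure)
    then have "(f x, f y) \<in> rels (metric_structure \<delta> X \<rho>) (\<rho> x y)" using rel[OF that] by blast
    then show ?thesis by (simp add: rels_metric_structure)
  qed (simp add: refl)
  with DE fD show ?thesis by (auto simp: partial_isometry_def)
qed

lemma has_EPPA_metric_class:
  assumes cc: "cycle_condition \<delta> \<Phi>" and \<delta>: "1 \<le> \<delta>"
    and tri: "\<And>a b c. a \<le> \<delta> \<Longrightarrow> b \<le> \<delta> \<Longrightarrow> c \<le> \<delta> \<Longrightarrow> a \<le> b + c \<Longrightarrow> b \<le> a + c \<Longrightarrow> c \<le> a + b \<Longrightarrow>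
      triangle_ok K1 K2 C0 C1 a b c \<Longrightarrow> good \<Phi> {#a, b, c#}"
    and comp: "\<And>(V :: 'v::infinite set) d. lgraph \<delta> V d \<Longrightarrow> cycles_good \<Phi> d (20 * \<delta>) \<Longrightarrow>
      \<exists>D. completes \<delta> K1 K2 C0 C1 V d D"
  shows "has_EPPA (metric_class \<delta> K1 K2 C0 C1 :: (nat, 'v) rel_structure set)"
  unfolding has_EPPA_def
proof
  fix A :: "(nat, 'v) rel_structure" assume "A \<in> metric_class \<delta> K1 K2 C0 C1"
  then obtain X \<rho>0 where A: "A = metric_structure \<delta> X \<rho>0" and X: "finite X"
    and ms: "Metric_space X (\<lambda>x y. real (\<rho>0 x y))" and le: "\<And>x y. x \<in> X \<Longrightarrow> y \<in> X \<Longrightarrow> \<rho>0 x y \<le> \<delta>"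
    and ok: "\<And>x y z. x \<in> X \<Longrightarrow> y \<in> X \<Longrightarrow> z \<in> X \<Longrightarrow> x \<noteq> y \<Longrightarrow> y \<noteq> z \<Longrightarrow> x \<noteq> z \<Longrightarrow>
      triangle_ok K1 K2 C0 C1 (\<rho>0 x y) (\<rho>0 y z) (\<rho>0 x z)"
    unfolding metric_class_def valued_metric_space_def by auto
  interpret ms: Metric_space X "\<lambda>x y. real (\<rho>0 x y)" by (fact ms)
  \<comment> \<open>Nothing is known about \<open>\<rho>0 x x\<close> outside \<open>X\<close>;
    cutting off there makes the diagonal vanish everywhere.\<close>
  define \<rho> where "\<rho> x y = (if x \<in> X \<and> y \<in> X then \<rho>0 x y else 0)" for x y
  have \<rho>: "\<rho> x y = \<rho>0 x y" if "x \<in> X" "y \<in> X" for x y using that by (simp add: \<rho>_def)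
  have A\<rho>: "A = metric_structure \<delta> X \<rho>"
    unfolding A metric_structure_def by (auto simp: fun_eq_iff \<rho>)
  have sym: "\<rho> x y = \<rho> y x" for x y using ms.commute[of x y] by (auto simp: \<rho>_def)
  have zero: "\<rho>0 x y = 0 \<longleftrightarrow> x = y" if "x \<in> X" "y \<in> X" for x y
  proof -
    have "real (\<rho>0 x y) = 0 \<longleftrightarrow> x = y" using that by (rule ms.zero)
    then show ?thesis by simp
  qed
  have refl: "\<rho> x x = 0" for x using zero[of x x] by (simp add: \<rho>_def)
  have range: "\<rho> x y \<in> {1..\<delta>}" if "x \<in> X" "y \<in> X" "x \<noteq> y" for x y
    using zero[OF that(1,2)] le[OF that(1,2)] that by (simp add: \<rho> Suc_le_eq)
  have metric: "\<rho> x z \<le> \<rho> x y + \<rho> y z" if "x \<in> X" "y \<in> X" "z \<in> X" for x y z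
    using ms.triangle[OF that] that by (simp add: \<rho>)
  have good3: "good \<Phi> {#\<rho> x y, \<rho> y z, \<rho> z x#}"
    if "x \<in> X" "y \<in> X" "z \<in> X" "x \<noteq> y" "y \<noteq> z" "x \<noteq> z" for x y z
  proof (rule tri)
    show "\<rho> x y \<le> \<delta>" "\<rho> y z \<le> \<delta>" "\<rho> z x \<le> \<delta>" using le that by (simp_all add: \<rho>)
    show "\<rho> x y \<le> \<rho> y z + \<rho> z x" "\<rho> y z \<le> \<rho> x y + \<rho> z x" "\<rho> z x \<le> \<rho> x y + \<rho> y z"
      using metric[OF that(1,3,2)] metric[OF that(2,1,3)] metric[OF that(3,2,1)] sym[of z y] sym[of y x] sym[of x z]
      by linarith+
    show "triangle_ok K1 K2 C0 C1 (\<rho> x y) (\<rho> y z) (\<rho> z x)"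
      using ok[OF that] that sym[of z x] by (simp add: \<rho>)
  qed
  interpret cycle_condition \<delta> \<Phi> by (fact cc)
  obtain V :: "'v set" and d \<alpha> where G: "lgraph \<delta> V d" and W: "EPPA_witness X \<rho> V d \<alpha>"
    and cg: "cycles_good \<Phi> d ((20 * \<delta> - 2) + 2)"
    using EPPA_witness_cycles_good[where \<rho> = \<rho> and n = "20 * \<delta> - 2", OF X sym refl range \<delta> good3] by blast
  have "(20 * \<delta> - 2) + 2 = 20 * \<delta>" using \<delta> by simp
  with cg G obtain D where D: "completes \<delta> K1 K2 C0 C1 V d D" using comp by metis
  have W': "\<alpha> ` X \<subseteq> V" "\<And>x y. x \<in> X \<Longrightarrow> y \<in> X \<Longrightarrow> d (\<alpha> x) (\<alpha> y) = \<rho> x y"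
    using W by (auto simp: EPPA_witness_def)
  have Dd: "D (\<alpha> x) (\<alpha> y) = \<rho> x y" if "x \<in> X" "y \<in> X" for x y
  proof (cases "x = y")
    case True
    then show ?thesis using completesD(2)[OF D] refl by simp
  next
    case False
    then have "d (\<alpha> x) (\<alpha> y) \<noteq> 0" using W'(2)[OF that] range[OF that False] by auto
    then show ?thesis using completesD(5)[OF D] W'(2)[OF that] by simp
  qed
  let ?B = "metric_structure \<delta> V D"
  have "?B \<in> metric_class \<delta> K1 K2 C0 C1"
    using D G by (intro completes_metric_class) (auto simp: lgraph_def)
  moreover have "embedding A ?B \<alpha>"
    unfolding embedding_def A\<rho>
  proof (intro conjI allI ballI)
    show "\<alpha> ` verts (metric_structure \<delta> X \<rho>) \<subseteq> verts ?B" using W' by (simp add: verts_metric_structure)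
    show "inj_on \<alpha> (verts (metric_structure \<delta> X \<rho>))"
    proof (rule inj_onI)
      fix x y assume xy: "x \<in> verts (metric_structure \<delta> X \<rho>)" "y \<in> verts (metric_structure \<delta> X \<rho>)" "\<alpha> x = \<alpha> y"
      then have xX: "x \<in> X" "y \<in> X" by (simp_all add: verts_metric_structure)
      have "\<rho> x y = 0" using Dd[OF xX] Dd[OF xX(1) xX(1)] refl[of x] xy(3) by simp
      then show "x = y" using range[OF xX] by fastforce
    qed
    fix i x y assume "x \<in> verts (metric_structure \<delta> X \<rho>)" "y \<in> verts (metric_structure \<delta> X \<rho>)"
    then have xX: "x \<in> X" "y \<in> X" by (simp_all add: verts_metric_structure)
    then have "\<alpha> x \<in> V" "\<alpha> y \<in> V" using W'(1) by auto
    then show "(x, y) \<in> rels (metric_structure \<delta> X \<rho>) i \<longleftrightarrow> (\<alpha> x, \<alpha> y) \<in> rels ?B i"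
      using Dd[OF xX] xX by (simp add: rels_metric_structure)
  qed
  moreover have "\<exists>g. automorphism ?B g \<and> (\<forall>x\<in>F. \<alpha> (f x) = g (\<alpha> x))" if "partial_automorphism A F f" for F f
  proof -
    have "partial_isometry X \<rho> F f"
      using that unfolding A\<rho> by (rule partial_isometry_of_partial_automorphism) (use range refl in auto)
    then have "\<exists>g. lgraph_auto V d g \<and> (\<forall>x\<in>F. g (\<alpha> x) = \<alpha> (f x))"
      using W by (simp add: EPPA_witness_def)
    then obtain g where g: "lgraph_auto V d g" "\<forall>x\<in>F. g (\<alpha> x) = \<alpha> (f x)" by blast
    then have perm: "g permutes V" by (simp add: lgraph_auto_def)
    have Dg: "D (g x) (g y) = D x y" for x y by (rule completesD(6)[OF D g(1)])
    have "automorphism ?B g"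
      unfolding automorphism_def isomorphism_def embedding_def rels_metric_structure verts_metric_structure Dg
      using permutes_image[OF perm] permutes_inj_on[OF perm] permutes_in_image[OF perm] by auto
    with g(2) show ?thesis by auto
  qed
  ultimately show "\<exists>B\<in>metric_class \<delta> K1 K2 C0 C1. \<exists>\<alpha> :: 'v \<Rightarrow> 'v. embedding A B \<alpha> \<and>
     (\<forall>D f. partial_automorphism A D f \<longrightarrow> (\<exists>g. automorphism B g \<and> (\<forall>x\<in>D. \<alpha> (f x) = g (\<alpha> x))))"
    by blast
qed

section \<open>Choice of \<open>Q\<close> and \<open>M\<close> for admissible parameters\<close>

lemma EPPA_case_II:
  assumes acc: "acceptable \<delta> K1 K2 C0 C1" and II: "case_II \<delta> K1 K2 (min C0 C1) (max C0 C1)"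
  shows "has_EPPA (metric_class \<delta> K1 K2 C0 C1 :: (nat, 'v::infinite) rel_structure set)"
proof -
  have a: "3 \<le> \<delta>" "1 \<le> K1" "K1 \<le> K2" "K2 \<le> \<delta>" "2 * \<delta> + 2 \<le> C1" "C1 \<le> 3 * \<delta> + 2" "even C0" "odd C1"
    using acc by (auto simp: acceptable_def)
  \<comment> \<open>The smaller bound is \<open>2 * K1 + 2 * K2 + 1\<close>, so by parity it is
    \<open>C1\<close>.\<close>
  have "odd (min C0 C1)" using II by (simp add: case_II_def)
  then have min: "min C0 C1 = C1" "max C0 C1 = C0" using a(7) by (auto simp: min_def max_def split: if_splits)
  have b: "C1 = 2 * K1 + 2 * K2 + 1" "\<delta> \<le> K1 + K2" "K1 + 2 * K2 \<le> 2 * \<delta> - 1"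
    "C0 = C1 + 1 \<or> C1 + 1 < C0 \<and> K1 = K2 \<and> 3 * K2 = 2 * \<delta> - 1"
    using II unfolding case_II_def min by auto
  from b(4) show ?thesis
  proof
    assume C0: "C0 = C1 + 1"
    define Q where "Q = 2 * K1 + 2 * K2"
    \<comment> \<open>The least value with \<open>K1 \<le> M\<close> and
      \<open>\<delta> \<le> 2 * M\<close>. The upper bounds \<open>K2\<close> and
      \<open>(Q - \<delta>) / 2\<close> are met thanks to \<open>\<delta> \<le> K1 + K2\<close> and
      \<open>2 * \<delta> + 2 \<le> C1\<close>.\<close>
    define M where "M = max K1 ((\<delta> + 1) div 2)"
    have h: "\<delta> \<le> 2 * ((\<delta> + 1) div 2)" "2 * ((\<delta> + 1) div 2) \<le> \<delta> + 1" by linarith+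
    have M: "1 \<le> M" "M \<le> \<delta>" "\<delta> \<le> 2 * M" "2 * M + \<delta> \<le> Q" "K1 \<le> M" "M \<le> K2"
      using a b h by (auto simp: M_def Q_def max_def)
    show ?thesis
    proof (rule has_EPPA_metric_class)
      show "cycle_condition \<delta> (\<Phi>_IIA Q K1)"
        by (rule cycle_condition_IIA) (use a b in \<open>auto simp: Q_def\<close>)
      fix x y z assume t: "x \<le> \<delta>" "y \<le> \<delta>" "z \<le> \<delta>" "x \<le> y + z" "y \<le> x + z" "z \<le> x + y" and ok: "triangle_ok K1 K2 C0 C1 x y z"
      have "x + y + z < C1"
      proof (cases "odd (x + y + z)")
        case False
        then have "x + y + z < C1 + 1" "x + y + z \<noteq> C1" using ok a(8) C0 by (auto simp: triangle_ok_iff)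
        then show ?thesis by linarith
      qed (use ok in \<open>auto simp: triangle_ok_iff\<close>)
      then have "x + y + z \<le> Q" using b(1) by (simp add: Q_def)
      then show "good (\<Phi>_IIA Q K1) {#x, y, z#}" using good_triangle(1)[OF t ok] by (simp add: Q_def)
    next
      fix V :: "'v set" and d assume "lgraph \<delta> V d" "cycles_good (\<Phi>_IIA Q K1) d (20 * \<delta>)"
      then show "\<exists>D. completes \<delta> K1 K2 C0 C1 V d D"
        by (rule completes_IIA) (use a b C0 M in \<open>auto simp: Q_def\<close>)
    qed (use a in auto)
  next
    assume IIB: "C1 + 1 < C0 \<and> K1 = K2 \<and> 3 * K2 = 2 * \<delta> - 1"
    have K: "3 * K2 + 1 = 2 * \<delta>" "odd K2" "3 \<le> K2" "4 * K2 + 4 \<le> C0" "C1 = 4 * K2 + 1"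
    proof -
      show 1: "3 * K2 + 1 = 2 * \<delta>" using IIB a(1) by linarith
      then show 2: "odd K2" by presburger
      show "3 \<le> K2" using 1 2 a(1) by presburger
      show C1: "C1 = 4 * K2 + 1" using IIB b(1) by simp
      then have "4 * K2 + 2 < C0" using IIB by simp
      then show "4 * K2 + 4 \<le> C0" using a(7) by presburger
    qed
    show ?thesis
    proof (rule has_EPPA_metric_class)
      show "cycle_condition \<delta> (\<Phi>_IIB (3 * \<delta>) K2 C0)"
        using K(1-4) by (rule cycle_condition_IIB) (use a in simp)
      fix x y z assume t: "x \<le> \<delta>" "y \<le> \<delta>" "z \<le> \<delta>" "x \<le> y + z" "y \<le> x + z" "z \<le> x + y" and ok: "triangle_ok K1 K2 C0 C1 x y z"
      show "good (\<Phi>_IIB (3 * \<delta>) K2 C0) {#x, y, z#}"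
        using good_triangle(4)[OF t ok] t K(5) IIB by simp
    next
      fix V :: "'v set" and d assume "lgraph \<delta> V d" "cycles_good (\<Phi>_IIB (3 * \<delta>) K2 C0) d (20 * \<delta>)"
      then have "\<exists>D. completes \<delta> K2 K2 C0 C1 V d D"
        by (rule completes_IIB) (use K in auto)
      then show "\<exists>D. completes \<delta> K1 K2 C0 C1 V d D" using IIB by simp
    qed (use a in auto)
  qed
qed

lemma EPPA_case_III:
  assumes acc: "acceptable \<delta> K1 K2 C0 C1" and III: "case_III \<delta> K1 K2 (min C0 C1) (max C0 C1)"
  shows "has_EPPA (metric_class \<delta> K1 K2 C0 C1 :: (nat, 'v::infinite) rel_structure set)"
proof -
  define C where "C = min C0 C1"
  have a: "3 \<le> \<delta>" "1 \<le> K1" "K1 \<le> K2" "K2 \<le> \<delta>" "2 * \<delta> + 2 \<le> C" "C \<le> 3 * \<delta> + 2" "even C0" "odd C1" "C \<le> C0" "C \<le> C1"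
    using acc by (auto simp: acceptable_def C_def)
  have b: "2 * \<delta> + K1 + 1 \<le> C" "2 * \<delta> \<le> K1 + 2 * K2 + 1" "2 * \<delta> \<le> 3 * K2"
    "2 * \<delta> = K1 + 2 * K2 + 1 \<Longrightarrow> 2 * \<delta> + K1 + 2 \<le> C" "max C0 C1 > C + 1 \<Longrightarrow> 2 * \<delta> + K2 \<le> C"
    using III a(1) unfolding case_III_def C_def[symmetric] by auto
  have h: "\<delta> \<le> 2 * ((\<delta> + 1) div 2)" "2 * ((\<delta> + 1) div 2) \<le> \<delta> + 1" by linarith+
  \<comment> \<open>The three terms are the lower bounds on \<open>M\<close> from the
    \<open>K1\<close>-bound, from the metric completion and from the
    \<open>K2\<close>-bound.\<close>
  define M where "M = max (max K1 ((\<delta> + 1) div 2)) (2 * \<delta> - 2 * K2)"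
  have M': "M = K1 \<or> M = (\<delta> + 1) div 2 \<or> M = 2 * \<delta> - 2 * K2" unfolding M_def by (simp add: max_def)
  have M: "1 \<le> M" "M \<le> \<delta>" "\<delta> \<le> 2 * M" "K1 \<le> M" "M \<le> K2" "2 * \<delta> \<le> 2 * K2 + M"
    using a b h by (auto simp: M_def)
  have "C0 \<noteq> C1" using a(7,8) by auto
  then consider "max C0 C1 = C + 1" | "max C0 C1 > C + 1" unfolding C_def by linarith
  then show ?thesis
  proof cases
    case 1
    define Q where "Q = C - 1"
    have QM: "2 * M + \<delta> \<le> Q" using M' a b h unfolding Q_def by linarith
    have Q: "Q < C0" "Q < C1" "2 * \<delta> + 1 \<le> Q" "Q \<le> 3 * \<delta> + 1" using a by (auto simp: Q_def)
    show ?thesis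
    proof (rule has_EPPA_metric_class)
      show "cycle_condition \<delta> (\<Phi>_K Q K1 K2)"
        by (rule cycle_condition_K) (use a b Q in auto)
      fix x y z assume t: "x \<le> \<delta>" "y \<le> \<delta>" "z \<le> \<delta>" "x \<le> y + z" "y \<le> x + z" "z \<le> x + y" and ok: "triangle_ok K1 K2 C0 C1 x y z"
      \<comment> \<open>Perimeters with the parity of the smaller bound \<open>C\<close> are below
        it by definition; the others are below \<open>C + 1\<close> and cannot equal
        \<open>C\<close>.\<close>
      have "x + y + z < C"
      proof (cases "odd (x + y + z)")
        case True
        then have "x + y + z < C1" "x + y + z \<noteq> C0" using ok a(7) by (auto simp: triangle_ok_iff)
        then show ?thesis using 1 by (auto simp: C_def min_def max_def split: if_splits)
      next
        case False
        then have "x + y + z < C0" "x + y + z \<noteq> C1" using ok a(8) by (auto simp: triangle_ok_iff)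
        then show ?thesis using 1 by (auto simp: C_def min_def max_def split: if_splits)
      qed
      then have "x + y + z \<le> Q" by (simp add: Q_def)
      then show "good (\<Phi>_K Q K1 K2) {#x, y, z#}" using good_triangle(2)[OF t ok] by simp
    next
      fix V :: "'v set" and d assume "lgraph \<delta> V d" "cycles_good (\<Phi>_K Q K1 K2) d (20 * \<delta>)"
      then show "\<exists>D. completes \<delta> K1 K2 C0 C1 V d D"
      proof (rule completes_IIIA[where M = M])
        show "2 * \<delta> + K1 \<le> Q" using b(1) by (simp add: Q_def)
        show "2 * \<delta> = K1 + 2 * K2 + 1 \<Longrightarrow> 2 * \<delta> + K1 + 1 \<le> Q" using b(4) by (simp add: Q_def)
      qed (fact Q M QM b(2))+
    qed (use a in auto)
  next
    case 2
    have K2C: "2 * \<delta> + K2 \<le> C" using b(5) 2 by blast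
    have CM: "M + 2 * \<delta> + 1 \<le> C" using M' a b(1-4) h K2C by linarith
    show ?thesis
    proof (rule has_EPPA_metric_class)
      show "cycle_condition \<delta> (\<Phi>_KC (3 * \<delta>) K1 K2 C0 C1)"
        by (rule cycle_condition_KC) (use a b(2,3) K2C in linarith)+
      fix x y z assume t: "x \<le> \<delta>" "y \<le> \<delta>" "z \<le> \<delta>" "x \<le> y + z" "y \<le> x + z" "z \<le> x + y" and ok: "triangle_ok K1 K2 C0 C1 x y z"
      show "good (\<Phi>_KC (3 * \<delta>) K1 K2 C0 C1) {#x, y, z#}"
        using good_triangle(3)[OF t ok] t by simp
    next
      fix V :: "'v set" and d assume "lgraph \<delta> V d" "cycles_good (\<Phi>_KC (3 * \<delta>) K1 K2 C0 C1) d (20 * \<delta>)"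
      then show "\<exists>D. completes \<delta> K1 K2 C0 C1 V d D"
        by (rule completes_IIIB[where M = M]) (use a b(2,3) M CM in linarith)+
    qed (use a in auto)
  qed
qed

theorem theorem6p2:
  fixes \<delta> K\<^sub>1 K\<^sub>2 C\<^sub>0 C\<^sub>1 :: nat
  assumes "admissible \<delta> K\<^sub>1 K\<^sub>2 C\<^sub>0 C\<^sub>1"
  shows "has_EPPA (metric_class \<delta> K\<^sub>1 K\<^sub>2 C\<^sub>0 C\<^sub>1 :: (nat, 'v::infinite) rel_structure set)"
  using assms EPPA_case_II EPPA_case_III unfolding admissible_def by blast

end
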